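(* Let $K=[a_1,b_1]\times\cdots\times[a_n,b_n]\supset\Gamma$, let $k\in\mathbb N$ and $f\in\mathscr C^k(K)$. Then there exists $C(f,K,n,k)>0$ (independent of $N$) such that for all $N\ge1$, $$\Bigl|\mathcal Q_C^{N,n}[f]-\int_\Gamma f\,d\mu\Bigr|\le C(f,K,n,k)\,\bigl(1+|\mathbf w_C^{N,n}|_1\bigr)\,N^{-k}.$$ If moreover the spaces $\mathbb Q_N$ are $\mathscr S$-invariant for all $N\ge0$, then, for some $c>0$ independent of $N$ and for all $N\ge1$, $$\Bigl|\mathcal Q_C^{N,n}[f]-\int_\Gamma f\,d\mu\Bigr|\le c\cdot C(f,K,n,k)\,\log^n(N+1)\,N^{-k}.$$
   Context: Affine IFS: $\mathscr S=\{S_\ell:\mathbb R^n\to\mathbb R^n\}_{\ell=1}^L$, $L\ge2$, with $S_\ell(x)=A_\ell x+b_\ell$ and spectral norm $\rho_\ell=\|A_\ell\|<1$. Its attractor $\Gamma$ is the unique nonempty compact set with $\Gamma=\bigcup_{\ell=1}^L S_\ell(\Gamma)$. Fix $\mu_1,\dots,\mu_L\in(0,1)$ with $\sum_\ell\mu_\ell=1$; $\mu$ is the unique Borel regular probability measure (on a closed ball $F$ with $\bigcup_\ell S_\ell(F)\subset F$) satisfying $\mu=\sum_\ell\mu_\ell\,\mu\circ S_\ell^{-1}$; its support is $\Gamma$. Ruelle operator: $\mathscr F[f]=\sum_{\ell=1}^L\mu_\ell\, f\circ S_\ell$. A finite-dimensional space $\mathcal P$ of polynomials is $\mathscr S$-invariant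 if it contains the constants and $\mathscr F(\mathcal P)\subset\mathcal P$. $\mathbb Q_N=\operatorname{span}\{x^{\boldsymbol\alpha}:\max_i\alpha_i\le N\}$. Chebyshev tensor-product cubature: $a_i<b_i$, and $\mathcal X=\mathcal X_1^N\times\cdots\times\mathcal X_n^N=\{x_1,\dots,x_M\}$, $M=(N+1)^n$, where $\mathcal X_i^N$ is the set of $N+1$ Chebyshev nodes on $[a_i,b_i]$, i.e. the image under the affine map $[-1,1]\to[a_i,b_i]$ of $\{\cos\frac{(2j+1)\pi}{2N+2}\}_{j=0}^N$ (first kind) or $\{\cos\frac{j\pi}{N}\}_{j=0}^N$ (second kind). These points are unisolvent for $\mathbb Q_N$, with Lagrange polynomials $\mathscr L_i\in\mathbb Q_N$, $\mathscr L_i(x_j)=\delta_{i,j}$. The weights $\mathbf w_C^{N,n}\in\mathbb R^M$ are a vector satisfying $\mathbf S^\top\mathbf w_C^{N,n}=\mathbf w_C^{N,n}$ and $\sum_i(\mathbf w_C^{N,n})_i=1$, where $\mathbf S_{i,j}=\sum_\ell\mu_\ell\,\mathscr L_j(S_\ell(x_i))$ (such a vector is assumed to exist), and $\mathcal Q_C^{N,n}[f]=\sum_{i=1}^M(\mathbf w_C^{N,n})_i f(x_i)$. $|\cdot|_1$ is the $\ell^1$ norm. *)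

theory Defs
  imports "HOL-Analysis.Analysis" "HOL-Probability.Probability_Measure"
begin

subsection \<open>Affine iterated function systems\<close>

definition affine_ifs :: "nat \<Rightarrow> (nat \<Rightarrow> real^'n \<Rightarrow> real^'n) \<Rightarrow> bool" where
  "affine_ifs L S \<longleftrightarrow> 2 \<le> L \<and>
     (\<forall>l<L. \<exists>(A :: real^'n^'n) b. onorm ((*v) A) < 1 \<and> S l = (\<lambda>x. A *v x + b))"

definition is_attractor :: "nat \<Rightarrow> (nat \<Rightarrow> real^'n \<Rightarrow> real^'n) \<Rightarrow> (real^'n) set \<Rightarrow> bool" where
  "is_attractor L S \<Gamma> \<longleftrightarrow> compact \<Gamma> \<and> \<Gamma> \<noteq> {} \<and> \<Gamma> = (\<Union>l<L. S l ` \<Gamma>)"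

definition ifs_probabilities :: "nat \<Rightarrow> (nat \<Rightarrow> real) \<Rightarrow> bool" where
  "ifs_probabilities L p \<longleftrightarrow> (\<forall>l<L. 0 < p l \<and> p l < 1) \<and> (\<Sum>l<L. p l) = 1"

text \<open>A probability measure on the ball \<open>F\<close> is represented by a Borel measure on the whole
  space that gives \<open>F\<close> full mass. Finite Borel measures on Euclidean space are automatically
  regular.\<close>

definition invariant_measure ::
    "nat \<Rightarrow> (nat \<Rightarrow> real^'n \<Rightarrow> real^'n) \<Rightarrow> (nat \<Rightarrow> real) \<Rightarrow> (real^'n) measure \<Rightarrow> bool" where
  "invariant_measure L S p M \<longleftrightarrow>
     sets M = sets borel \<and> prob_space M \<and>
     (\<exists>z r. 0 < r \<and> (\<Union>l<L. S l ` cball z r) \<subseteq> cball z r \<and> measure M (cball z r) = 1) \<and>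
     (\<forall>B\<in>sets borel. measure M B = (\<Sum>l<L. p l * measure M (S l -` B)))"

definition ruelle ::
    "nat \<Rightarrow> (nat \<Rightarrow> real^'n \<Rightarrow> real^'n) \<Rightarrow> (nat \<Rightarrow> real) \<Rightarrow> (real^'n \<Rightarrow> real) \<Rightarrow> real^'n \<Rightarrow> real" where
  "ruelle L S p f = (\<lambda>x. \<Sum>l<L. p l * f (S l x))"

text \<open>To be used for finite-dimensional spaces \<open>P\<close> of polynomial functions.\<close>

definition ifs_invariant ::
    "nat \<Rightarrow> (nat \<Rightarrow> real^'n \<Rightarrow> real^'n) \<Rightarrow> (nat \<Rightarrow> real) \<Rightarrow> (real^'n \<Rightarrow> real) set \<Rightarrow> bool" where
  "ifs_invariant L S p P \<longleftrightarrow> (\<forall>c. (\<lambda>x. c) \<in> P) \<and> ruelle L S p ` P \<subseteq> P"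


subsection \<open>Polynomials and Chebyshev tensor-product cubature\<close>

definition Q_space :: "nat \<Rightarrow> (real^'n \<Rightarrow> real) set" where
  "Q_space N = range (\<lambda>c :: ('n \<Rightarrow> nat) \<Rightarrow> real.
     (\<lambda>x. \<Sum>\<alpha> | \<forall>i. \<alpha> i \<le> N. c \<alpha> * (\<Prod>i\<in>UNIV. (x $ i) ^ \<alpha> i)))"

datatype cheb_kind = First_Kind | Second_Kind

fun cheb_node :: "cheb_kind \<Rightarrow> nat \<Rightarrow> nat \<Rightarrow> real" where
  "cheb_node First_Kind N j = cos ((2 * real j + 1) * pi / (2 * real N + 2))"
| "cheb_node Second_Kind N j = cos (real j * pi / real N)"

definition cheb_nodes :: "cheb_kind \<Rightarrow> nat \<Rightarrow> real \<Rightarrow> real \<Rightarrow> real set" where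
  "cheb_nodes kind N a b = (\<lambda>j. (a + b) / 2 + (b - a) / 2 * cheb_node kind N j) ` {0..N}"

definition cheb_grid :: "cheb_kind \<Rightarrow> nat \<Rightarrow> real^'n \<Rightarrow> real^'n \<Rightarrow> (real^'n) set" where
  "cheb_grid kind N a b = {x. \<forall>i. x $ i \<in> cheb_nodes kind N (a $ i) (b $ i)}"

text \<open>Vectors and matrices over the \<open>(N + 1)\<^sup>n\<close> grid points are indexed by the points
  themselves. The description below is well defined whenever \<open>X\<close> is unisolvent for
  \<open>Q_space N\<close>.\<close>

definition lagrange :: "nat \<Rightarrow> (real^'n) set \<Rightarrow> real^'n \<Rightarrow> real^'n \<Rightarrow> real" where
  "lagrange N X y =
     (THE q. q \<in> Q_space N \<and> (\<forall>x\<in>X. q x = (if x = y then 1 else 0)))"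

definition cubature_matrix ::
    "nat \<Rightarrow> (nat \<Rightarrow> real^'n \<Rightarrow> real^'n) \<Rightarrow> (nat \<Rightarrow> real) \<Rightarrow> nat \<Rightarrow> (real^'n) set
      \<Rightarrow> real^'n \<Rightarrow> real^'n \<Rightarrow> real" where
  "cubature_matrix L S p N X x y = (\<Sum>l<L. p l * lagrange N X y (S l x))"

definition cubature_weights ::
    "nat \<Rightarrow> (nat \<Rightarrow> real^'n \<Rightarrow> real^'n) \<Rightarrow> (nat \<Rightarrow> real) \<Rightarrow> nat \<Rightarrow> (real^'n) set
      \<Rightarrow> (real^'n \<Rightarrow> real) \<Rightarrow> bool" where
  "cubature_weights L S p N X w \<longleftrightarrow>
     (\<forall>y\<in>X. (\<Sum>x\<in>X. cubature_matrix L S p N X x y * w x) = w y) \<and> (\<Sum>x\<in>X. w x) = 1"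

definition cubature :: "(real^'n) set \<Rightarrow> (real^'n \<Rightarrow> real) \<Rightarrow> (real^'n \<Rightarrow> real) \<Rightarrow> real" where
  "cubature X w f = (\<Sum>x\<in>X. w x * f x)"

definition l1_norm :: "(real^'n) set \<Rightarrow> (real^'n \<Rightarrow> real) \<Rightarrow> real" where
  "l1_norm X w = (\<Sum>x\<in>X. \<bar>w x\<bar>)"


subsection \<open>Functions of class \<open>C\<^sup>k\<close>\<close>

text \<open>All partial derivatives up to order \<open>k\<close> exist and are continuous on \<open>K\<close>, derivatives at
  boundary points being taken within \<open>K\<close>. On a nondegenerate box these derivatives are unique,
  and the class consists of the functions whose partial derivatives up to order \<open>k\<close> in the
  interior extend continuously to \<open>K\<close>. Values outside \<open>K\<close> are irrelevant.\<close>

fun C_k_on :: "nat \<Rightarrow> (real^'n) set \<Rightarrow> (real^'n \<Rightarrow> real) \<Rightarrow> bool" where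
  "C_k_on 0 K f \<longleftrightarrow> continuous_on K f"
| "C_k_on (Suc k) K f \<longleftrightarrow>
     (\<exists>g :: 'n \<Rightarrow> real^'n \<Rightarrow> real.
        (\<forall>x\<in>K. (f has_derivative (\<lambda>h. \<Sum>i\<in>UNIV. g i x * h $ i)) (at x within K)) \<and>
        (\<forall>i. C_k_on k K (g i)))"

end

theory Submission
  imports Defs "HOL-Computational_Algebra.Polynomial"
begin

text \<open>Polynomials of total degree at most \<open>N\<close> are preserved by the Ruelle operator. Its iterates on such a
  polynomial \<open>q\<close> converge to a constant, while the cubature and the integral of \<open>q\<close> do not change, so
  the cubature is exact on \<open>q\<close>, and its error on \<open>f\<close> is at most \<open>1 + \<bar>w\<bar>\<^sub>1\<close> times the distance from \<open>f\<close> to these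
  polynomials. By Jackson's theorem, applied in each coordinate to de la Vallee Poussin means, this distance
  is \<open>O(N\<^sup>-\<^sup>k)\<close>. If \<open>Q_space N\<close> itself is invariant, then the same argument identifies the weights with the
  integrals of the Lagrange polynomials, so \<open>\<bar>w\<bar>\<^sub>1\<close> is at most the Lebesgue constant \<open>O(log\<^sup>n N)\<close> of the grid.\<close>

subsection \<open>Discrete convolution with trigonometric kernels\<close>

text \<open>A general affine map does not preserve \<open>Q_space N\<close>. This is why exactness
  is shown for total degree at most \<open>N\<close>, and why the approximants need small total
  degree, not just small degree in each variable. Spending degree \<open>2 * m\<close> on each of
  the n coordinates, with \<open>m = N div (2 * n)\<close>, costs a factor that depends only on n
  and k.

  Convolutions are sums over equispaced angles. For frequencies below the number of nodes such sums
  are exact, so masses, moments and multipliers of the kernels all follow from discrete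
  orthogonality of cosines. The same orthogonality treats both kinds of nodes and bounds their
  Lebesgue constants without closed formulas for the Lagrange polynomials.

  Jackson's theorem yields a polynomial on each line separately, with no relation between
  neighbouring lines. A bounded linear operator with the same order of error can act in one
  coordinate while the others are parameters. As \<open>f\<close> and the Lebesgue function are
  controlled only on the box, the measure must also be shown to live on
  \<open>\<Gamma>\<close>.\<close>

lemma sum_cos_equispaced:
  fixes d :: int and M :: nat
  assumes "M > 0"
  shows "(\<Sum>s<M. cos (\<phi> + of_int d * (t + 2 * pi * real s / real M)))
    = (if int M dvd d then real M * cos (\<phi> + of_int d * t) else 0)"
proof (cases "int M dvd d")
  case True
  then obtain e where e: "d = int M * e" by auto
  have "cos (\<phi> + of_int d * (t + 2 * pi * real s / real M)) = cos (\<phi> + of_int d * t)" for s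
  proof -
    have "\<phi> + of_int d * (t + 2 * pi * real s / real M)
        = \<phi> + of_int d * t + of_int (e * int s) * (2 * pi)"
      using assms by (simp add: e field_simps)
    then show ?thesis using cos.plus_of_int[of "\<phi> + of_int d * t" "e * int s"]
      by (simp add: add.assoc)
  qed
  then show ?thesis using True by simp
next
  case False
  define h where "h = 2 * pi * of_int d / real M"
  define x where "x = \<phi> + of_int d * t"
  \<comment> \<open>Multiplying by \<open>2 * sin (h / 2)\<close> turns each cosine into a
    difference of neighbouring sines, and the two ends that survive differ by a full number of
    periods.\<close>
  have tele: "2 * sin (h / 2) * (\<Sum>s<m. cos (x + real s * h))
      = sin (x + (real m - 1 / 2) * h) - sin (x - h / 2)" for m :: nat
  proof (induction m)
    case (Suc m)
    have "2 * sin (h / 2) * cos (x + real m * h)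
        = sin ((x + real m * h) + h / 2) - sin ((x + real m * h) - h / 2)"
      unfolding sin_add sin_diff by simp
    moreover have "(x + real m * h) + h / 2 = x + (real (Suc m) - 1 / 2) * h"
      and "(x + real m * h) - h / 2 = x + (real m - 1 / 2) * h"
      by (simp_all add: algebra_simps)
    ultimately show ?case using Suc.IH by (simp add: distrib_left)
  qed (simp add: algebra_simps)
  have "x + (real M - 1 / 2) * h = (x - h / 2) + of_int d * (2 * pi)"
    using assms by (simp add: h_def field_simps)
  then have "2 * sin (h / 2) * (\<Sum>s<M. cos (x + real s * h)) = 0"
    unfolding tele using sin.plus_of_int[of "x - h / 2" d] by (simp add: algebra_simps)
  \<comment> \<open>\<open>h / 2\<close> is \<open>pi * d / M\<close>, a multiple of
    \<open>pi\<close> exactly when \<open>M\<close> divides \<open>d\<close>.\<close>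
  moreover have "sin (h / 2) \<noteq> 0"
  proof
    assume "sin (h / 2) = 0"
    then obtain i :: int where "h / 2 = of_int i * pi"
      unfolding sin_zero_iff_int2 by auto
    then have "of_int d * pi = of_int (i * int M) * pi"
      using assms by (simp add: h_def field_simps)
    then have "d = i * int M" by (simp only: mult_cancel_right of_int_eq_iff) simp
    then show False using False by simp
  qed
  ultimately have "(\<Sum>s<M. cos (x + real s * h)) = 0" by simp
  then show ?thesis using False by (simp add: x_def h_def algebra_simps)
qed

lemma sum_cos_cos_equispaced:
  fixes d l M :: nat
  assumes "M > 0"
  shows "(\<Sum>s<M. cos (real d * (t + 2 * pi * real s / real M)) * cos (real l * (t + 2 * pi * real s / real M)))
    = real M / 2 * ((if int M dvd int d - int l then cos ((real d - real l) * t) else 0)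
        + (if M dvd d + l then cos ((real d + real l) * t) else 0))"
proof -
  let ?u = "\<lambda>s. t + 2 * pi * real s / real M"
  have "cos (real d * u) * cos (real l * u)
      = (cos (0 + of_int (int d - int l) * u) + cos (0 + of_int (int d + int l) * u)) / 2" for u
    by (simp add: cos_add cos_diff left_diff_distrib distrib_right)
  then have "(\<Sum>s<M. cos (real d * ?u s) * cos (real l * ?u s))
      = ((\<Sum>s<M. cos (0 + of_int (int d - int l) * ?u s))
        + (\<Sum>s<M. cos (0 + of_int (int d + int l) * ?u s))) / 2"
    by (simp only: sum.distrib[symmetric] sum_divide_distrib)
  also have "\<dots> = real M / 2 * ((if int M dvd int d - int l then cos ((real d - real l) * t) else 0)
        + (if M dvd d + l then cos ((real d + real l) * t) else 0))"
    unfolding sum_cos_equispaced[OF assms]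
    by (simp flip: of_nat_add add: of_nat_dvd_iff) (simp add: algebra_simps)
  finally show ?thesis .
qed

text \<open>With \<open>d + l < M\<close> neither the difference nor the sum of the frequencies can
  be a nonzero multiple of \<open>M\<close>, so there is no aliasing. The second indicator accounts
  for frequency zero, whose square has mean 1 instead of 1/2.\<close>

lemma sum_cos_cos_equispaced':
  fixes d l M :: nat
  assumes "d + l < M"
  shows "(\<Sum>s<M. cos (real d * (t + 2 * pi * real s / real M)) * cos (real l * (t + 2 * pi * real s / real M)))
    = real M / 2 * (of_bool (d = l) + of_bool (d = 0 \<and> l = 0))"
proof -
  have "M > 0" using assms by simp
  moreover have "int M dvd int d - int l \<longleftrightarrow> d = l"
  proof
    assume "int M dvd int d - int l"
    show "d = l"
    proof (rule ccontr)
      assume "d \<noteq> l"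
      with \<open>int M dvd int d - int l\<close> have "\<bar>int M\<bar> \<le> \<bar>int d - int l\<bar>"
        by (intro dvd_imp_le_int) auto
      then show False using assms by linarith
    qed
  qed simp
  moreover have "M dvd d + l \<longleftrightarrow> d = 0 \<and> l = 0"
    using assms by (auto dest: dvd_imp_le)
  ultimately show ?thesis by (auto simp: sum_cos_cos_equispaced)
qed

section \<open>Chebyshev polynomials and kernels that are squared moduli\<close>

fun cheb_T :: "nat \<Rightarrow> real poly" where
  "cheb_T 0 = 1"
| "cheb_T (Suc 0) = [:0, 1:]"
| "cheb_T (Suc (Suc n)) = [:0, 2:] * cheb_T (Suc n) - cheb_T n"

lemma poly_cheb_T_cos: "poly (cheb_T n) (cos \<theta>) = cos (real n * \<theta>)"
proof (induction n rule: cheb_T.induct)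
  case (3 n)
  have "real (Suc (Suc n)) * \<theta> = real (Suc n) * \<theta> + \<theta>"
    and *: "real n * \<theta> = real (Suc n) * \<theta> - \<theta>"
    by (simp_all add: algebra_simps)
  then have "cos (real (Suc (Suc n)) * \<theta>) = 2 * cos \<theta> * cos (real (Suc n) * \<theta>) - cos (real n * \<theta>)"
    by (simp only: cos_add cos_diff) simp
  then show ?case using 3 by (simp add: mult.commute)
qed auto

lemma degree_cheb_T: "degree (cheb_T n) \<le> n"
proof (induction n rule: cheb_T.induct)
  case (3 n)
  have "degree ([:0, 2:] * cheb_T (Suc n)) \<le> Suc (Suc n)"
    using 3(1) by (intro order.trans[OF degree_mult_le]) simp
  then show ?case using 3(2) by (auto intro!: degree_diff_le)
qed auto

lemma lead_coeff_cheb_T: "coeff (cheb_T n) n > 0"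
proof (induction n rule: cheb_T.induct)
  case (3 n)
  have "coeff (cheb_T n) (Suc (Suc n)) = 0"
    using degree_cheb_T[of n] by (intro coeff_eq_0) simp
  then show ?case using 3(1) by simp
qed auto

text \<open>Because \<open>cheb_T l\<close> has degree exactly \<open>l\<close>, leading terms can
  be eliminated one after another. Reproduction of polynomials thereby reduces to reproduction of
  single cosines.\<close>

lemma cheb_T_span:
  assumes "degree p \<le> n"
  shows "\<exists>c. p = (\<Sum>l\<le>n. smult (c l) (cheb_T l))"
  using assms
proof (induction n arbitrary: p)
  case 0
  then obtain x where "p = [:x:]" using degree_eq_zeroE by auto
  then show ?case by (intro exI[of _ "\<lambda>_. x"]) simp
next
  case (Suc n)
  define x where "x = coeff p (Suc n) / coeff (cheb_T (Suc n)) (Suc n)"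
  define q where "q = p - smult x (cheb_T (Suc n))"
  have "degree q \<le> Suc n"
    unfolding q_def using Suc.prems degree_cheb_T
    by (intro degree_diff_le) (auto intro: order.trans[OF degree_smult_le])
  moreover have "coeff q (Suc n) = 0"
    using lead_coeff_cheb_T[of "Suc n"] by (simp add: q_def x_def)
  ultimately have "degree q \<le> n"
    by (metis coeff_eq_0 degree_le le_SucE le_neq_implies_less leading_coeff_0_iff less_Suc_eq_le not_less_eq)
  then obtain c where "q = (\<Sum>l\<le>n. smult (c l) (cheb_T l))" using Suc.IH by blast
  then have "p = (\<Sum>l\<le>Suc n. smult ((c(Suc n := x)) l) (cheb_T l))"
    by (simp add: q_def algebra_simps)
  then show ?case by blast
qed

text \<open>This is \<open>\<bar>\<Sum>j<m. a j * exp (i * j * u)\<bar>\<^sup>2\<close>: nonnegative, and an even trigonometric polynomial.\<close>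

definition trig_kernel :: "(nat \<Rightarrow> real) \<Rightarrow> nat \<Rightarrow> real \<Rightarrow> real" where
  "trig_kernel a m u = (\<Sum>i<m. a i * cos (real i * u))\<^sup>2 + (\<Sum>i<m. a i * sin (real i * u))\<^sup>2"

lemma trig_kernel_nonneg: "0 \<le> trig_kernel a m u"
  by (simp add: trig_kernel_def)

text \<open>The absolute difference, kept in \<open>nat\<close> because it indexes
  \<open>cheb_T\<close>; at least one of the two truncated subtractions is zero.\<close>

definition nat_dist :: "nat \<Rightarrow> nat \<Rightarrow> nat" where
  "nat_dist i j = (i - j) + (j - i)"

lemma cos_nat_dist: "cos (real (nat_dist i j) * u) = cos (real i * u) * cos (real j * u) + sin (real i * u) * sin (real j * u)"
proof (cases "i \<le> j")
  case True
  then have "real (nat_dist i j) * u = - (real i * u - real j * u)"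
    by (simp add: nat_dist_def of_nat_diff algebra_simps)
  then show ?thesis by (simp only: cos_minus cos_diff)
next
  case False
  then have "real (nat_dist i j) * u = real i * u - real j * u"
    by (simp add: nat_dist_def of_nat_diff algebra_simps)
  then show ?thesis by (simp only: cos_diff)
qed

lemma nat_dist_less: "i < m \<Longrightarrow> j < m \<Longrightarrow> nat_dist i j < m"
  by (auto simp: nat_dist_def)

lemma of_bool_nat_dist:
  "(of_bool (nat_dist i j = l) + of_bool (nat_dist i j = 0 \<and> l = 0) :: real)
    = of_bool (i = j + l) + of_bool (j = i + l)"
  by (auto simp: nat_dist_def)

lemma trig_kernel_expand:
  "trig_kernel a m u = (\<Sum>i<m. \<Sum>j<m. a i * a j * cos (real (nat_dist i j) * u))"
  unfolding trig_kernel_def power2_eq_square sum_product sum.distrib[symmetric] cos_nat_dist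
  by (intro sum.cong refl) (simp add: algebra_simps)

text \<open>For \<open>l > 0\<close> every pair at distance \<open>l\<close> occurs in two orders.
  For \<open>l = 0\<close> there is one order only, but both indicators fire, so the factor 2 is the
  same. The right side is the autocorrelation of \<open>a\<close>, which gives the Fourier
  coefficients of the kernel.\<close>

lemma sum_pairs_at_distance:
  fixes a :: "nat \<Rightarrow> real"
  shows "(\<Sum>i<m. \<Sum>j<m. a i * a j * (of_bool (nat_dist i j = l) + of_bool (nat_dist i j = 0 \<and> l = 0)))
    = 2 * (\<Sum>j<m - l. a j * a (j + l))"
proof -
  have "(\<Sum>i<m. \<Sum>j<m. a i * a j * (of_bool (nat_dist i j = l) + of_bool (nat_dist i j = 0 \<and> l = 0)))
      = (\<Sum>i<m. \<Sum>j<m. a i * a j * of_bool (i = j + l))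
      + (\<Sum>i<m. \<Sum>j<m. a i * a j * of_bool (j = i + l))"
    unfolding of_bool_nat_dist by (simp only: sum.distrib[symmetric] distrib_left)
  also have "(\<Sum>i<m. \<Sum>j<m. a i * a j * of_bool (i = j + l))
      = (\<Sum>i<m. \<Sum>j<m. a i * a j * of_bool (j = i + l))"
    by (subst sum.swap) (simp add: mult.commute)
  also have "(\<Sum>i<m. \<Sum>j<m. a i * a j * of_bool (j = i + l))
      = (\<Sum>i<m. if i + l < m then a i * a (i + l) else 0)"
    by (intro sum.cong refl) (auto simp: of_bool_def if_distrib cong: if_cong)
  also have "\<dots> = (\<Sum>j<m - l. a j * a (j + l))"
    by (rule sum.mono_neutral_cong_right) auto
  finally show ?thesis by simp
qed

text \<open>The frequencies of the kernel are below \<open>m\<close>, so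
  \<open>m + l \<le> M\<close> is what excludes aliasing against the frequency
  \<open>l\<close>.\<close>

lemma sum_trig_kernel_cos:
  assumes "m + l \<le> M"
  shows "(\<Sum>s<M. trig_kernel a m (t + 2 * pi * real s / real M) * cos (real l * (t + 2 * pi * real s / real M)))
    = real M * (\<Sum>j<m - l. a j * a (j + l))"
proof -
  let ?u = "\<lambda>s. t + 2 * pi * real s / real M"
  have "(\<Sum>s<M. trig_kernel a m (?u s) * cos (real l * ?u s))
      = (\<Sum>i<m. \<Sum>j<m. a i * a j * (\<Sum>s<M. cos (real (nat_dist i j) * ?u s) * cos (real l * ?u s)))"
    unfolding trig_kernel_expand sum_distrib_right
    by (subst sum.swap, rule sum.cong[OF refl], subst sum.swap)
       (simp add: sum_distrib_left sum_distrib_right mult_ac)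
  also have "\<dots> = (\<Sum>i<m. \<Sum>j<m. a i * a j * (real M / 2 *
      (of_bool (nat_dist i j = l) + of_bool (nat_dist i j = 0 \<and> l = 0))))"
  proof (intro sum.cong refl)
    fix i j assume "i \<in> {..<m}" "j \<in> {..<m}"
    then have "nat_dist i j + l < M" using nat_dist_less[of i m j] assms by simp
    from sum_cos_cos_equispaced'[OF this]
    show "a i * a j * (\<Sum>s<M. cos (real (nat_dist i j) * ?u s) * cos (real l * ?u s))
      = a i * a j * (real M / 2 * (of_bool (nat_dist i j = l) + of_bool (nat_dist i j = 0 \<and> l = 0)))"
      by (simp only:)
  qed
  also have "\<dots> = real M / 2 * (\<Sum>i<m. \<Sum>j<m. a i * a j *
      (of_bool (nat_dist i j = l) + of_bool (nat_dist i j = 0 \<and> l = 0)))"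
    unfolding sum_distrib_left by (simp only: mult.left_commute mult.assoc)
  finally show ?thesis unfolding sum_pairs_at_distance by simp
qed

text \<open>The function \<open>\<lambda>x. \<Sum>s<M. f (cos (2 * pi * s / M)) * poly (kernel_op a m M s) x\<close> is, for \<open>x = cos \<theta>\<close>, a
  discretised convolution of \<open>f \<circ> cos\<close> with the kernel; the symmetrisation in \<open>\<theta>\<close> turns it into
  an algebraic polynomial.\<close>

definition kernel_op :: "(nat \<Rightarrow> real) \<Rightarrow> nat \<Rightarrow> nat \<Rightarrow> nat \<Rightarrow> real poly" where
  "kernel_op a m M s = (\<Sum>i<m. \<Sum>j<m.
     smult (a i * a j * cos (real (nat_dist i j) * (2 * pi * real s / real M)) / real M)
       (cheb_T (nat_dist i j)))"

lemma degree_kernel_op: "degree (kernel_op a m M s) \<le> m - 1"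
  unfolding kernel_op_def
proof (intro degree_sum_le finite_lessThan)
  fix i j assume "i \<in> {..<m}" "j \<in> {..<m}"
  then show "degree (smult (a i * a j * cos (real (nat_dist i j) * (2 * pi * real s / real M)) / real M)
       (cheb_T (nat_dist i j))) \<le> m - 1"
    using degree_cheb_T[of "nat_dist i j"] nat_dist_less[of i m j]
    by (intro order.trans[OF degree_smult_le]) auto
qed

lemma poly_kernel_op_cos:
  "poly (kernel_op a m M s) (cos \<theta>)
    = (trig_kernel a m (\<theta> + 2 * pi * real s / real M)
      + trig_kernel a m (- \<theta> + 2 * pi * real s / real M)) / (2 * real M)"
proof -
  have "cos (x * t) / real M * cos (x * \<theta>) = (cos (x * (\<theta> + t)) + cos (x * (- \<theta> + t))) / (2 * real M)"
    for x t
    by (simp add: cos_add cos_diff distrib_left field_simps)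
  then have *: "a i * a j * cos (x * t) / real M * cos (x * \<theta>)
      = (a i * a j * cos (x * (\<theta> + t)) + a i * a j * cos (x * (- \<theta> + t))) / (2 * real M)" for i j x t
    by (metis (no_types, lifting) distrib_left mult.assoc times_divide_eq_right)
  show ?thesis
    unfolding kernel_op_def trig_kernel_expand poly_sum poly_smult poly_cheb_T_cos *
    by (simp only: sum.distrib[symmetric] sum_divide_distrib)
qed

lemma poly_kernel_op_nonneg:
  assumes "x \<in> {-1..1}"
  shows "0 \<le> poly (kernel_op a m M s) x"
proof -
  obtain \<theta> where "x = cos \<theta>" using assms by (metis atLeastAtMost_iff cos_arccos)
  then show ?thesis by (simp add: poly_kernel_op_cos trig_kernel_nonneg)
qed

lemma sum_poly_kernel_op:
  assumes "x \<in> {-1..1}" "0 < M" "m \<le> M"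
  shows "(\<Sum>s<M. poly (kernel_op a m M s) x) = (\<Sum>j<m. (a j)\<^sup>2)"
proof -
  obtain \<theta> where x: "x = cos \<theta>" using assms(1) by (metis atLeastAtMost_iff cos_arccos)
  have *: "(\<Sum>s<M. trig_kernel a m (t + 2 * pi * real s / real M)) = real M * (\<Sum>j<m. (a j)\<^sup>2)" for t
    using sum_trig_kernel_cos[of m 0 M a t] assms(3) by (simp add: power2_eq_square)
  then show ?thesis
    using assms(2,3) unfolding x poly_kernel_op_cos sum_divide_distrib[symmetric] sum.distrib *
    by (simp add: field_simps)
qed


subsection \<open>Jackson's theorem on an interval\<close>

text \<open>The pointwise bound of \<open>(cos \<theta> - cos t)\<^sup>2\<close> by
  \<open>2 * (1 - cos (\<theta> + t))\<close> reduces the second moment to the Fourier coefficients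
  of order 0 and 1. The angles enter as a sum because the kernel is evaluated at
  \<open>\<theta> + t\<close> and \<open>- \<theta> + t\<close>.\<close>

lemma sum_poly_kernel_op_sq:
  assumes "x \<in> {-1..1}" "m + 1 \<le> M"
  shows "(\<Sum>s<M. poly (kernel_op a m M s) x * (x - cos (2 * pi * real s / real M))\<^sup>2)
    \<le> 2 * ((\<Sum>j<m. (a j)\<^sup>2) - (\<Sum>j<m - 1. a j * a (Suc j)))"
proof -
  obtain \<theta> where x: "x = cos \<theta>" using assms(1) by (metis atLeastAtMost_iff cos_arccos)
  let ?t = "\<lambda>s. 2 * pi * real s / real M"
  let ?K = "trig_kernel a m"
  define R where "R = (\<Sum>j<m. (a j)\<^sup>2) - (\<Sum>j<m - 1. a j * a (Suc j))"
  have sq: "(cos \<theta> - cos t)\<^sup>2 \<le> 2 * (1 - cos (\<theta> + t))" for \<theta> t :: real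
  proof -
    have "(cos \<theta> - cos t)\<^sup>2 = 4 * (sin ((\<theta> + t) / 2))\<^sup>2 * (sin ((t - \<theta>) / 2))\<^sup>2"
      unfolding cos_diff_cos by (simp add: power_mult_distrib)
    also have "\<dots> \<le> 4 * (sin ((\<theta> + t) / 2))\<^sup>2 * 1"
      by (intro mult_left_mono) (auto simp: abs_square_le_1)
    also have "\<dots> = 2 * (1 - cos (2 * ((\<theta> + t) / 2)))"
      unfolding cos_double_sin by simp
    also have "2 * ((\<theta> + t) / 2) = \<theta> + t" by simp
    finally show ?thesis .
  qed
  have R: "(\<Sum>s<M. ?K (u + ?t s) * (1 - cos (u + ?t s))) = real M * R" for u
    using sum_trig_kernel_cos[of m 0 M a u] sum_trig_kernel_cos[of m 1 M a u] assms(2)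
    by (simp add: R_def right_diff_distrib sum_subtractf power2_eq_square)
  have "(\<Sum>s<M. poly (kernel_op a m M s) x * (x - cos (?t s))\<^sup>2)
      \<le> (\<Sum>s<M. (?K (\<theta> + ?t s) * (1 - cos (\<theta> + ?t s))
          + ?K (- \<theta> + ?t s) * (1 - cos (- \<theta> + ?t s))) / real M)"
  proof (rule sum_mono)
    fix s assume "s \<in> {..<M}"
    then have M: "real M > 0" by simp
    have "?K (\<theta> + ?t s) * (cos \<theta> - cos (?t s))\<^sup>2 \<le> ?K (\<theta> + ?t s) * (2 * (1 - cos (\<theta> + ?t s)))"
      by (intro mult_left_mono sq trig_kernel_nonneg)
    moreover have "?K (- \<theta> + ?t s) * (cos (- \<theta>) - cos (?t s))\<^sup>2
        \<le> ?K (- \<theta> + ?t s) * (2 * (1 - cos (- \<theta> + ?t s)))"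
      by (intro mult_left_mono sq trig_kernel_nonneg)
    ultimately show "poly (kernel_op a m M s) x * (x - cos (?t s))\<^sup>2
       \<le> (?K (\<theta> + ?t s) * (1 - cos (\<theta> + ?t s))
          + ?K (- \<theta> + ?t s) * (1 - cos (- \<theta> + ?t s))) / real M"
      using M unfolding x poly_kernel_op_cos cos_minus
      by (simp add: divide_simps) (simp add: algebra_simps)
  qed
  also have "\<dots> = 2 * R"
    unfolding sum_divide_distrib[symmetric] sum.distrib R using assms(2) by (simp add: field_simps)
  finally show ?thesis by (simp add: R_def)
qed

text \<open>The coefficients \<open>a j = sin (j * pi / n)\<close> vanish for \<open>j = 0\<close> and \<open>j = n\<close>, so that the normalised kernel has
  first Fourier coefficient \<open>cos (pi / n) = 1 - O(1 / n\<^sup>2)\<close>.\<close>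

lemma jackson_lipschitz:
  fixes f :: "real \<Rightarrow> real"
  assumes lip: "\<And>x y. x \<in> {-1..1} \<Longrightarrow> y \<in> {-1..1} \<Longrightarrow> \<bar>f x - f y\<bar> \<le> B * \<bar>x - y\<bar>"
    and "B \<ge> 0" "m \<ge> 1"
  shows "\<exists>p. degree p \<le> m \<and> (\<forall>x\<in>{-1..1}. \<bar>f x - poly p x\<bar> \<le> 9 * B / real m)"
proof -
  \<comment> \<open>A kernel with \<open>n\<close> coefficients gives degree
    \<open>n - 1 = m\<close>, and \<open>M = Suc n\<close> below is the least number of nodes that
    \<open>sum_poly_kernel_op_sq\<close> admits.\<close>
  define n where "n = Suc m"
  define h where "h = pi / real n"
  define a where "a j = sin (real j * h)" for j
  define W where "W = (\<Sum>j<n. (a j)\<^sup>2)"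
  define M where "M = Suc n"
  define t where "t s = cos (2 * pi * real s / real M)" for s
  define p where "p = (\<Sum>s<M. smult (f (t s) / W) (kernel_op a n M s))"
  have n: "n \<ge> 2" "real n > 0" using assms by (auto simp: n_def)
  have h: "0 < h" "h < pi" using n by (auto simp: h_def field_simps)
  have "(\<Sum>j<n. (a j)\<^sup>2) \<ge> (a 1)\<^sup>2"
    using n by (intro member_le_sum) auto
  moreover have "a 1 > 0" using h by (simp add: a_def sin_gt_zero)
  ultimately have W: "W > 0" by (simp add: W_def less_le_trans[OF zero_less_power])
  \<comment> \<open>The phase \<open>- (pi / 2)\<close> makes a sine of the cosine of frequency 1;
    the sum vanishes because \<open>n \<ge> 2\<close> does not divide 1.\<close>
  have "(\<Sum>j<n. cos (- (pi / 2) + of_int 1 * (0 + 2 * pi * real j / real n))) = 0"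
    using n by (subst sum_cos_equispaced) auto
  moreover have "cos (- (pi / 2) + of_int 1 * (0 + 2 * pi * real j / real n)) = sin (2 * (real j * h))" for j
    by (simp only: cos_add) (simp add: h_def mult_ac)
  ultimately have sin0: "(\<Sum>j<n. sin (2 * (real j * h))) = 0" by simp
  have a_n: "a n = 0" using n by (simp add: a_def h_def)
  have "(\<Sum>j<n. a j * a (Suc j)) = (\<Sum>j<n. cos h * (a j)\<^sup>2 + sin h / 2 * sin (2 * (real j * h)))"
    unfolding a_def sin_double
    by (intro sum.cong refl) (simp add: distrib_right sin_add power2_eq_square algebra_simps)
  also have "\<dots> = cos h * W"
    unfolding sum.distrib sum_distrib_left[symmetric] sin0 W_def by simp
  finally have aa: "(\<Sum>j<n - 1. a j * a (Suc j)) = cos h * W"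
    using a_n by (simp add: n_def)
  have "degree p \<le> m"
    unfolding p_def
  proof (intro degree_sum_le finite_lessThan)
    fix s assume "s \<in> {..<M}"
    show "degree (smult (f (t s) / W) (kernel_op a n M s)) \<le> m"
      using degree_kernel_op[of a n M s] degree_smult_le[of "f (t s) / W" "kernel_op a n M s"]
      by (simp add: n_def)
  qed
  moreover have "\<bar>f x - poly p x\<bar> \<le> 9 * B / real m" if x: "x \<in> {-1..1}" for x
  proof -
    let ?k = "\<lambda>s. poly (kernel_op a n M s) x"
    have k: "?k s \<ge> 0" for s using poly_kernel_op_nonneg[OF x] .
    have one: "(\<Sum>s<M. ?k s) = W"
      using sum_poly_kernel_op[OF x, of M n a] by (simp add: M_def W_def)
    have two: "(\<Sum>s<M. ?k s * (x - t s)\<^sup>2) \<le> 2 * (W - cos h * W)"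
      using sum_poly_kernel_op_sq[OF x, of n M a] unfolding aa W_def[symmetric] t_def
      by (simp add: M_def)
    have "f x = (\<Sum>s<M. ?k s * f x) / W"
      using W one by (simp add: sum_distrib_right[symmetric])
    then have "f x - poly p x = (\<Sum>s<M. ?k s * (f x - f (t s))) / W"
      unfolding p_def poly_sum poly_smult right_diff_distrib sum_subtractf diff_divide_distrib
      by (simp add: sum_divide_distrib mult.commute)
    then have "\<bar>f x - poly p x\<bar> = \<bar>\<Sum>s<M. ?k s * (f x - f (t s))\<bar> / W"
      using W by simp
    also have "\<dots> \<le> (\<Sum>s<M. ?k s * (B / 2 * (real n * (x - t s)\<^sup>2 + 1 / real n))) / W"
    proof (intro divide_right_mono order.trans[OF sum_abs] sum_mono)
      fix s
      \<comment> \<open>The arithmetic-geometric mean inequality, balanced at distance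
        \<open>1 / n\<close>, bounds the first moment by the mass and the second moment, in place of
        Cauchy-Schwarz.\<close>
      have "0 \<le> (real n * \<bar>x - t s\<bar> - 1)\<^sup>2 / real n" by simp
      also have "\<dots> = real n * \<bar>x - t s\<bar>\<^sup>2 - 2 * \<bar>x - t s\<bar> + 1 / real n"
        using n by (simp add: power2_eq_square field_simps del: abs_mult_self_eq)
      finally have "2 * \<bar>x - t s\<bar> \<le> real n * (x - t s)\<^sup>2 + 1 / real n" by simp
      then have "B / 2 * (2 * \<bar>x - t s\<bar>) \<le> B / 2 * (real n * (x - t s)\<^sup>2 + 1 / real n)"
        using \<open>B \<ge> 0\<close> by (intro mult_left_mono) auto
      moreover have "\<bar>f x - f (t s)\<bar> \<le> B * \<bar>x - t s\<bar>"
        using x by (intro lip) (auto simp: t_def)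
      ultimately have "\<bar>f x - f (t s)\<bar> \<le> B / 2 * (real n * (x - t s)\<^sup>2 + 1 / real n)" by simp
      then show "\<bar>?k s * (f x - f (t s))\<bar> \<le> ?k s * (B / 2 * (real n * (x - t s)\<^sup>2 + 1 / real n))"
        unfolding abs_mult abs_of_nonneg[OF k] by (intro mult_left_mono k)
    qed (use W in auto)
    also have "(\<Sum>s<M. ?k s * (B / 2 * (real n * (x - t s)\<^sup>2 + 1 / real n)))
        = B / 2 * (real n * (\<Sum>s<M. ?k s * (x - t s)\<^sup>2) + (\<Sum>s<M. ?k s) / real n)"
      unfolding sum_distrib_left sum_divide_distrib sum.distrib[symmetric]
      by (intro sum.cong refl) (simp add: algebra_simps)
    also have "\<dots> \<le> B / 2 * (real n * (2 * (W - cos h * W)) + W / real n)"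
      unfolding one using two \<open>B \<ge> 0\<close> n by (intro mult_left_mono add_right_mono) auto
    finally have "\<bar>f x - poly p x\<bar> \<le> B / 2 * (real n * (2 * (W - cos h * W)) + W / real n) / W"
      using W by (simp add: divide_right_mono)
    also have "\<dots> = B / 2 * (real n * (2 * (1 - cos h)) + 1 / real n)"
      using W by (simp add: field_simps)
    also have "\<dots> \<le> B / 2 * (real n * h\<^sup>2 + 1 / real n)"
    proof -
      have "\<bar>sin (h / 2)\<bar>\<^sup>2 \<le> \<bar>h / 2\<bar>\<^sup>2" by (intro power_mono abs_sin_x_le_abs_x) auto
      then have "2 * (1 - cos h) \<le> h\<^sup>2"
        using cos_double_sin[of "h / 2"] by (simp add: power_divide)
      then show ?thesis using \<open>B \<ge> 0\<close> n by (intro mult_left_mono add_right_mono) auto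
    qed
    also have "\<dots> = B * (pi\<^sup>2 + 1) / 2 / real n"
      using n by (simp add: h_def field_simps power2_eq_square)
    \<comment> \<open>Origin of the constant 9: the crude bound \<open>pi < 4\<close> gives 17/2,
      which is rounded up.\<close>
    also have "\<dots> \<le> B * (4\<^sup>2 + 1) / 2 / real n"
      using \<open>B \<ge> 0\<close> pi_less_4 by (intro divide_right_mono mult_left_mono add_mono power_mono) auto
    also have "\<dots> \<le> B * 9 / real n"
      using \<open>B \<ge> 0\<close> by (intro divide_right_mono) auto
    also have "\<dots> \<le> B * 9 / real m"
      using \<open>B \<ge> 0\<close> \<open>m \<ge> 1\<close> by (intro divide_left_mono) (auto simp: n_def)
    finally show ?thesis by (simp add: mult.commute)
  qed
  ultimately show ?thesis by blast
qed

lemma poly_antiderivative: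
  fixes p :: "real poly"
  shows "\<exists>P. pderiv P = p \<and> degree P \<le> Suc (degree p)"
proof -
  define P where "P = (\<Sum>i\<le>degree p. monom (coeff p i / real (Suc i)) (Suc i))"
  have "pderiv P = (\<Sum>i\<le>degree p. monom (coeff p i) i)"
  proof -
    have "pderiv (sum f A) = (\<Sum>x\<in>A. pderiv (f x))" for f :: "nat \<Rightarrow> real poly" and A
      by (induction A rule: infinite_finite_induct) (simp_all add: pderiv_add)
    then show ?thesis by (simp add: P_def pderiv_monom)
  qed
  moreover have "degree P \<le> Suc (degree p)"
    unfolding P_def by (intro degree_sum_le) (auto intro: order.trans[OF degree_monom_le])
  ultimately show ?thesis using poly_as_sum_of_monoms[of p] by auto
qed

text \<open>If \<open>q\<close> approximates \<open>D 1\<close> up to \<open>e\<close> and \<open>Q\<close> is an antiderivative of \<open>q\<close>, then \<open>D 0 - Q\<close> is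
  Lipschitz with constant \<open>e\<close>, which gains a factor \<open>O(1 / m)\<close>.\<close>

lemma jackson_Ck:
  "\<exists>c>0. \<forall>(D :: nat \<Rightarrow> real \<Rightarrow> real) B m. k \<le> m \<longrightarrow>
    (\<forall>j<k. \<forall>x\<in>{-1..1}. (D j has_real_derivative D (Suc j) x) (at x within {-1..1})) \<longrightarrow>
    (\<forall>x\<in>{-1..1}. \<bar>D k x\<bar> \<le> B) \<longrightarrow>
    (\<exists>p. degree p \<le> m \<and> (\<forall>x\<in>{-1..1}. \<bar>D 0 x - poly p x\<bar> \<le> c * B / real m ^ k))"
proof (induction k)
  case 0
  have "\<exists>p. degree p \<le> m \<and> (\<forall>x\<in>{-1..1}. \<bar>D 0 x - poly p x\<bar> \<le> 1 * B / real m ^ 0)"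
    if "\<forall>x\<in>{-1..1}. \<bar>D 0 x\<bar> \<le> B" for D :: "nat \<Rightarrow> real \<Rightarrow> real" and B m
    using that by (intro exI[of _ 0]) auto
  then show ?case by (intro exI[of _ 1]) auto
next
  case (Suc k)
  then obtain c where c: "c > 0" and IH: "\<And>(D :: nat \<Rightarrow> real \<Rightarrow> real) B m. k \<le> m \<Longrightarrow>
    (\<forall>j<k. \<forall>x\<in>{-1..1}. (D j has_real_derivative D (Suc j) x) (at x within {-1..1})) \<Longrightarrow>
    (\<forall>x\<in>{-1..1}. \<bar>D k x\<bar> \<le> B) \<Longrightarrow>
    (\<exists>p. degree p \<le> m \<and> (\<forall>x\<in>{-1..1}. \<bar>D 0 x - poly p x\<bar> \<le> c * B / real m ^ k))"
    by blast
  have "\<exists>p. degree p \<le> m \<and> (\<forall>x\<in>{-1..1}. \<bar>D 0 x - poly p x\<bar> \<le> (9 * c * 2 ^ k) * B / real m ^ Suc k)"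
    if m: "Suc k \<le> m"
      and D: "\<And>j x. j < Suc k \<Longrightarrow> x \<in> {-1..1} \<Longrightarrow> (D j has_real_derivative D (Suc j) x) (at x within {-1..1})"
      and B: "\<And>x. x \<in> {-1..1} \<Longrightarrow> \<bar>D (Suc k) x\<bar> \<le> B"
    for D :: "nat \<Rightarrow> real \<Rightarrow> real" and B m
  proof -
    have B0: "B \<ge> 0" using B[of 0] by simp
    \<comment> \<open>One degree is reserved for integrating the approximant of \<open>D 1\<close>,
      hence \<open>m - 1\<close>.\<close>
    define e where "e = c * B / real (m - 1) ^ k"
    have e0: "e \<ge> 0" using c B0 by (simp add: e_def)
    obtain q where q: "degree q \<le> m - 1" "\<And>x. x \<in> {-1..1} \<Longrightarrow> \<bar>D 1 x - poly q x\<bar> \<le> e"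
    proof -
      have "k \<le> m - 1" using m by simp
      moreover have "\<forall>j<k. \<forall>x\<in>{-1..1}. (D (Suc j) has_real_derivative D (Suc (Suc j)) x) (at x within {-1..1})"
        using D by simp
      moreover have "\<forall>x\<in>{-1..1}. \<bar>D (Suc k) x\<bar> \<le> B" using B by blast
      ultimately have "\<exists>q. degree q \<le> m - 1 \<and> (\<forall>x\<in>{-1..1}. \<bar>D (Suc 0) x - poly q x\<bar> \<le> e)"
        unfolding e_def by (rule IH)
      then show thesis using that by auto
    qed
    obtain Q where Q: "pderiv Q = q" "degree Q \<le> Suc (degree q)"
      using poly_antiderivative by blast
    have "\<bar>(D 0 x - poly Q x) - (D 0 y - poly Q y)\<bar> \<le> e * \<bar>x - y\<bar>"
      if "x \<in> {-1..1}" "y \<in> {-1..1}" for x y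
    proof -
      have "((\<lambda>x. D 0 x - poly Q x) has_real_derivative D 1 z - poly q z) (at z within {-1..1})"
        if "z \<in> {-1..1}" for z
        using D[of 0 z] that Q(1)
        by (auto intro!: derivative_eq_intros has_field_derivative_at_within[OF poly_DERIV])
      from field_differentiable_bound[OF _ this, of e x y] q(2) that
      show ?thesis by simp
    qed
    from jackson_lipschitz[OF this e0, of m] m
    obtain r where r: "degree r \<le> m" "\<And>x. x \<in> {-1..1} \<Longrightarrow> \<bar>D 0 x - poly Q x - poly r x\<bar> \<le> 9 * e / real m"
      by auto
    \<comment> \<open>Price of passing back from \<open>m - 1\<close> to \<open>m\<close>. For
      positive \<open>k\<close> the assumption \<open>Suc k \<le> m\<close> forces
      \<open>m \<ge> 2\<close>, so that \<open>m \<le> 2 * (m - 1)\<close>.\<close>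
    have "real m ^ k \<le> 2 ^ k * real (m - 1) ^ k"
    proof (cases k)
      case (Suc k')
      then have "real m \<le> 2 * real (m - 1)" using m by (simp add: of_nat_diff)
      then show ?thesis unfolding power_mult_distrib[symmetric] by (intro power_mono) auto
    qed simp
    moreover have "real m ^ k > 0" using m by simp
    moreover have "1 / u \<le> w / v" if "0 < v" "v \<le> w * u" "0 \<le> u" "0 \<le> w" for u v w :: real
      using that by (cases "u = 0") (auto simp: field_simps)
    ultimately have "1 / real (m - 1) ^ k \<le> 2 ^ k / real m ^ k" by simp
    from mult_left_mono[OF this, of "9 * c * B / real m"] c B0
    have "9 * e / real m \<le> (9 * c * 2 ^ k) * B / real m ^ Suc k"
      by (simp add: e_def mult_ac)
    then have "\<forall>x\<in>{-1..1}. \<bar>D 0 x - poly (Q + r) x\<bar> \<le> (9 * c * 2 ^ k) * B / real m ^ Suc k"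
      using r(2) order.trans unfolding poly_add diff_diff_eq by blast
    moreover have "degree (Q + r) \<le> m"
      using Q(2) q(1) r(1) m by (intro degree_add_le) auto
    ultimately show ?thesis by blast
  qed
  then show ?case using c by (intro exI[of _ "9 * c * 2 ^ k"]) auto
qed

text \<open>The discrete convolution is diagonal in the Chebyshev basis, with the autocorrelation of
  \<open>a\<close> at lag \<open>l\<close> as multiplier. This is the formula from which the
  reproduction property of the de la Vallee Poussin means is read off.\<close>

lemma sum_cos_kernel_op:
  assumes "m + l \<le> M" "0 < M"
  shows "(\<Sum>s<M. cos (real l * (2 * pi * real s / real M)) * poly (kernel_op a m M s) (cos \<theta>))
    = (\<Sum>j<m - l. a j * a (j + l)) * cos (real l * \<theta>)"
proof -
  let ?t = "\<lambda>s. 2 * pi * real s / real M"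
  have "(\<Sum>s<M. cos (real l * ?t s) * poly (kernel_op a m M s) (cos \<theta>))
      = (\<Sum>i<m. \<Sum>j<m. a i * a j * cos (real (nat_dist i j) * \<theta>) / real M *
          (\<Sum>s<M. cos (real (nat_dist i j) * ?t s) * cos (real l * ?t s)))"
    unfolding kernel_op_def poly_sum poly_smult poly_cheb_T_cos sum_distrib_left
    by (subst sum.swap, rule sum.cong[OF refl], subst sum.swap) (simp add: mult_ac)
  also have "\<dots> = (\<Sum>i<m. \<Sum>j<m. a i * a j *
      (of_bool (nat_dist i j = l) + of_bool (nat_dist i j = 0 \<and> l = 0)) * (cos (real l * \<theta>) / 2))"
  proof (intro sum.cong refl)
    fix i j assume "i \<in> {..<m}" "j \<in> {..<m}"
    then have "nat_dist i j + l < M" using nat_dist_less[of i m j] assms by simp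
    from sum_cos_cos_equispaced'[OF this, of 0]
    have S: "(\<Sum>s<M. cos (real (nat_dist i j) * ?t s) * cos (real l * ?t s))
      = real M / 2 * (of_bool (nat_dist i j = l) + of_bool (nat_dist i j = 0 \<and> l = 0))"
      by (simp only: add_0)
    show "a i * a j * cos (real (nat_dist i j) * \<theta>) / real M *
          (\<Sum>s<M. cos (real (nat_dist i j) * ?t s) * cos (real l * ?t s))
        = a i * a j * (of_bool (nat_dist i j = l) + of_bool (nat_dist i j = 0 \<and> l = 0)) * (cos (real l * \<theta>) / 2)"
      unfolding S using assms(2) by (cases "nat_dist i j = l") auto
  qed
  finally show ?thesis unfolding sum_distrib_right[symmetric] sum_pairs_at_distance by simp
qed

text \<open>De la Vallee Poussin means, twice the Fejer kernel of order \<open>2 * m\<close> minus the one of order \<open>m\<close>.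
  They are a bounded linear operator with near-best error, so that the operators in the single
  coordinates can be composed.\<close>

definition vp_poly :: "nat \<Rightarrow> nat \<Rightarrow> real poly" where
  "vp_poly m s = smult (1 / real m)
     (kernel_op (\<lambda>_. 1) (2 * m) (4 * m) s - kernel_op (\<lambda>_. 1) m (4 * m) s)"

lemma degree_vp_poly: "degree (vp_poly m s) \<le> 2 * m"
  unfolding vp_poly_def
  by (intro order.trans[OF degree_smult_le] degree_diff_le)
     (auto intro: order.trans[OF degree_kernel_op])

text \<open>The two kernels are nonnegative on the interval and have masses \<open>2 * m\<close> and
  \<open>m\<close>; their sum, divided by \<open>m\<close>, dominates the absolute value of the
  difference.\<close>

lemma sum_abs_vp_poly:
  assumes "x \<in> {-1..1}" "m > 0"
  shows "(\<Sum>s<4 * m. \<bar>poly (vp_poly m s) x\<bar>) \<le> 3"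
proof -
  have "(\<Sum>s<4 * m. \<bar>poly (vp_poly m s) x\<bar>)
      \<le> (\<Sum>s<4 * m. (poly (kernel_op (\<lambda>_. 1) (2 * m) (4 * m) s) x
          + poly (kernel_op (\<lambda>_. 1) m (4 * m) s) x) / real m)"
  proof (rule sum_mono)
    fix s
    show "\<bar>poly (vp_poly m s) x\<bar> \<le> (poly (kernel_op (\<lambda>_. 1) (2 * m) (4 * m) s) x
          + poly (kernel_op (\<lambda>_. 1) m (4 * m) s) x) / real m"
      using poly_kernel_op_nonneg[OF assms(1), of "\<lambda>_. 1" "2 * m" "4 * m" s]
        poly_kernel_op_nonneg[OF assms(1), of "\<lambda>_. 1" "m" "4 * m" s] assms(2)
      by (simp add: vp_poly_def abs_mult divide_right_mono)
  qed
  also have "\<dots> = 3"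
    unfolding sum_divide_distrib[symmetric] sum.distrib using assms by (simp add: sum_poly_kernel_op)
  finally show ?thesis .
qed

text \<open>On a frequency \<open>l \<le> m\<close> the triangular multipliers are
  \<open>2 * m - l\<close> and \<open>m - l\<close>; their difference is \<open>m\<close> whatever
  \<open>l\<close> is. Exactness asks for at least \<open>3 * m\<close> nodes, and there are
  \<open>4 * m\<close>.\<close>

lemma vp_poly_reproduces:
  assumes "degree p \<le> m" "m > 0" "x \<in> {-1..1}"
  shows "(\<Sum>s<4 * m. poly p (cos (2 * pi * real s / real (4 * m))) * poly (vp_poly m s) x) = poly p x"
proof -
  obtain \<theta> where x: "x = cos \<theta>" using assms(3) by (metis atLeastAtMost_iff cos_arccos)
  obtain c where p: "p = (\<Sum>l\<le>m. smult (c l) (cheb_T l))" using cheb_T_span assms by blast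
  let ?t = "\<lambda>s. 2 * pi * real s / real (4 * m)"
  have T: "(\<Sum>s<4 * m. cos (real l * ?t s) * poly (vp_poly m s) x) = cos (real l * \<theta>)" if "l \<le> m" for l
  proof -
    have k: "(\<Sum>s<4 * m. cos (real l * ?t s) * poly (kernel_op (\<lambda>_. 1) n (4 * m) s) (cos \<theta>))
        = real (n - l) * cos (real l * \<theta>)" if "n + l \<le> 4 * m" for n
      unfolding sum_cos_kernel_op[OF that mult_pos_pos[OF zero_less_numeral assms(2)]] by simp
    have "(\<Sum>s<4 * m. cos (real l * ?t s) * poly (vp_poly m s) x)
        = (\<Sum>s<4 * m. (cos (real l * ?t s) * poly (kernel_op (\<lambda>_. 1) (2 * m) (4 * m) s) (cos \<theta>)
          - cos (real l * ?t s) * poly (kernel_op (\<lambda>_. 1) m (4 * m) s) (cos \<theta>)) / real m)"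
      unfolding vp_poly_def x poly_smult poly_diff right_diff_distrib
      by (intro sum.cong refl) (simp add: diff_divide_distrib)
    also have "\<dots> = (real (2 * m - l) * cos (real l * \<theta>) - real (m - l) * cos (real l * \<theta>)) / real m"
      unfolding sum_divide_distrib[symmetric] sum_subtractf using that by (subst (1 2) k) auto
    also have "\<dots> = (real (2 * m - l) - real (m - l)) * cos (real l * \<theta>) / real m"
      by (simp only: left_diff_distrib)
    also have "\<dots> = cos (real l * \<theta>)"
      using that assms(2) by (simp add: of_nat_diff)
    finally show ?thesis .
  qed
  have "(\<Sum>s<4 * m. poly p (cos (?t s)) * poly (vp_poly m s) x)
      = (\<Sum>l\<le>m. c l * (\<Sum>s<4 * m. cos (real l * ?t s) * poly (vp_poly m s) x))"
    unfolding p poly_sum poly_smult poly_cheb_T_cos sum_distrib_right sum_distrib_left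
    by (subst sum.swap) (simp only: mult.assoc)
  also have "\<dots> = poly p x"
    unfolding p poly_sum poly_smult x poly_cheb_T_cos
    by (intro sum.cong refl arg_cong2[of _ _ _ _ "(*)"]) (use T in \<open>simp add: x\<close>)
  finally show ?thesis .
qed

text \<open>Lebesgue's inequality: an operator of norm at most 3 that reproduces \<open>p\<close>
  has at most \<open>1 + 3\<close> times the error of \<open>p\<close>. So the polynomial from
  \<open>jackson_Ck\<close>, which depends on the function in no controlled way, is replaced by a
  linear operator.\<close>

lemma vp_approx_Ck:
  "\<exists>c>0. \<forall>(D :: nat \<Rightarrow> real \<Rightarrow> real) B m. k \<le> m \<longrightarrow> 0 < m \<longrightarrow>
    (\<forall>j<k. \<forall>x\<in>{-1..1}. (D j has_real_derivative D (Suc j) x) (at x within {-1..1})) \<longrightarrow>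
    (\<forall>x\<in>{-1..1}. \<bar>D k x\<bar> \<le> B) \<longrightarrow>
    (\<forall>x\<in>{-1..1}. \<bar>D 0 x - (\<Sum>s<4 * m. D 0 (cos (2 * pi * real s / real (4 * m))) * poly (vp_poly m s) x)\<bar>
       \<le> c * B / real m ^ k)"
proof -
  obtain c where c: "c > 0" and J: "\<And>(D :: nat \<Rightarrow> real \<Rightarrow> real) B m. k \<le> m \<Longrightarrow>
    (\<forall>j<k. \<forall>x\<in>{-1..1}. (D j has_real_derivative D (Suc j) x) (at x within {-1..1})) \<Longrightarrow>
    (\<forall>x\<in>{-1..1}. \<bar>D k x\<bar> \<le> B) \<Longrightarrow>
    (\<exists>p. degree p \<le> m \<and> (\<forall>x\<in>{-1..1}. \<bar>D 0 x - poly p x\<bar> \<le> c * B / real m ^ k))"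
    using jackson_Ck[of k] by blast
  have "\<bar>D 0 x - (\<Sum>s<4 * m. D 0 (cos (2 * pi * real s / real (4 * m))) * poly (vp_poly m s) x)\<bar>
       \<le> (4 * c) * B / real m ^ k"
    if "k \<le> m" "0 < m"
      and D: "\<forall>j<k. \<forall>x\<in>{-1..1}. (D j has_real_derivative D (Suc j) x) (at x within {-1..1})"
      and B: "\<forall>x\<in>{-1..1}. \<bar>D k x\<bar> \<le> B" and x: "x \<in> {-1..1}"
    for D :: "nat \<Rightarrow> real \<Rightarrow> real" and B m x
  proof -
    define e where "e = c * B / real m ^ k"
    obtain p where p: "degree p \<le> m" "\<And>x. x \<in> {-1..1} \<Longrightarrow> \<bar>D 0 x - poly p x\<bar> \<le> e"
      using J[OF \<open>k \<le> m\<close> D B] by (auto simp: e_def)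
    let ?t = "\<lambda>s. cos (2 * pi * real s / real (4 * m))"
    have "D 0 x - (\<Sum>s<4 * m. D 0 (?t s) * poly (vp_poly m s) x)
        = (D 0 x - poly p x) - (\<Sum>s<4 * m. (D 0 (?t s) - poly p (?t s)) * poly (vp_poly m s) x)"
      unfolding left_diff_distrib sum_subtractf vp_poly_reproduces[OF p(1) \<open>0 < m\<close> x] by simp
    then have "\<bar>D 0 x - (\<Sum>s<4 * m. D 0 (?t s) * poly (vp_poly m s) x)\<bar>
        \<le> \<bar>D 0 x - poly p x\<bar> + \<bar>\<Sum>s<4 * m. (D 0 (?t s) - poly p (?t s)) * poly (vp_poly m s) x\<bar>"
      by (simp only: abs_triangle_ineq4)
    also have "\<dots> \<le> e + (\<Sum>s<4 * m. e * \<bar>poly (vp_poly m s) x\<bar>)"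
    proof (rule add_mono[OF p(2)[OF x] order.trans[OF sum_abs sum_mono]])
      fix s
      have "?t s \<in> {-1..1}" using cos_ge_minus_one cos_le_one unfolding atLeastAtMost_iff by blast
      then have "\<bar>D 0 (?t s) - poly p (?t s)\<bar> \<le> e" by (rule p(2))
      then show "\<bar>(D 0 (?t s) - poly p (?t s)) * poly (vp_poly m s) x\<bar> \<le> e * \<bar>poly (vp_poly m s) x\<bar>"
        unfolding abs_mult by (rule mult_right_mono[OF _ abs_ge_zero])
    qed
    also have "\<dots> \<le> e + e * 3"
      unfolding sum_distrib_left[symmetric]
      using order.trans[OF abs_ge_zero p(2)[OF x]]
      by (intro add_left_mono mult_left_mono sum_abs_vp_poly[OF x \<open>0 < m\<close>])
    finally show ?thesis by (simp add: e_def mult_ac)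
  qed
  then show ?thesis using c by (intro exI[of _ "4 * c"]) auto
qed


subsection \<open>Tensor-product interpolation and total degree\<close>

lemma finite_multidegrees: "finite {\<alpha> :: 'n::finite \<Rightarrow> nat. \<forall>i. \<alpha> i \<le> N}"
proof -
  have "{\<alpha> :: 'n \<Rightarrow> nat. \<forall>i. \<alpha> i \<le> N} = PiE UNIV (\<lambda>_. {..N})"
    by (auto simp: PiE_def Pi_def)
  then show ?thesis by (simp add: finite_PiE)
qed

lemma Q_space_add:
  assumes "p \<in> Q_space N" "q \<in> Q_space N"
  shows "(\<lambda>x. p x + q x) \<in> Q_space N"
proof -
  obtain c d where p: "p = (\<lambda>x. \<Sum>\<alpha> | \<forall>i. \<alpha> i \<le> N. c \<alpha> * (\<Prod>i\<in>UNIV. (x $ i) ^ \<alpha> i))"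
    and q: "q = (\<lambda>x. \<Sum>\<alpha> | \<forall>i. \<alpha> i \<le> N. d \<alpha> * (\<Prod>i\<in>UNIV. (x $ i) ^ \<alpha> i))"
    using assms unfolding Q_space_def by blast
  show ?thesis
    unfolding Q_space_def p q
    by (rule range_eqI[of _ _ "\<lambda>\<alpha>. c \<alpha> + d \<alpha>"]) (simp add: sum.distrib distrib_right)
qed

lemma Q_space_scale:
  assumes "p \<in> Q_space N"
  shows "(\<lambda>x. r * p x) \<in> Q_space N"
proof -
  obtain c where p: "p = (\<lambda>x. \<Sum>\<alpha> | \<forall>i. \<alpha> i \<le> N. c \<alpha> * (\<Prod>i\<in>UNIV. (x $ i) ^ \<alpha> i))"
    using assms unfolding Q_space_def by blast
  show ?thesis
    unfolding Q_space_def p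
    by (rule range_eqI[of _ _ "\<lambda>\<alpha>. r * c \<alpha>"]) (simp add: sum_distrib_left mult_ac)
qed

lemma Q_space_monomial:
  assumes "\<And>i. \<alpha> i \<le> N"
  shows "(\<lambda>x :: real^'n. \<Prod>i\<in>UNIV. (x $ i) ^ \<alpha> i) \<in> Q_space N"
  unfolding Q_space_def
proof (rule range_eqI[of _ _ "\<lambda>\<beta>. of_bool (\<beta> = \<alpha>)"])
  have "(\<Sum>\<beta> | \<forall>i. \<beta> i \<le> N. of_bool (\<beta> = \<alpha>) * (\<Prod>i\<in>UNIV. (x $ i) ^ \<beta> i))
      = (\<Sum>\<beta> | \<forall>i. \<beta> i \<le> N. if \<beta> = \<alpha> then \<Prod>i\<in>UNIV. (x $ i) ^ \<beta> i else 0)" for x :: "real^'n"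
    by (intro sum.cong refl) auto
  then show "(\<lambda>x :: real^'n. \<Prod>i\<in>UNIV. (x $ i) ^ \<alpha> i)
      = (\<lambda>x. \<Sum>\<beta> | \<forall>i. \<beta> i \<le> N. of_bool (\<beta> = \<alpha>) * (\<Prod>i\<in>UNIV. (x $ i) ^ \<beta> i))"
    using assms by (simp add: sum.delta finite_multidegrees)
qed

lemma Q_space_0: "(\<lambda>x. 0) \<in> Q_space N"
  unfolding Q_space_def by (rule range_eqI[of _ _ "\<lambda>_. 0"]) simp

lemma Q_space_sum:
  assumes "\<And>j. j \<in> J \<Longrightarrow> p j \<in> Q_space N"
  shows "(\<lambda>x. \<Sum>j\<in>J. p j x) \<in> Q_space N"
  using assms by (induction J rule: infinite_finite_induct) (auto intro: Q_space_0 Q_space_add)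

lemma Q_space_induct [consumes 1, case_names add scale zero monomial]:
  assumes "q \<in> Q_space N"
    and "\<And>p q. P p \<Longrightarrow> P q \<Longrightarrow> P (\<lambda>x. p x + q x)"
    and "\<And>r p. P p \<Longrightarrow> P (\<lambda>x. r * p x)"
    and "P (\<lambda>x. 0)"
    and "\<And>\<alpha>. (\<And>i. \<alpha> i \<le> N) \<Longrightarrow> P (\<lambda>x :: real^'n. \<Prod>i\<in>UNIV. (x $ i) ^ \<alpha> i)"
  shows "P q"
proof -
  obtain c where q: "q = (\<lambda>x. \<Sum>\<alpha> | \<forall>i. \<alpha> i \<le> N. c \<alpha> * (\<Prod>i\<in>UNIV. (x $ i) ^ \<alpha> i))"
    using assms(1) unfolding Q_space_def by blast
  have "P (\<lambda>x. \<Sum>\<alpha>\<in>J. c \<alpha> * (\<Prod>i\<in>UNIV. (x $ i) ^ \<alpha> i))"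
    if "finite J" "J \<subseteq> {\<alpha>. \<forall>i. \<alpha> i \<le> N}" for J
    using that by (induction J rule: finite_induct) (auto intro!: assms(2-5))
  then show ?thesis unfolding q using finite_multidegrees by blast
qed

lemma Q_space_mono:
  assumes "q \<in> Q_space N" "N \<le> M"
  shows "q \<in> Q_space M"
  using assms(1)
proof (induction rule: Q_space_induct)
  case (monomial \<alpha>)
  then show ?case using assms(2) by (intro Q_space_monomial) (meson order.trans)
qed (auto intro: Q_space_add Q_space_scale Q_space_0)

lemma Q_space_mult:
  assumes "p \<in> Q_space N" "q \<in> Q_space M"
  shows "(\<lambda>x. p x * q x) \<in> Q_space (N + M)"
  using assms(1)
proof (induction rule: Q_space_induct)
  case (add p p')
  then show ?case using Q_space_add by (fastforce simp: distrib_right)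
next
  case (scale r p)
  then show ?case using Q_space_scale[of _ "N + M" r] by (fastforce simp: mult.assoc)
next
  case (monomial \<alpha>)
  show ?case using assms(2)
  proof (induction rule: Q_space_induct)
    case (add p p')
    then show ?case using Q_space_add by (fastforce simp: distrib_left)
  next
    case (scale r p)
    then show ?case using Q_space_scale[of _ "N + M" r] by (fastforce simp: mult.left_commute)
  next
    case (monomial \<beta>)
    with \<open>\<And>i. \<alpha> i \<le> N\<close> have "\<alpha> i + \<beta> i \<le> N + M" for i by (simp add: add_mono)
    from Q_space_monomial[OF this] show ?case
      by (simp add: power_add prod.distrib)
  qed (simp add: Q_space_0)
qed (simp add: Q_space_0)

lemma Q_space_const: "(\<lambda>x. c) \<in> Q_space N"
  using Q_space_scale[OF Q_space_monomial[of "\<lambda>_. 0" N], of c] by simp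

lemma Q_space_prod_poly:
  fixes P :: "'n::finite \<Rightarrow> real poly"
  assumes "\<And>i. degree (P i) \<le> N"
  shows "(\<lambda>x :: real^'n. \<Prod>i\<in>UNIV. poly (P i) (x $ i)) \<in> Q_space N"
proof -
  have "poly (P i) t = (\<Sum>k\<le>N. coeff (P i) k * t ^ k)" for i t
    unfolding poly_altdef using assms[of i]
    by (intro sum.mono_neutral_left) (auto simp: coeff_eq_0)
  then have "(\<Prod>i\<in>UNIV. poly (P i) (x $ i))
      = (\<Sum>\<alpha>\<in>PiE UNIV (\<lambda>_. {..N}). (\<Prod>i\<in>UNIV. coeff (P i) (\<alpha> i)) * (\<Prod>i\<in>UNIV. (x $ i) ^ \<alpha> i))"
    for x :: "real^'n"
    by (simp add: prod_sum_PiE prod.distrib)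
  moreover have "(\<lambda>x :: real^'n. \<Sum>\<alpha>\<in>PiE UNIV (\<lambda>_. {..N}).
      (\<Prod>i\<in>UNIV. coeff (P i) (\<alpha> i)) * (\<Prod>i\<in>UNIV. (x $ i) ^ \<alpha> i)) \<in> Q_space N"
    by (intro Q_space_sum Q_space_scale Q_space_monomial) auto
  ultimately show ?thesis by simp
qed

section \<open>Lagrange interpolation in one variable and on product grids\<close>

definition lagrange_poly :: "real set \<Rightarrow> real \<Rightarrow> real poly" where
  "lagrange_poly T t = (\<Prod>s\<in>T - {t}. smult (1 / (t - s)) [:- s, 1:])"

lemma degree_lagrange_poly:
  assumes "finite T" "t \<in> T" "card T = Suc N"
  shows "degree (lagrange_poly T t) \<le> N"
proof -
  have "degree (lagrange_poly T t) \<le> (\<Sum>s\<in>T - {t}. degree (smult (1 / (t - s)) [:- s, 1:]))"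
    unfolding lagrange_poly_def by (rule degree_prod_sum_le[unfolded o_def]) (use assms in simp)
  also have "\<dots> \<le> (\<Sum>s\<in>T - {t}. 1)"
    by (intro sum_mono order.trans[OF degree_smult_le]) simp
  finally show ?thesis using assms by simp
qed

lemma poly_lagrange_poly:
  assumes "finite T" "s \<in> T" "t \<in> T"
  shows "poly (lagrange_poly T t) s = of_bool (s = t)"
  using assms
  by (auto simp: lagrange_poly_def poly_prod diff_divide_distrib[symmetric] intro!: prod.neutral)

lemma lagrange_poly_interpolates:
  assumes "finite T" "card T = Suc N" "degree p \<le> N"
  shows "poly p x = (\<Sum>t\<in>T. poly p t * poly (lagrange_poly T t) x)"
proof -
  have "p = (\<Sum>t\<in>T. smult (poly p t) (lagrange_poly T t))"
  proof (rule poly_eqI_degree[of T])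
    fix s assume "s \<in> T"
    then have "(\<Sum>t\<in>T. poly p t * poly (lagrange_poly T t) s) = (\<Sum>t\<in>T. if s = t then poly p t else 0)"
      using assms(1) by (intro sum.cong refl) (simp add: poly_lagrange_poly)
    then show "poly p s = poly (\<Sum>t\<in>T. smult (poly p t) (lagrange_poly T t)) s"
      using assms(1) \<open>s \<in> T\<close> by (simp add: poly_sum)
  next
    have "degree (\<Sum>t\<in>T. smult (poly p t) (lagrange_poly T t)) \<le> N"
      using assms by (intro degree_sum_le order.trans[OF degree_smult_le] degree_lagrange_poly)
    then show "degree (\<Sum>t\<in>T. smult (poly p t) (lagrange_poly T t)) < card T"
      using assms by simp
  qed (use assms in simp)
  then have "poly p x = poly (\<Sum>t\<in>T. smult (poly p t) (lagrange_poly T t)) x" by simp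
  then show ?thesis by (simp add: poly_sum)
qed

lemma finite_grid:
  fixes T :: "'n::finite \<Rightarrow> 'a set"
  assumes "\<And>i. finite (T i)"
  shows "finite {x :: 'a^'n. \<forall>i. x $ i \<in> T i}"
proof (rule finite_subset)
  show "{x. \<forall>i. x $ i \<in> T i} \<subseteq> vec_lambda ` PiE UNIV T"
  proof
    fix x :: "'a^'n" assume "x \<in> {x. \<forall>i. x $ i \<in> T i}"
    then have "vec_lambda (\<lambda>i. x $ i) \<in> vec_lambda ` PiE UNIV T" by (intro imageI) auto
    then show "x \<in> vec_lambda ` PiE UNIV T" by simp
  qed
qed (simp add: finite_PiE assms)

text \<open>Both sides are linear in \<open>q\<close>, so a monomial suffices; there the formula is
  the product over the coordinates of the one-dimensional formulas, multiplied out over all choices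
  of nodes.\<close>

lemma tensor_interpolation:
  fixes T :: "'n::finite \<Rightarrow> real set" and N :: nat
  defines "X \<equiv> {x :: real^'n. \<forall>i. x $ i \<in> T i}"
  assumes T: "\<And>i. finite (T i)" "\<And>i. card (T i) = Suc N" and q: "q \<in> Q_space N"
  shows "q x = (\<Sum>y\<in>X. q y * (\<Prod>i\<in>UNIV. poly (lagrange_poly (T i) (y $ i)) (x $ i)))"
  using q
proof (induction arbitrary: x rule: Q_space_induct)
  case (add p q)
  from add(1)[of x] add(2)[of x] show ?case by (simp add: distrib_right sum.distrib)
next
  case (scale r p)
  from scale[of x] show ?case by (simp add: sum_distrib_left mult.assoc)
next
  case (monomial \<alpha>)
  have "(x $ i) ^ \<alpha> i = (\<Sum>t\<in>T i. t ^ \<alpha> i * poly (lagrange_poly (T i) t) (x $ i))" for i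
    using lagrange_poly_interpolates[OF T(1)[of i] T(2)[of i], of "monom 1 (\<alpha> i)" "x $ i"] monomial[of i]
    by (simp add: poly_monom degree_monom_eq)
  then have "(\<Prod>i\<in>UNIV. (x $ i) ^ \<alpha> i)
      = (\<Sum>g\<in>PiE UNIV T. \<Prod>i\<in>UNIV. g i ^ \<alpha> i * poly (lagrange_poly (T i) (g i)) (x $ i))"
    by (simp only: prod_sum_PiE[OF finite T(1)])
  also have "\<dots> = (\<Sum>y\<in>X. (\<Prod>i\<in>UNIV. (y $ i) ^ \<alpha> i)
      * (\<Prod>i\<in>UNIV. poly (lagrange_poly (T i) (y $ i)) (x $ i)))"
    by (rule sum.reindex_bij_witness[of _ "\<lambda>y i. y $ i" "\<lambda>g. \<chi> i. g i"])
       (auto simp: X_def prod.distrib)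
  finally show ?case .
qed simp

lemma tensor_lagrange_at_node:
  fixes T :: "'n::finite \<Rightarrow> real set" and x y :: "real^'n"
  assumes "\<And>i. finite (T i)" "\<And>i. x $ i \<in> T i" "\<And>i. y $ i \<in> T i"
  shows "(\<Prod>i\<in>UNIV. poly (lagrange_poly (T i) (y $ i)) (x $ i)) = (if x = y then 1 else 0)"
proof -
  have "(\<Prod>i\<in>UNIV. poly (lagrange_poly (T i) (y $ i)) (x $ i)) = (\<Prod>i\<in>UNIV. of_bool (x $ i = y $ i))"
    using assms by (intro prod.cong refl poly_lagrange_poly) auto
  also have "\<dots> = (if x = y then 1 else 0)"
    by (auto simp: vec_eq_iff intro!: prod_zero)
  finally show ?thesis .
qed

text \<open>The description in \<open>lagrange\<close> is resolved by unisolvence: the tensor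
  product of one-dimensional Lagrange polynomials has the required values, and
  \<open>tensor_interpolation\<close> shows that the values on the grid determine an element of
  \<open>Q_space N\<close>.\<close>

lemma
  fixes T :: "'n::finite \<Rightarrow> real set" and N :: nat
  defines "X \<equiv> {x :: real^'n. \<forall>i. x $ i \<in> T i}"
  assumes T: "\<And>i. finite (T i)" "\<And>i. card (T i) = Suc N"
  shows lagrange_tensor: "y \<in> X \<Longrightarrow>
      lagrange N X y = (\<lambda>x. \<Prod>i\<in>UNIV. poly (lagrange_poly (T i) (y $ i)) (x $ i))"
    and lagrange_in_Q_space: "y \<in> X \<Longrightarrow> lagrange N X y \<in> Q_space N"
    and Q_space_lagrange_expansion: "q \<in> Q_space N \<Longrightarrow> q x = (\<Sum>y\<in>X. q y * lagrange N X y x)"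
proof -
  let ?l = "\<lambda>y x. \<Prod>i\<in>UNIV. poly (lagrange_poly (T i) (y $ i)) (x $ i)"
  have Q: "?l y \<in> Q_space N" if "y \<in> X" for y
    using that T by (intro Q_space_prod_poly degree_lagrange_poly) (auto simp: X_def)
  show *: "lagrange N X y = ?l y" if y: "y \<in> X" for y
    unfolding lagrange_def
  proof (rule the_equality)
    have "?l y x = (if x = y then 1 else 0)" if "x \<in> X" for x
      using that y T(1) by (intro tensor_lagrange_at_node) (auto simp: X_def)
    with Q[OF y] show "?l y \<in> Q_space N \<and> (\<forall>x\<in>X. ?l y x = (if x = y then 1 else 0))"
      by blast
    fix q assume q: "q \<in> Q_space N \<and> (\<forall>x\<in>X. q x = (if x = y then 1 else 0))"
    have finX: "finite X" unfolding X_def by (rule finite_grid[OF T(1)])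
    show "q = ?l y"
    proof
      fix x
      have "q x = (\<Sum>z\<in>X. q z * ?l z x)"
        using q unfolding X_def by (intro tensor_interpolation[OF T]) auto
      also have "\<dots> = (\<Sum>z\<in>X. if z = y then ?l z x else 0)"
        using q by (intro sum.cong refl) auto
      finally show "q x = ?l y x" using y finX by simp
    qed
  qed
  show "lagrange N X y \<in> Q_space N" if "y \<in> X" for y
    using * Q that by simp
  show "q x = (\<Sum>y\<in>X. q y * lagrange N X y x)" if "q \<in> Q_space N"
  proof -
    have "q x = (\<Sum>y\<in>X. q y * ?l y x)"
      using that unfolding X_def by (intro tensor_interpolation[OF T]) auto
    then show ?thesis using * by simp
  qed
qed

text \<open>Unlike \<open>Q_space\<close>, polynomials of bounded total degree are preserved by all affine maps.\<close>

inductive total_degree_le :: "nat \<Rightarrow> (real^'n \<Rightarrow> real) \<Rightarrow> bool" where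
  const: "total_degree_le N (\<lambda>_. c)"
| coord: "total_degree_le 1 (\<lambda>x. x $ i)"
| add: "total_degree_le N f \<Longrightarrow> total_degree_le N g \<Longrightarrow> total_degree_le N (\<lambda>x. f x + g x)"
| mult: "total_degree_le N f \<Longrightarrow> total_degree_le M g \<Longrightarrow> total_degree_le (N + M) (\<lambda>x. f x * g x)"
| mono: "total_degree_le N f \<Longrightarrow> N \<le> M \<Longrightarrow> total_degree_le M f"

lemma total_degree_le_Q_space:
  fixes f :: "real^'n \<Rightarrow> real"
  shows "total_degree_le N f \<Longrightarrow> f \<in> Q_space N"
proof (induction rule: total_degree_le.induct)
  case (coord i)
  have "(\<lambda>x :: real^'n. x $ i) = (\<lambda>x. \<Prod>j\<in>UNIV. (x $ j) ^ of_bool (j = i))"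
    by (simp add: of_bool_def if_distrib prod.delta cong: if_cong)
  then show ?case by (simp only:) (intro Q_space_monomial, simp)
qed (auto intro: Q_space_const Q_space_add Q_space_mult Q_space_mono)

lemma total_degree_le_scale: "total_degree_le N f \<Longrightarrow> total_degree_le N (\<lambda>x. c * f x)"
  using total_degree_le.mult[OF total_degree_le.const[of 0 c]] by simp

lemma total_degree_le_sum:
  assumes "\<And>j. j \<in> J \<Longrightarrow> total_degree_le N (f j)"
  shows "total_degree_le N (\<lambda>x. \<Sum>j\<in>J. f j x)"
  using assms
  by (induction J rule: infinite_finite_induct) (auto intro: total_degree_le.const total_degree_le.add)

lemma total_degree_le_power:
  "total_degree_le N f \<Longrightarrow> total_degree_le (k * N) (\<lambda>x. f x ^ k)"
  by (induction k) (auto intro: total_degree_le.const total_degree_le.mult)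

lemma total_degree_le_prod:
  assumes "finite J" "\<And>j. j \<in> J \<Longrightarrow> total_degree_le N (f j)"
  shows "total_degree_le (card J * N) (\<lambda>x. \<Prod>j\<in>J. f j x)"
  using assms
  by (induction J rule: finite_induct) (auto intro: total_degree_le.const total_degree_le.mult)

lemma total_degree_le_poly:
  assumes "degree p \<le> N" "total_degree_le 1 f"
  shows "total_degree_le N (\<lambda>x. poly p (f x))"
  unfolding poly_altdef
proof (intro total_degree_le_sum total_degree_le_scale)
  fix k assume "k \<in> {..degree p}"
  then show "total_degree_le N (\<lambda>x. f x ^ k)"
    using total_degree_le.mono[OF total_degree_le_power[OF assms(2), of k]] assms(1) by auto
qed

text \<open>Serves to transfer to \<open>Q_space\<close> the continuity and Lipschitz bounds that
  are proved by induction on \<open>total_degree_le\<close>.\<close>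

lemma Q_space_total_degree_le:
  fixes q :: "real^'n \<Rightarrow> real"
  assumes "q \<in> Q_space N"
  shows "total_degree_le (CARD('n) * N) q"
  using assms
proof (induction rule: Q_space_induct)
  case (monomial \<alpha>)
  have "total_degree_le N (\<lambda>x :: real^'n. (x $ i) ^ \<alpha> i)" for i
    using total_degree_le.mono[OF total_degree_le_power[OF total_degree_le.coord[of i], of "\<alpha> i"], of N]
      monomial[of i] by simp
  then show ?case by (intro total_degree_le_prod) auto
qed (auto intro: total_degree_le.add total_degree_le_scale total_degree_le.const)

lemma total_degree_le_affine:
  fixes A :: "real^'n^'n" and f :: "real^'n \<Rightarrow> real"
  assumes "total_degree_le N f"
  shows "total_degree_le N (\<lambda>x. f (A *v x + b))"
  using assms
proof (induction rule: total_degree_le.induct)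
  case (coord i)
  have "(\<lambda>x. (A *v x + b) $ i) = (\<lambda>x. (\<Sum>j\<in>UNIV. A $ i $ j * x $ j) + b $ i)"
    by (simp add: matrix_vector_mult_def)
  moreover have "total_degree_le 1 (\<lambda>x. (\<Sum>j\<in>UNIV. A $ i $ j * x $ j) + b $ i)"
    by (intro total_degree_le.add total_degree_le.const total_degree_le_sum total_degree_le_scale
        total_degree_le.coord)
  ultimately show ?case by simp
qed (auto intro: total_degree_le.intros)

lemma total_degree_le_continuous: "total_degree_le N f \<Longrightarrow> continuous_on UNIV f"
  by (induction rule: total_degree_le.induct) (auto intro!: continuous_intros)

text \<open>The size and the Lipschitz bound are proved together because the product rule for
  differences uses both. A single constant serves for the two, whence \<open>max 1 R\<close> for a
  coordinate and the factor 2 for a product.\<close>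

lemma total_degree_le_lipschitz:
  fixes f :: "real^'n \<Rightarrow> real"
  assumes "total_degree_le N f"
  shows "\<exists>C\<ge>0. \<forall>x\<in>cball 0 R. \<forall>y\<in>cball 0 R. \<bar>f x\<bar> \<le> C \<and> \<bar>f x - f y\<bar> \<le> C * norm (x - y)"
  using assms
proof (induction rule: total_degree_le.induct)
  case (const N c)
  show ?case by (rule exI[of _ "\<bar>c\<bar>"]) auto
next
  case (coord i)
  show ?case
  proof (rule exI[of _ "max 1 R"], safe)
    fix x y :: "real^'n" assume "x \<in> cball 0 R"
    then show "\<bar>x $ i\<bar> \<le> max 1 R" using component_le_norm_cart[of x i] by simp
    have "\<bar>x $ i - y $ i\<bar> \<le> 1 * norm (x - y)" using component_le_norm_cart[of "x - y" i] by simp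
    also have "\<dots> \<le> max 1 R * norm (x - y)" by (intro mult_right_mono) auto
    finally show "\<bar>x $ i - y $ i\<bar> \<le> max 1 R * norm (x - y)" .
  qed simp
next
  case (add N f g)
  then obtain C D where C: "C \<ge> 0" "D \<ge> 0"
    "\<forall>x\<in>cball 0 R. \<forall>y\<in>cball 0 R. \<bar>f x\<bar> \<le> C \<and> \<bar>f x - f y\<bar> \<le> C * norm (x - y)"
    "\<forall>x\<in>cball 0 R. \<forall>y\<in>cball 0 R. \<bar>g x\<bar> \<le> D \<and> \<bar>g x - g y\<bar> \<le> D * norm (x - y)" by blast
  show ?case
  proof (intro exI[of _ "C + D"] conjI ballI)
    fix x y :: "real^'n" assume "x \<in> cball 0 R" "y \<in> cball 0 R"
    with C have "\<bar>f x\<bar> \<le> C" "\<bar>g x\<bar> \<le> D" "\<bar>f x - f y\<bar> \<le> C * norm (x - y)" "\<bar>g x - g y\<bar> \<le> D * norm (x - y)"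
      by blast+
    then show "\<bar>f x + g x\<bar> \<le> C + D" "\<bar>f x + g x - (f y + g y)\<bar> \<le> (C + D) * norm (x - y)"
      by (auto simp: distrib_right abs_le_iff)
  qed (use C in auto)
next
  case (mult N f M g)
  then obtain C D where C: "C \<ge> 0" "D \<ge> 0"
    "\<forall>x\<in>cball 0 R. \<forall>y\<in>cball 0 R. \<bar>f x\<bar> \<le> C \<and> \<bar>f x - f y\<bar> \<le> C * norm (x - y)"
    "\<forall>x\<in>cball 0 R. \<forall>y\<in>cball 0 R. \<bar>g x\<bar> \<le> D \<and> \<bar>g x - g y\<bar> \<le> D * norm (x - y)" by blast
  show ?case
  proof (intro exI[of _ "2 * (C * D)"] conjI ballI)
    fix x y :: "real^'n" assume "x \<in> cball 0 R" "y \<in> cball 0 R"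
    with C have *: "\<bar>f x\<bar> \<le> C" "\<bar>g x\<bar> \<le> D" "\<bar>g y\<bar> \<le> D"
      "\<bar>f x - f y\<bar> \<le> C * norm (x - y)" "\<bar>g x - g y\<bar> \<le> D * norm (x - y)"
      by blast+
    have "\<bar>f x * g x\<bar> \<le> C * D" unfolding abs_mult using * C by (intro mult_mono) auto
    then show "\<bar>f x * g x\<bar> \<le> 2 * (C * D)" using C(1,2) by (smt (verit) mult_nonneg_nonneg)
    have "\<bar>f x * g x - f y * g y\<bar> = \<bar>f x * (g x - g y) + (f x - f y) * g y\<bar>"
      by (simp add: algebra_simps)
    also have "\<dots> \<le> \<bar>f x\<bar> * \<bar>g x - g y\<bar> + \<bar>f x - f y\<bar> * \<bar>g y\<bar>"
      by (metis abs_mult abs_triangle_ineq)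
    also have "\<dots> \<le> C * (D * norm (x - y)) + (C * norm (x - y)) * D"
      using * C(1,2) by (intro add_mono mult_mono) auto
    finally show "\<bar>f x * g x - f y * g y\<bar> \<le> 2 * (C * D) * norm (x - y)"
      by (simp add: algebra_simps)
  qed (use C in auto)
qed blast


subsection \<open>Lebesgue constants of Chebyshev nodes\<close>

text \<open>Shifting by one trades the first term for its periodic copy at the end. The induction
  runs in both directions because the shift will be a floor of either sign.\<close>

lemma sum_periodic_shift:
  fixes h :: "int \<Rightarrow> real"
  assumes "\<And>i. h (i + int M) = h i"
  shows "(\<Sum>s<M. h (int s + c)) = (\<Sum>s<M. h (int s))"
proof -
  have step: "(\<Sum>s<M. h (int s + (c + 1))) = (\<Sum>s<M. h (int s + c))" for c
  proof -
    have "(\<Sum>s<Suc M. h (int s + c)) = h c + (\<Sum>s<M. h (int s + (c + 1)))"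
      unfolding sum.lessThan_Suc_shift by (simp add: algebra_simps)
    moreover have "(\<Sum>s<Suc M. h (int s + c)) = (\<Sum>s<M. h (int s + c)) + h c"
      using assms[of c] by (simp add: add.commute)
    ultimately show ?thesis by simp
  qed
  show ?thesis
  proof (induction c rule: int_induct[where k = 0])
    case (step1 i)
    then show ?case using step[of i] by simp
  next
    case (step2 i)
    then show ?case using step[of "i - 1"] by simp
  qed simp
qed

lemma sin_ge_linear:
  assumes "0 \<le> x" "x \<le> pi / 2"
  shows "2 * x / pi \<le> sin x"
proof -
  have "convex_on {0..pi/2} (\<lambda>x. - sin x)"
  proof (rule f''_ge0_imp_convex[where f' = "\<lambda>x. - cos x" and f'' = sin])
    show "((\<lambda>x. - sin x) has_real_derivative - cos x) (at x)" for x
      by (auto intro!: derivative_eq_intros)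
    show "((\<lambda>x. - cos x) has_real_derivative sin x) (at x)" for x
      by (auto intro!: derivative_eq_intros)
  qed (auto intro: sin_ge_zero)
  from convex_onD_Icc'[OF this, of x] assms show ?thesis by (simp add: field_simps)
qed

text \<open>The bound has a simple pole at each end, as \<open>1 / sin x\<close> does, and it shares
  the symmetry under \<open>x \<mapsto> pi - x\<close>. So it is enough to treat the left half,
  where Jordan's inequality \<open>sin_ge_linear\<close> applies.\<close>

lemma inverse_sin_le:
  assumes "0 < x" "x < pi"
  shows "1 / sin x \<le> pi / 2 * (1 / x + 1 / (pi - x))"
proof -
  have *: "x * (pi - x) \<le> pi\<^sup>2 / 2 * sin x" if "0 < x" "x \<le> pi / 2" for x
  proof -
    have "x * (pi - x) \<le> x * pi" using that by (intro mult_left_mono) auto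
    also have "\<dots> = pi\<^sup>2 / 2 * (2 * x / pi)" by (simp add: power2_eq_square)
    also have "\<dots> \<le> pi\<^sup>2 / 2 * sin x" using that by (intro mult_left_mono sin_ge_linear) auto
    finally show ?thesis .
  qed
  have "x * (pi - x) \<le> pi\<^sup>2 / 2 * sin x"
  proof (cases "x \<le> pi / 2")
    case False
    then show ?thesis using *[of "pi - x"] assms by (simp add: mult.commute)
  qed (use * assms in auto)
  moreover have "pi / 2 * (1 / x + 1 / (pi - x)) = pi\<^sup>2 / 2 / (x * (pi - x))"
    using assms by (simp add: field_simps power2_eq_square)
  moreover have "sin x > 0" "x * (pi - x) > 0" using assms by (auto intro: sin_gt_zero)
  moreover have "1 / s \<le> c / P" if "0 < s" "0 < P" "P \<le> c * s" for s c P :: real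
    using that by (simp add: field_simps)
  ultimately show ?thesis by simp
qed

lemma sum_inverse_le_ln:
  assumes "n \<ge> 1"
  shows "(\<Sum>s=1..n. 1 / real s) \<le> 1 + ln (real n)"
  using assms
proof (induction n rule: dec_induct)
  case (step n)
  have "ln (real n / real (Suc n)) \<le> real n / real (Suc n) - 1"
    using step by (intro ln_le_minus_one) auto
  then have "1 / real (Suc n) \<le> ln (real (Suc n)) - ln (real n)"
    using step by (simp add: ln_div field_simps)
  then show ?case using step by simp
qed simp

text \<open>The two terms next to the singularity are bounded by \<open>M\<close>, the others by a harmonic sum.\<close>

lemma sum_abs_dirichlet_like:
  fixes D :: "real \<Rightarrow> real"
  assumes M: "M \<ge> 1"
    and D1: "\<And>u. \<bar>D u\<bar> \<le> real M"
    and D2: "\<And>u. \<bar>D u\<bar> * \<bar>sin (u / 2)\<bar> \<le> 1"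
    and per: "\<And>u. D (u + 2 * pi) = D u"
  shows "(\<Sum>s<M. \<bar>D (u + 2 * pi * real s / real M)\<bar>) \<le> real M * (3 + ln (real M))"
proof -
  \<comment> \<open>This is \<open>u\<close> in units of the mesh width. After a shift by its
    integer part only the offset \<open>\<delta>\<close> remains, and the nodes next to the
    singularities at 0 and \<open>2 * pi\<close> are \<open>s = 0\<close> and
    \<open>s = M - 1\<close>.\<close>
  define y where "y = u * real M / (2 * pi)"
  define q where "q = \<lfloor>y\<rfloor>"
  define \<delta> where "\<delta> = y - of_int q"
  have \<delta>: "0 \<le> \<delta>" "\<delta> < 1" unfolding \<delta>_def q_def by linarith+
  define h where "h i = \<bar>D (2 * pi * (of_int i + \<delta>) / real M)\<bar>" for i :: int
  have u: "u = 2 * pi * (of_int q + \<delta>) / real M"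
    using M by (simp add: \<delta>_def y_def)
  have "\<bar>D (u + 2 * pi * real s / real M)\<bar> = h (int s + q)" for s
    unfolding h_def u by (simp add: algebra_simps add_divide_distrib)
  then have "(\<Sum>s<M. \<bar>D (u + 2 * pi * real s / real M)\<bar>) = (\<Sum>s<M. h (int s + q))" by simp
  also have "\<dots> = (\<Sum>s<M. h (int s))"
  proof (rule sum_periodic_shift)
    fix i
    have "2 * pi * (of_int (i + int M) + \<delta>) / real M = 2 * pi * (of_int i + \<delta>) / real M + 2 * pi"
      using M by (simp add: field_simps)
    then show "h (i + int M) = h i" unfolding h_def by (simp only: per)
  qed
  also have "\<dots> \<le> real M * (3 + ln (real M))"
  proof (cases "M = 1")
    case True
    then show ?thesis using D1 by (simp add: h_def order.trans[OF D1])
  next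
    case False
    then obtain m where m: "M = Suc (Suc m)" using M by (metis One_nat_def not0_implies_Suc not_one_le_zero)
    have mid: "h (int s) \<le> real M / 2 * (1 / real s + 1 / real (Suc m - s))" if s: "s \<in> {1..m}" for s
    proof -
      define x where "x = pi * (real s + \<delta>) / real M"
      have "0 < (real s + \<delta>) / real M" "(real s + \<delta>) / real M < 1" using s \<delta> by (auto simp: m)
      from mult_strict_left_mono[OF this(1) pi_gt_zero] mult_strict_left_mono[OF this(2) pi_gt_zero]
      have x: "0 < x" "x < pi" by (simp_all add: x_def)
      have "h (int s) * sin x \<le> 1"
        using D2[of "2 * pi * (real s + \<delta>) / real M"] sin_gt_zero[OF x] by (simp add: h_def x_def)
      then have "h (int s) \<le> 1 / sin x" using sin_gt_zero[OF x] by (simp add: field_simps)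
      also have "\<dots> \<le> pi / 2 * (1 / x + 1 / (pi - x))" by (rule inverse_sin_le[OF x])
      also have "pi - x = pi * (real M - real s - \<delta>) / real M" using M by (simp add: x_def field_simps)
      also have "pi / 2 * (1 / x + 1 / (pi * (real M - real s - \<delta>) / real M))
          = real M / 2 * (1 / (real s + \<delta>) + 1 / (real M - real s - \<delta>))"
        unfolding x_def distrib_left[of "pi / 2"] distrib_left[of "real M / 2"] by simp
      \<comment> \<open>The offset is rounded down to 0 in the first denominator and up to 1 in the
        second; as \<open>M = m + 2\<close>, the latter becomes \<open>Suc m - s\<close>, still
        positive for \<open>s \<le> m\<close>.\<close>
      also have "\<dots> \<le> real M / 2 * (1 / real s + 1 / real (Suc m - s))"
        using s \<delta> by (intro mult_left_mono add_mono divide_left_mono) (auto simp: m of_nat_diff)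
      finally show ?thesis .
    qed
    have "(\<Sum>s<M. h (int s)) = (\<Sum>s<Suc m. h (int s)) + h (int (Suc m))"
      unfolding m by (rule sum.lessThan_Suc)
    also have "(\<Sum>s<Suc m. h (int s)) = h (int 0) + (\<Sum>s<m. h (int (Suc s)))"
      by (rule sum.lessThan_Suc_shift)
    also have "(\<Sum>s<m. h (int (Suc s))) = (\<Sum>s=1..m. h (int s))"
      by (simp add: sum.atLeast1_atMost_eq)
    finally have "(\<Sum>s<M. h (int s)) = h (int 0) + (\<Sum>s=1..m. h (int s)) + h (int (Suc m))" .
    also have "\<dots> \<le> real M + (\<Sum>s=1..m. real M / 2 * (1 / real s + 1 / real (Suc m - s))) + real M"
      by (intro add_mono sum_mono mid) (auto simp: h_def D1)
    also have "(\<Sum>s=1..m. real M / 2 * (1 / real s + 1 / real (Suc m - s)))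
        = real M / 2 * ((\<Sum>s=1..m. 1 / real s) + (\<Sum>s=1..m. 1 / real (Suc m - s)))"
      unfolding sum_distrib_left[symmetric] sum.distrib ..
    also have "(\<Sum>s=1..m. 1 / real (Suc m - s)) = (\<Sum>s=1..m. 1 / real s)"
      by (rule sum.reindex_bij_witness[of _ "\<lambda>s. Suc m - s" "\<lambda>s. Suc m - s"]) auto
    also have "(\<Sum>s=1..m. 1 / real s) \<le> 1 + ln (real M)"
    proof (cases "m = 0")
      case False
      then have "(\<Sum>s=1..m. 1 / real s) \<le> 1 + ln (real m)" by (intro sum_inverse_le_ln) simp
      also have "\<dots> \<le> 1 + ln (real M)" using False by (simp add: m)
      finally show ?thesis .
    qed (use M in \<open>simp add: m\<close>)
    finally show ?thesis using M by (simp add: algebra_simps)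
  qed
  finally show ?thesis .
qed

text \<open>The nodes of either kind are the cosines of \<open>M = circle_size kind N\<close> equispaced angles. Interpolation of
  a function \<open>f\<close> is the discrete convolution of \<open>f \<circ> cos\<close> at these angles with the Dirichlet kernel, whose
  last term is halved for the second kind since there \<open>2 * N = M\<close>.\<close>

definition dirichlet :: "nat \<Rightarrow> real \<Rightarrow> real" where
  "dirichlet n u = 1 + 2 * (\<Sum>k=1..n. cos (real k * u))"

lemma dirichlet_sin: "dirichlet n u * sin (u / 2) = sin ((real n + 1 / 2) * u)"
proof (induction n)
  case (Suc n)
  have "2 * cos (real (Suc n) * u) * sin (u / 2)
      = sin (real (Suc n) * u + u / 2) - sin (real (Suc n) * u - u / 2)"
    by (simp only: sin_add sin_diff)
  moreover have "real (Suc n) * u + u / 2 = (real (Suc n) + 1 / 2) * u"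
    and "real (Suc n) * u - u / 2 = (real n + 1 / 2) * u"
    by (simp_all add: algebra_simps)
  moreover have "dirichlet (Suc n) u = dirichlet n u + 2 * cos (real (Suc n) * u)"
    by (simp add: dirichlet_def)
  ultimately show ?case using Suc by (simp only: distrib_right)
qed (simp add: dirichlet_def)

lemma abs_dirichlet_le: "\<bar>dirichlet n u\<bar> \<le> 1 + 2 * real n"
proof -
  have "\<bar>\<Sum>k=1..n. cos (real k * u)\<bar> \<le> (\<Sum>k=1..n. 1)"
    by (intro order.trans[OF sum_abs] sum_mono) simp
  then show ?thesis unfolding dirichlet_def by (auto simp: abs_le_iff)
qed

lemma cos_nat_periodic: "cos (real k * (u + 2 * pi)) = cos (real k * u)"
  using cos.plus_of_nat[of "real k * u" k] by (simp add: distrib_left)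

lemma dirichlet_periodic: "dirichlet n (u + 2 * pi) = dirichlet n u"
  unfolding dirichlet_def cos_nat_periodic ..

fun interp_kernel :: "cheb_kind \<Rightarrow> nat \<Rightarrow> real \<Rightarrow> real" where
  "interp_kernel First_Kind N u = dirichlet N u"
| "interp_kernel Second_Kind N u = dirichlet (N - 1) u + cos (real N * u)"

fun circle_size :: "cheb_kind \<Rightarrow> nat \<Rightarrow> nat" where
  "circle_size First_Kind N = 2 * N + 2"
| "circle_size Second_Kind N = 2 * N"

fun circle_shift :: "cheb_kind \<Rightarrow> nat \<Rightarrow> real" where
  "circle_shift First_Kind N = pi / real (2 * N + 2)"
| "circle_shift Second_Kind N = 0"

definition circle_node :: "cheb_kind \<Rightarrow> nat \<Rightarrow> nat \<Rightarrow> real" where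
  "circle_node kind N s = circle_shift kind N + 2 * pi * real s / real (circle_size kind N)"

text \<open>Both kernels meet the hypotheses of \<open>sum_abs_dirichlet_like\<close>. For the
  second kind, halving the last term is what turns the product with \<open>sin (u / 2)\<close> into
  \<open>sin (N * u) * cos (u / 2)\<close>.\<close>

lemma sum_abs_interp_kernel:
  assumes "N \<ge> 1"
  shows "(\<Sum>s<circle_size kind N. \<bar>interp_kernel kind N (u + circle_node kind N s)\<bar>)
    \<le> real (circle_size kind N) * (3 + ln (real (circle_size kind N)))"
proof -
  have D1: "\<bar>interp_kernel kind N u\<bar> \<le> real (circle_size kind N)" for u
  proof (cases kind)
    case First_Kind
    then show ?thesis using abs_dirichlet_le[of N u] by simp
  next
    case Second_Kind
    have "\<bar>dirichlet (N - 1) u + cos (real N * u)\<bar> \<le> (1 + 2 * real (N - 1)) + 1"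
      by (intro order.trans[OF abs_triangle_ineq] add_mono abs_dirichlet_le) simp
    then show ?thesis using Second_Kind assms by (simp add: of_nat_diff)
  qed
  have D2: "\<bar>interp_kernel kind N u\<bar> * \<bar>sin (u / 2)\<bar> \<le> 1" for u
  proof (cases kind)
    case First_Kind
    then show ?thesis by (simp add: abs_mult[symmetric] dirichlet_sin)
  next
    case Second_Kind
    have e: "(real (N - 1) + 1 / 2) * u = real N * u - u / 2"
      using assms by (simp add: of_nat_diff algebra_simps)
    have "(dirichlet (N - 1) u + cos (real N * u)) * sin (u / 2) = sin (real N * u) * cos (u / 2)"
      by (simp only: distrib_right[of "dirichlet (N - 1) u"] dirichlet_sin e sin_diff)
    then have "\<bar>interp_kernel kind N u\<bar> * \<bar>sin (u / 2)\<bar> = \<bar>sin (real N * u)\<bar> * \<bar>cos (u / 2)\<bar>"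
      using Second_Kind by (simp add: abs_mult[symmetric])
    also have "\<dots> \<le> 1 * 1" by (intro mult_mono) auto
    finally show ?thesis by simp
  qed
  have per: "interp_kernel kind N (u + 2 * pi) = interp_kernel kind N u" for u
    by (cases kind) (simp_all only: interp_kernel.simps dirichlet_periodic cos_nat_periodic)
  have "circle_size kind N \<ge> 1" using assms by (cases kind) auto
  from sum_abs_dirichlet_like[OF this D1 D2 per, of "u + circle_shift kind N"]
  show ?thesis by (simp add: circle_node_def add.assoc)
qed


fun kernel_coeff :: "cheb_kind \<Rightarrow> nat \<Rightarrow> nat \<Rightarrow> real" where
  "kernel_coeff First_Kind N j = (if j = 0 then 1 else 2)"
| "kernel_coeff Second_Kind N j = (if j = 0 \<or> j = N then 1 else 2)"

lemma interp_kernel_expand: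
  assumes "N \<ge> 1"
  shows "interp_kernel kind N u = (\<Sum>j\<le>N. kernel_coeff kind N j * cos (real j * u))"
proof -
  have d: "dirichlet n u = (\<Sum>j\<le>n. (if j = 0 then 1 else 2) * cos (real j * u))" for n
    by (induction n) (simp_all add: dirichlet_def algebra_simps)
  show ?thesis
  proof (cases kind)
    case First_Kind
    then show ?thesis by (simp add: d)
  next
    case Second_Kind
    obtain n where n: "N = Suc n" using assms by (cases N) auto
    have "(\<Sum>j\<le>n. (if j = 0 then 1 else 2) * cos (real j * u))
        = (\<Sum>j\<le>n. (if j = 0 \<or> j = Suc n then 1 else 2) * cos (real j * u))"
      by (intro sum.cong refl) auto
    then show ?thesis using Second_Kind by (simp add: d n)
  qed
qed

text \<open>The only aliasing occurs for the second kind at \<open>j = l = N\<close>, where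
  \<open>j + l\<close> is the number of nodes. The cosine is then 1 or -1 at every node, so the sum
  is twice the usual one, and the halved coefficient compensates.\<close>

lemma kernel_coeff_orthogonal:
  assumes "N \<ge> 1" "j \<le> N" "l \<le> N"
  shows "kernel_coeff kind N j * (\<Sum>s<circle_size kind N.
      cos (real j * circle_node kind N s) * cos (real l * circle_node kind N s))
    = real (circle_size kind N) * of_bool (j = l)"
proof (cases "kind = Second_Kind \<and> j = N \<and> l = N")
  case True
  have "cos (real N * circle_node kind N s) * cos (real N * circle_node kind N s) = 1" for s
  proof -
    have "real N * circle_node kind N s = real s * pi"
      using True assms by (simp add: circle_node_def)
    then show ?thesis by (simp flip: power2_eq_square power_mult add: mult.commute)
  qed
  then show ?thesis using True by simp
next
  case False
  then have "j + l < circle_size kind N"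
    using assms by (cases kind) auto
  from sum_cos_cos_equispaced'[OF this, of "circle_shift kind N"]
  show ?thesis using False assms by (cases kind) (auto simp: circle_node_def)
qed

text \<open>By \<open>cheb_T_span\<close> only cosines matter, and for these orthogonality leaves
  one term. The sum runs over the circle: a node in the interior of the interval is the cosine of
  two of the angles.\<close>

lemma interp_kernel_reproduces:
  assumes "N \<ge> 1" "degree p \<le> N"
  shows "poly p (cos \<theta>) = (\<Sum>s<circle_size kind N. poly p (cos (circle_node kind N s)) *
     (interp_kernel kind N (\<theta> + circle_node kind N s) + interp_kernel kind N (- \<theta> + circle_node kind N s)))
       / (2 * real (circle_size kind N))"
proof -
  obtain c where p: "p = (\<Sum>l\<le>N. smult (c l) (cheb_T l))" using cheb_T_span assms by blast
  let ?M = "circle_size kind N" and ?t = "circle_node kind N"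
  have M: "real ?M > 0" using assms by (cases kind) auto
  have k: "interp_kernel kind N (\<theta> + t) + interp_kernel kind N (- \<theta> + t)
      = 2 * (\<Sum>j\<le>N. kernel_coeff kind N j * (cos (real j * \<theta>) * cos (real j * t)))" for t
    unfolding interp_kernel_expand[OF assms(1)] sum.distrib[symmetric] sum_distrib_left
    by (intro sum.cong refl) (simp add: distrib_left cos_add cos_diff algebra_simps)
  have "(\<Sum>s<?M. cos (real l * ?t s) * (interp_kernel kind N (\<theta> + ?t s) + interp_kernel kind N (- \<theta> + ?t s)))
      = 2 * real ?M * cos (real l * \<theta>)" if "l \<le> N" for l
  proof -
    have "(\<Sum>s<?M. cos (real l * ?t s) * (interp_kernel kind N (\<theta> + ?t s) + interp_kernel kind N (- \<theta> + ?t s)))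
        = (\<Sum>j\<le>N. 2 * cos (real j * \<theta>) * (kernel_coeff kind N j * (\<Sum>s<?M. cos (real j * ?t s) * cos (real l * ?t s))))"
      unfolding k sum_distrib_left by (subst sum.swap) (simp add: mult_ac)
    also have "\<dots> = (\<Sum>j\<le>N. if j = l then 2 * real ?M * cos (real l * \<theta>) else 0)"
      using that assms(1) by (intro sum.cong refl) (simp add: kernel_coeff_orthogonal)
    finally show ?thesis using that by simp
  qed
  note * = this
  have "(\<Sum>s<?M. poly p (cos (?t s)) * (interp_kernel kind N (\<theta> + ?t s) + interp_kernel kind N (- \<theta> + ?t s)))
      = (\<Sum>l\<le>N. c l * (\<Sum>s<?M. cos (real l * ?t s) * (interp_kernel kind N (\<theta> + ?t s) + interp_kernel kind N (- \<theta> + ?t s))))"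
    unfolding p poly_sum poly_smult poly_cheb_T_cos sum_distrib_right sum_distrib_left
    by (subst sum.swap) (simp only: mult.assoc)
  also have "\<dots> = 2 * real ?M * poly p (cos \<theta>)"
  proof -
    have "(\<Sum>l\<le>N. c l * (\<Sum>s<?M. cos (real l * ?t s) * (interp_kernel kind N (\<theta> + ?t s) + interp_kernel kind N (- \<theta> + ?t s))))
        = (\<Sum>l\<le>N. c l * (2 * real ?M * cos (real l * \<theta>)))"
      by (intro sum.cong refl) (simp only: * atMost_iff)
    also have "\<dots> = 2 * real ?M * poly p (cos \<theta>)"
      unfolding p poly_sum poly_smult poly_cheb_T_cos sum_distrib_left
      by (intro sum.cong refl) simp
    finally show ?thesis .
  qed
  finally show ?thesis using M by simp
qed

text \<open>The angles on the lower half circle are mirror images of those on the upper half, where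
  the nodes are defined; \<open>2 * N + 1 - s\<close> and \<open>2 * N - s\<close> are the reflected
  indices for the two kinds.\<close>

lemma cos_circle_node:
  assumes "N \<ge> 1" "s < circle_size kind N"
  shows "\<exists>j\<le>N. cos (circle_node kind N s) = cheb_node kind N j"
proof (cases kind)
  case First_Kind
  have node: "circle_node kind N s = (2 * real s + 1) * pi / (2 * real N + 2)"
    using First_Kind by (simp add: circle_node_def add_divide_distrib algebra_simps)
  show ?thesis
  proof (cases "s \<le> N")
    case False
    define j where "j = 2 * N + 1 - s"
    have j: "j \<le> N" "real s = 2 * real N + 1 - real j"
      using False assms First_Kind by (auto simp: j_def of_nat_diff)
    have "circle_node kind N s = - ((2 * real j + 1) * pi / (2 * real N + 2)) + of_int 1 * (2 * pi)"
      unfolding node j(2) by (simp add: field_simps)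
    then have "cos (circle_node kind N s) = cheb_node kind N j"
      using First_Kind by simp
    then show ?thesis using j by blast
  qed (use First_Kind node in auto)
next
  case Second_Kind
  have node: "circle_node kind N s = real s * pi / real N"
    using Second_Kind assms by (simp add: circle_node_def)
  show ?thesis
  proof (cases "s \<le> N")
    case False
    define j where "j = 2 * N - s"
    have j: "j \<le> N" "real s = 2 * real N - real j"
      using False assms Second_Kind by (auto simp: j_def of_nat_diff)
    have "circle_node kind N s = - (real j * pi / real N) + of_int 1 * (2 * pi)"
      unfolding node j(2) using assms by (simp add: field_simps)
    then have "cos (circle_node kind N s) = cheb_node kind N j"
      using Second_Kind by simp
    then show ?thesis using j by blast
  qed (use Second_Kind node in auto)
qed

lemma inj_cheb_node:
  assumes "N \<ge> 1"
  shows "inj_on (cheb_node kind N) {0..N}"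
proof (cases kind)
  case First_Kind
  show ?thesis
  proof (rule inj_onI)
    fix i j assume ij: "i \<in> {0..N}" "j \<in> {0..N}" "cheb_node kind N i = cheb_node kind N j"
    have r: "0 \<le> (2 * real i + 1) * pi / (2 * real N + 2)" "(2 * real i + 1) * pi / (2 * real N + 2) \<le> pi"
      if "i \<in> {0..N}" for i
    proof -
      have "pi * ((2 * real i + 1) / (2 * real N + 2)) \<le> pi"
        using that by (intro mult_left_le) auto
      then show "0 \<le> (2 * real i + 1) * pi / (2 * real N + 2)" "(2 * real i + 1) * pi / (2 * real N + 2) \<le> pi"
        by (simp_all add: mult.commute)
    qed
    have "(2 * real i + 1) * pi / (2 * real N + 2) = (2 * real j + 1) * pi / (2 * real N + 2)"
      by (rule cos_inj_pi[OF r(1)[OF ij(1)] r(2)[OF ij(1)] r(1)[OF ij(2)] r(2)[OF ij(2)]])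
         (use ij(3) First_Kind in simp)
    then show "i = j" by (simp add: field_simps)
  qed
next
  case Second_Kind
  show ?thesis
  proof (rule inj_onI)
    fix i j assume ij: "i \<in> {0..N}" "j \<in> {0..N}" "cheb_node kind N i = cheb_node kind N j"
    have r: "0 \<le> real i * pi / real N" "real i * pi / real N \<le> pi"
      if "i \<in> {0..N}" for i using that assms by (auto simp: field_simps)
    have "real i * pi / real N = real j * pi / real N"
      by (rule cos_inj_pi[OF r(1)[OF ij(1)] r(2)[OF ij(1)] r(1)[OF ij(2)] r(2)[OF ij(2)]])
         (use ij(3) Second_Kind in simp)
    then show "i = j" using assms by (simp add: field_simps)
  qed
qed

lemma finite_cheb_nodes: "finite (cheb_nodes kind N a b)"
  by (simp add: cheb_nodes_def)

lemma card_cheb_nodes: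
  assumes "N \<ge> 1" "a < b"
  shows "card (cheb_nodes kind N a b) = Suc N"
proof -
  have "inj_on (\<lambda>j. (a + b) / 2 + (b - a) / 2 * cheb_node kind N j) {0..N}"
    using inj_cheb_node[OF assms(1), of kind] assms(2) by (auto simp: inj_on_def)
  then show ?thesis unfolding cheb_nodes_def by (simp add: card_image)
qed

lemma affine_interval_bounds:
  fixes a b :: real
  assumes "a \<le> b" "u \<in> {-1..1}"
  shows "(a + b) / 2 + (b - a) / 2 * u \<in> {a..b}"
proof -
  have "(b - a) / 2 * u \<le> (b - a) / 2 * 1" "(b - a) / 2 * (-1) \<le> (b - a) / 2 * u"
    using assms by (intro mult_left_mono; simp)+
  then show ?thesis unfolding atLeastAtMost_iff by argo
qed

lemma cheb_nodes_subset:
  assumes "a \<le> b"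
  shows "cheb_nodes kind N a b \<subseteq> {a..b}"
proof -
  have "cheb_node kind N j \<in> {-1..1}" for j by (cases kind) auto
  then show ?thesis using affine_interval_bounds[OF assms] by (auto simp: cheb_nodes_def)
qed

text \<open>Reproducing a Lagrange polynomial by \<open>interp_kernel\<close> leaves only the circle
  nodes above its own node \<open>y\<close>. Each circle node lies above exactly one
  \<open>y\<close>, so the sum over all \<open>y\<close> is at most a sum of absolute kernel values
  over the circle.\<close>

lemma lebesgue_constant_cheb:
  assumes "N \<ge> 1" "a < b" "x \<in> {a..b}"
  shows "(\<Sum>y\<in>cheb_nodes kind N a b. \<bar>poly (lagrange_poly (cheb_nodes kind N a b) y) x\<bar>)
    \<le> (2 + 3 / ln 2) * ln (real N + 1)"
proof -
  let ?T = "cheb_nodes kind N a b" and ?M = "circle_size kind N" and ?t = "circle_node kind N"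
  let ?D = "interp_kernel kind N"
  define z where "z u = (a + b) / 2 + (b - a) / 2 * u" for u
  have M: "real ?M > 0" using assms by (cases kind) auto
  define v where "v = (x - (a + b) / 2) / ((b - a) / 2)"
  have "v \<in> {-1..1}" using assms by (auto simp: v_def field_simps)
  then obtain \<theta> where "v = cos \<theta>" by (metis atLeastAtMost_iff cos_arccos)
  then have x: "x = z (cos \<theta>)" using assms by (simp add: z_def v_def field_simps)
  define B where "B s = (\<bar>?D (\<theta> + ?t s)\<bar> + \<bar>?D (- \<theta> + ?t s)\<bar>) / (2 * real ?M)" for s
  have zT: "z (cos (?t s)) \<in> ?T" if "s < ?M" for s
    using cos_circle_node[OF assms(1) that] by (auto simp: cheb_nodes_def z_def)
  have "\<bar>poly (lagrange_poly ?T y) x\<bar> \<le> (\<Sum>s<?M. of_bool (z (cos (?t s)) = y) * B s)" if y: "y \<in> ?T" for y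
  proof -
    \<comment> \<open>Pulling back to the standard interval makes the cosine formula applicable and
      leaves the degree bound intact.\<close>
    define p where "p = pcompose (lagrange_poly ?T y) [:(a + b) / 2, (b - a) / 2:]"
    have p: "poly p u = poly (lagrange_poly ?T y) (z u)" for u
      by (simp add: p_def poly_pcompose z_def mult.commute)
    have "degree p \<le> degree (lagrange_poly ?T y) * degree [:(a + b) / 2, (b - a) / 2:]"
      unfolding p_def by (rule degree_pcompose_le)
    also have "\<dots> \<le> N * 1"
      using degree_lagrange_poly[OF finite_cheb_nodes y card_cheb_nodes[OF assms(1,2)]]
      by (intro mult_le_mono) auto
    finally have "degree p \<le> N" by simp
    from interp_kernel_reproduces[OF assms(1) this, of \<theta> kind]
    have "poly (lagrange_poly ?T y) x = (\<Sum>s<?M. of_bool (z (cos (?t s)) = y) * (?D (\<theta> + ?t s) + ?D (- \<theta> + ?t s))) / (2 * real ?M)"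
      unfolding p x by (simp add: poly_lagrange_poly[OF finite_cheb_nodes zT y])
    also have "\<dots> = (\<Sum>s<?M. of_bool (z (cos (?t s)) = y) * ((?D (\<theta> + ?t s) + ?D (- \<theta> + ?t s)) / (2 * real ?M)))"
      unfolding sum_divide_distrib times_divide_eq_right ..
    finally have "\<bar>poly (lagrange_poly ?T y) x\<bar>
        \<le> (\<Sum>s<?M. \<bar>of_bool (z (cos (?t s)) = y) * ((?D (\<theta> + ?t s) + ?D (- \<theta> + ?t s)) / (2 * real ?M))\<bar>)"
      by (simp only: sum_abs)
    also have "\<dots> \<le> (\<Sum>s<?M. of_bool (z (cos (?t s)) = y) * B s)"
    proof (rule sum_mono)
      fix s
      show "\<bar>of_bool (z (cos (?t s)) = y) * ((?D (\<theta> + ?t s) + ?D (- \<theta> + ?t s)) / (2 * real ?M))\<bar>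
          \<le> of_bool (z (cos (?t s)) = y) * B s"
        unfolding abs_mult B_def using M by (intro mult_mono) (auto simp: abs_mult divide_right_mono)
    qed
    finally show ?thesis .
  qed
  then have "(\<Sum>y\<in>?T. \<bar>poly (lagrange_poly ?T y) x\<bar>) \<le> (\<Sum>y\<in>?T. \<Sum>s<?M. of_bool (z (cos (?t s)) = y) * B s)"
    by (rule sum_mono)
  also have "\<dots> = (\<Sum>s<?M. (\<Sum>y\<in>?T. of_bool (z (cos (?t s)) = y)) * B s)"
    by (subst sum.swap) (simp add: sum_distrib_right)
  also have "\<dots> = (\<Sum>s<?M. B s)"
  proof (intro sum.cong refl)
    fix s assume "s \<in> {..<?M}"
    then have "(\<Sum>y\<in>?T. if z (cos (?t s)) = y then 1 else 0 :: real) = 1"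
      using zT by (simp add: finite_cheb_nodes)
    then show "(\<Sum>y\<in>?T. of_bool (z (cos (?t s)) = y)) * B s = B s"
      by (simp add: of_bool_def)
  qed
  also have "\<dots> = ((\<Sum>s<?M. \<bar>?D (\<theta> + ?t s)\<bar>) + (\<Sum>s<?M. \<bar>?D (- \<theta> + ?t s)\<bar>)) / (2 * real ?M)"
    unfolding B_def sum_divide_distrib[symmetric] sum.distrib ..
  also have "\<dots> \<le> (real ?M * (3 + ln (real ?M)) + real ?M * (3 + ln (real ?M))) / (2 * real ?M)"
    by (intro divide_right_mono add_mono sum_abs_interp_kernel[OF assms(1)]) simp
  also have "\<dots> = 3 + ln (real ?M)" using M by (simp add: field_simps)
  also have "\<dots> \<le> 3 + ln (2 * (real N + 1))"
    using M by (cases kind) auto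
  also have "\<dots> = 3 + ln 2 + ln (real N + 1)" by (subst ln_mult) auto
  \<comment> \<open>As \<open>N \<ge> 1\<close>, both \<open>ln 2\<close> and 3 can be absorbed:
    \<open>ln 2\<close> costs one further \<open>ln (N + 1)\<close>, and 3 costs
    \<open>3 / ln 2\<close> of them.\<close>
  also have "\<dots> \<le> (2 + 3 / ln 2) * ln (real N + 1)"
  proof -
    have l: "ln 2 \<le> ln (real N + 1)" using assms(1) by simp
    have "3 = 3 / ln 2 * ln (2::real)" by simp
    also have "\<dots> \<le> 3 / ln 2 * ln (real N + 1)" by (intro mult_left_mono l) simp
    finally show ?thesis using l unfolding distrib_right by linarith
  qed
  finally show ?thesis .
qed


subsection \<open>Jackson's theorem on a box\<close>

definition upd :: "real^'n \<Rightarrow> 'n \<Rightarrow> real \<Rightarrow> real^'n" where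
  "upd x i t = (\<chi> j. if j = i then t else x $ j)"

lemma upd_nth [simp]: "upd x i t $ j = (if j = i then t else x $ j)"
  by (simp add: upd_def)

lemma upd_in_cbox: "x \<in> cbox a b \<Longrightarrow> t \<in> {a $ i..b $ i} \<Longrightarrow> upd x i t \<in> cbox a b"
  by (auto simp: mem_box_cart)

lemma upd_has_derivative:
  fixes g :: "real^'n \<Rightarrow> real"
  assumes "(g has_derivative (\<lambda>h. \<Sum>i\<in>UNIV. G i * h $ i)) (at (upd x i t) within cbox a b)"
    and "x \<in> cbox a b"
  shows "((\<lambda>t. g (upd x i t)) has_real_derivative G i) (at t within {a $ i..b $ i})"
proof -
  have eq: "upd x i = (\<lambda>t. upd x i 0 + t *\<^sub>R axis i 1)"
    by (auto simp: fun_eq_iff vec_eq_iff axis_def)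
  have "(upd x i has_derivative (\<lambda>h. h *\<^sub>R axis i 1)) (at t within {a $ i..b $ i})"
    by (subst eq) (auto intro!: derivative_eq_intros)
  moreover have "upd x i ` {a $ i..b $ i} \<subseteq> cbox a b" using upd_in_cbox[OF assms(2)] by auto
  ultimately have "((\<lambda>t. g (upd x i t)) has_derivative (\<lambda>h. \<Sum>j\<in>UNIV. G j * (h *\<^sub>R axis i 1) $ j))
      (at t within {a $ i..b $ i})"
    using has_derivative_in_compose[of "upd x i" "\<lambda>h. h *\<^sub>R axis i 1" t "{a $ i..b $ i}" g
        "\<lambda>h. \<Sum>i\<in>UNIV. G i * h $ i"]
      has_derivative_subset[OF assms(1)] by blast
  moreover have "(\<lambda>h. \<Sum>j\<in>UNIV. G j * (h *\<^sub>R axis i 1) $ j) = (*) (G i)"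
    by (auto simp: fun_eq_iff axis_def if_distrib cong: if_cong)
  ultimately show ?thesis by (simp add: has_field_derivative_def)
qed

lemma C_k_on_continuous: "C_k_on k K f \<Longrightarrow> continuous_on K f"
proof (cases k)
  case (Suc k')
  assume "C_k_on k K f"
  then obtain g where "\<forall>x\<in>K. (f has_derivative (\<lambda>h. \<Sum>i\<in>UNIV. g i x * h $ i)) (at x within K)"
    unfolding Suc by auto
  then show ?thesis by (intro has_derivative_continuous_on) blast
qed simp

text \<open>\<open>D\<close> consists of the pure partial derivatives in the fixed direction
  \<open>i\<close>, which is all that an operator acting in this coordinate sees. Continuity of the
  last one on the compact box will bound it uniformly over all lines parallel to the axis.\<close>

lemma C_k_on_partials:
  fixes f :: "real^'n \<Rightarrow> real"
  assumes "C_k_on k (cbox a b) f"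
  shows "\<exists>D :: nat \<Rightarrow> real^'n \<Rightarrow> real. D 0 = f \<and> continuous_on (cbox a b) (D k) \<and>
    (\<forall>j<k. \<forall>x\<in>cbox a b. \<forall>t\<in>{a $ i..b $ i}.
      ((\<lambda>t. D j (upd x i t)) has_real_derivative D (Suc j) (upd x i t)) (at t within {a $ i..b $ i}))"
  using assms
proof (induction k arbitrary: f)
  case 0
  then show ?case by (intro exI[of _ "\<lambda>_. f"]) simp
next
  case (Suc k)
  from Suc.prems obtain g where g: "\<And>x. x \<in> cbox a b \<Longrightarrow>
      (f has_derivative (\<lambda>h. \<Sum>i\<in>UNIV. g i x * h $ i)) (at x within cbox a b)"
    and gi: "\<And>i. C_k_on k (cbox a b) (g i)"
    unfolding C_k_on.simps by blast
  from Suc.IH[OF gi[of i]] obtain D where D: "D 0 = g i" "continuous_on (cbox a b) (D k)"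
    "\<And>j x t. j < k \<Longrightarrow> x \<in> cbox a b \<Longrightarrow> t \<in> {a $ i..b $ i} \<Longrightarrow>
      ((\<lambda>t. D j (upd x i t)) has_real_derivative D (Suc j) (upd x i t)) (at t within {a $ i..b $ i})"
    by blast
  define E where "E j = (case j of 0 \<Rightarrow> f | Suc j' \<Rightarrow> D j')" for j
  have "((\<lambda>t. E j (upd x i t)) has_real_derivative E (Suc j) (upd x i t)) (at t within {a $ i..b $ i})"
    if "j < Suc k" "x \<in> cbox a b" "t \<in> {a $ i..b $ i}" for j x t
  proof (cases j)
    case 0
    show ?thesis
      using upd_has_derivative[OF g[OF upd_in_cbox[OF that(2,3)]] that(2)] by (simp add: E_def 0 D(1))
  qed (use that D(3) in \<open>simp add: E_def\<close>)
  then show ?case using D(2) by (intro exI[of _ E]) (simp add: E_def)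
qed

definition box_coord :: "real^'n \<Rightarrow> real^'n \<Rightarrow> 'n \<Rightarrow> real \<Rightarrow> real" where
  "box_coord a b i u = (a $ i + b $ i) / 2 + (b $ i - a $ i) / 2 * u"

lemma box_coord_bounds:
  assumes "a $ i < b $ i" "u \<in> {-1..1}"
  shows "box_coord a b i u \<in> {a $ i..b $ i}"
  using affine_interval_bounds[of "a $ i" "b $ i" u] assms by (simp add: box_coord_def)

lemma box_coord_surj:
  assumes "a $ i < b $ i" "t \<in> {a $ i..b $ i}"
  shows "(2 * t - a $ i - b $ i) / (b $ i - a $ i) \<in> {-1..1}"
    and "box_coord a b i ((2 * t - a $ i - b $ i) / (b $ i - a $ i)) = t"
  using assms by (auto simp: box_coord_def field_simps)

text \<open>The de la Vallee Poussin mean in coordinate \<open>i\<close>, rescaled to the side of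
  the box, with the other coordinates as parameters. For \<open>x\<close> in a nondegenerate box it
  samples \<open>F\<close> inside the box only.\<close>

definition vp_dir :: "real^'n \<Rightarrow> real^'n \<Rightarrow> nat \<Rightarrow> 'n \<Rightarrow> (real^'n \<Rightarrow> real) \<Rightarrow> real^'n \<Rightarrow> real" where
  "vp_dir a b m i F x = (\<Sum>s<4 * m. F (upd x i (box_coord a b i (cos (2 * pi * real s / real (4 * m))))) *
     poly (vp_poly m s) ((2 * x $ i - a $ i - b $ i) / (b $ i - a $ i)))"

lemma vp_dir_approx:
  fixes f :: "real^'n \<Rightarrow> real"
  assumes ab: "\<And>i. a $ i < b $ i" and f: "C_k_on k (cbox a b) f"
  shows "\<exists>c>0. \<forall>m x. k \<le> m \<longrightarrow> 0 < m \<longrightarrow> x \<in> cbox a b \<longrightarrow> \<bar>f x - vp_dir a b m i f x\<bar> \<le> c / real m ^ k"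
proof -
  obtain D where D: "D 0 = f" "continuous_on (cbox a b) (D k)"
    "\<And>j x t. j < k \<Longrightarrow> x \<in> cbox a b \<Longrightarrow> t \<in> {a $ i..b $ i} \<Longrightarrow>
      ((\<lambda>t. D j (upd x i t)) has_real_derivative D (Suc j) (upd x i t)) (at t within {a $ i..b $ i})"
    using C_k_on_partials[OF f, of i] by blast
  obtain B where B: "\<And>x. x \<in> cbox a b \<Longrightarrow> \<bar>D k x\<bar> \<le> B"
    using compact_imp_bounded[OF compact_continuous_image[OF D(2) compact_cbox]]
    unfolding bounded_iff by (metis imageI real_norm_def)
  obtain c where cV: "c > 0 \<and> (\<forall>(D :: nat \<Rightarrow> real \<Rightarrow> real) B m. k \<le> m \<longrightarrow> 0 < m \<longrightarrow>
    (\<forall>j<k. \<forall>x\<in>{-1..1}. (D j has_real_derivative D (Suc j) x) (at x within {-1..1})) \<longrightarrow>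
    (\<forall>x\<in>{-1..1}. \<bar>D k x\<bar> \<le> B) \<longrightarrow>
    (\<forall>x\<in>{-1..1}. \<bar>D 0 x - (\<Sum>s<4 * m. D 0 (cos (2 * pi * real s / real (4 * m))) * poly (vp_poly m s) x)\<bar>
       \<le> c * B / real m ^ k))"
    using vp_approx_Ck[of k] by (rule exE)
  note c = cV[THEN conjunct1] and V = cV[THEN conjunct2, rule_format]
  define r where "r = (b $ i - a $ i) / 2"
  have r: "r > 0" using ab[of i] by (simp add: r_def)
  let ?z = "box_coord a b i"
  \<comment> \<open>Rescaling the side to length 2 multiplies the derivative of order
    \<open>k\<close> by \<open>r ^ k\<close>; adding 1 keeps the constant positive even when
    \<open>B = 0\<close>.\<close>
  have "\<bar>f x - vp_dir a b m i f x\<bar> \<le> (c * (r ^ k * \<bar>B\<bar>) + 1) / real m ^ k"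
    if m: "k \<le> m" "0 < m" and x: "x \<in> cbox a b" for m x
  proof -
    define E where "E j u = r ^ j * D j (upd x i (?z u))" for j u
    define v where "v = (2 * x $ i - a $ i - b $ i) / (b $ i - a $ i)"
    have "x $ i \<in> {a $ i..b $ i}" using x by (auto simp: mem_box_cart)
    from box_coord_surj[OF ab this] have v: "v \<in> {-1..1}" "?z v = x $ i" by (auto simp: v_def)
    have "(E j has_real_derivative E (Suc j) u) (at u within {-1..1})" if "j < k" "u \<in> {-1..1}" for j u
    proof -
      have z: "(?z has_real_derivative r) (at u within {-1..1})"
        unfolding box_coord_def r_def by (auto intro!: derivative_eq_intros)
      have "?z ` {-1..1} \<subseteq> {a $ i..b $ i}" using box_coord_bounds[of a i b] ab by blast
      from DERIV_subset[OF D(3)[OF that(1) x box_coord_bounds[OF ab that(2)]] this]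
      have "((\<lambda>t. D j (upd x i t)) has_real_derivative D (Suc j) (upd x i (?z u))) (at (?z u) within ?z ` {-1..1})" .
      from DERIV_image_chain[OF this z]
      have "((\<lambda>u. D j (upd x i (?z u))) has_real_derivative D (Suc j) (upd x i (?z u)) * r) (at u within {-1..1})"
        by (simp add: o_def)
      from DERIV_cmult[OF this, of "r ^ j"] show ?thesis
        unfolding E_def by (simp add: mult_ac)
    qed
    moreover have "\<bar>E k u\<bar> \<le> r ^ k * \<bar>B\<bar>" if "u \<in> {-1..1}" for u
    proof -
      have "\<bar>D k (upd x i (?z u))\<bar> \<le> \<bar>B\<bar>"
        using B[OF upd_in_cbox[OF x box_coord_bounds[OF ab[of i] that]]] by simp
      then show ?thesis using r by (simp add: E_def abs_mult mult_left_mono)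
    qed
    ultimately have "\<bar>E 0 v - (\<Sum>s<4 * m. E 0 (cos (2 * pi * real s / real (4 * m))) * poly (vp_poly m s) v)\<bar>
       \<le> c * (r ^ k * \<bar>B\<bar>) / real m ^ k"
      by (rule V[OF m _ _ v(1)])
    moreover have "E 0 v = f x"
    proof -
      have "upd x i (x $ i) = x" by (simp add: vec_eq_iff)
      then show ?thesis by (simp add: E_def v(2) D(1))
    qed
    moreover have "(\<Sum>s<4 * m. E 0 (cos (2 * pi * real s / real (4 * m))) * poly (vp_poly m s) v) = vp_dir a b m i f x"
      unfolding vp_dir_def E_def v_def D(1) power_0 mult_1 ..
    ultimately have "\<bar>f x - vp_dir a b m i f x\<bar> \<le> c * (r ^ k * \<bar>B\<bar>) / real m ^ k" by (simp only:)
    also have "\<dots> \<le> (c * (r ^ k * \<bar>B\<bar>) + 1) / real m ^ k" by (intro divide_right_mono) auto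
    finally show ?thesis .
  qed
  moreover have "c * (r ^ k * \<bar>B\<bar>) + 1 > 0" using c r by (simp add: add_nonneg_pos)
  ultimately show ?thesis by blast
qed

text \<open>Stability in the maximum norm, with the 3 of \<open>sum_abs_vp_poly\<close>: it limits
  how an error made in earlier coordinates is amplified by the operator in the next one.\<close>

lemma vp_dir_bounded:
  assumes ab: "\<And>i. a $ i < b $ i" and "0 < m" and x: "x \<in> cbox a b"
    and E: "\<And>x. x \<in> cbox a b \<Longrightarrow> \<bar>F x - G x\<bar> \<le> e"
  shows "\<bar>vp_dir a b m i F x - vp_dir a b m i G x\<bar> \<le> 3 * e"
proof -
  let ?z = "\<lambda>s. box_coord a b i (cos (2 * pi * real s / real (4 * m)))"
  define v where "v = (2 * x $ i - a $ i - b $ i) / (b $ i - a $ i)"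
  have "x $ i \<in> {a $ i..b $ i}" using x by (auto simp: mem_box_cart)
  from box_coord_surj(1)[OF ab this] have v: "v \<in> {-1..1}" by (simp add: v_def)
  have z: "upd x i (?z s) \<in> cbox a b" for s
    by (intro upd_in_cbox[OF x] box_coord_bounds[OF ab]) simp
  have e: "e \<ge> 0" using E[OF x] by simp
  have "vp_dir a b m i F x - vp_dir a b m i G x
      = (\<Sum>s<4 * m. (F (upd x i (?z s)) - G (upd x i (?z s))) * poly (vp_poly m s) v)"
    unfolding vp_dir_def v_def left_diff_distrib sum_subtractf ..
  then have "\<bar>vp_dir a b m i F x - vp_dir a b m i G x\<bar>
      \<le> (\<Sum>s<4 * m. \<bar>(F (upd x i (?z s)) - G (upd x i (?z s))) * poly (vp_poly m s) v\<bar>)"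
    by (simp only: sum_abs)
  also have "\<dots> \<le> (\<Sum>s<4 * m. e * \<bar>poly (vp_poly m s) v\<bar>)"
    unfolding abs_mult by (intro sum_mono mult_right_mono E z) simp
  also have "\<dots> \<le> e * 3"
    unfolding sum_distrib_left[symmetric] using sum_abs_vp_poly[OF v \<open>0 < m\<close>] e by (intro mult_left_mono)
  finally show ?thesis by simp
qed

text \<open>A function \<open>G\<close> is a polynomial in the coordinates from \<open>A\<close> alone if \<open>\<lambda>x. G (merge_on A x y)\<close> is a
  polynomial for every \<open>y\<close>; this is how the operators of the single coordinates are composed.\<close>

definition merge_on :: "'n set \<Rightarrow> real^'n \<Rightarrow> real^'n \<Rightarrow> real^'n" where
  "merge_on A x y = (\<chi> j. if j \<in> A then x $ j else y $ j)"

text \<open>Sampling freezes coordinate \<open>i\<close>, so what remains of \<open>G\<close>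
  depends polynomially on the coordinates in \<open>A\<close>; the factor \<open>vp_poly\<close>
  contributes degree \<open>2 * m\<close> in the new coordinate.\<close>

lemma vp_dir_total_degree_le:
  fixes G :: "real^'n \<Rightarrow> real"
  assumes G: "\<And>y. total_degree_le N (\<lambda>x. G (merge_on A x y))" and i: "i \<notin> A"
  shows "total_degree_le (N + 2 * m) (\<lambda>x. vp_dir a b m i G (merge_on (insert i A) x y))"
  unfolding vp_dir_def
proof (intro total_degree_le_sum total_degree_le.mult)
  fix s
  let ?t = "box_coord a b i (cos (2 * pi * real s / real (4 * m)))"
  have "upd (merge_on (insert i A) x y) i ?t = merge_on A x (upd y i ?t)" for x
    using i by (auto simp: merge_on_def vec_eq_iff)
  then show "total_degree_le N (\<lambda>x. G (upd (merge_on (insert i A) x y) i ?t))" using G by simp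
  have "total_degree_le 1 (\<lambda>x :: real^'n. 2 / (b $ i - a $ i) * x $ i + (- a $ i - b $ i) / (b $ i - a $ i))"
    by (intro total_degree_le.add total_degree_le_scale total_degree_le.const total_degree_le.coord)
  moreover have "2 / (b $ i - a $ i) * x $ i + (- a $ i - b $ i) / (b $ i - a $ i)
      = (2 * x $ i - a $ i - b $ i) / (b $ i - a $ i)" for x :: "real^'n"
    by (simp add: diff_divide_distrib)
  ultimately have "total_degree_le 1 (\<lambda>x :: real^'n. (2 * x $ i - a $ i - b $ i) / (b $ i - a $ i))"
    by (simp only:)
  from total_degree_le_poly[OF degree_vp_poly this]
  show "total_degree_le (2 * m) (\<lambda>x. poly (vp_poly m s) ((2 * merge_on (insert i A) x y $ i - a $ i - b $ i) / (b $ i - a $ i)))"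
    by (simp add: merge_on_def)
qed

text \<open>Write P for the operator in coordinate \<open>i\<close>; then f - P G = (f - P f) + P (f
  - G). Hence smoothness is asked of \<open>f\<close> alone and never of the intermediate
  \<open>G\<close>, and the error grows from E to at most e + 3 E, which stays below the powers of
  4.\<close>

lemma vp_tensor_approx:
  fixes f :: "real^'n \<Rightarrow> real"
  assumes ab: "\<And>i. a $ i < b $ i" and "0 < m"
    and e: "\<And>i x. x \<in> cbox a b \<Longrightarrow> \<bar>f x - vp_dir a b m i f x\<bar> \<le> e"
  shows "\<exists>G. (\<forall>y. total_degree_le (card A * (2 * m)) (\<lambda>x. G (merge_on A x y))) \<and>
    (\<forall>x\<in>cbox a b. \<bar>f x - G x\<bar> \<le> 4 ^ card A * e)"
  using finite[of A]
proof (induction A rule: finite_induct)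
  case empty
  have "e \<ge> 0" if "x \<in> cbox a b" for x using e[OF that] abs_ge_zero order.trans by blast
  then show ?case by (intro exI[of _ f]) (auto simp: merge_on_def intro: total_degree_le.const)
next
  case (insert i A)
  then obtain G where G: "\<And>y. total_degree_le (card A * (2 * m)) (\<lambda>x. G (merge_on A x y))"
    "\<And>x. x \<in> cbox a b \<Longrightarrow> \<bar>f x - G x\<bar> \<le> 4 ^ card A * e" by blast
  have "\<bar>f x - vp_dir a b m i G x\<bar> \<le> 4 ^ card (insert i A) * e" if x: "x \<in> cbox a b" for x
  proof -
    have e0: "e \<ge> 0" using e[OF x] abs_ge_zero order.trans by blast
    have "\<bar>f x - vp_dir a b m i G x\<bar>
        \<le> \<bar>f x - vp_dir a b m i f x\<bar> + \<bar>vp_dir a b m i f x - vp_dir a b m i G x\<bar>" by simp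
    also have "\<dots> \<le> e + 3 * (4 ^ card A * e)"
      by (intro add_mono e[OF x] vp_dir_bounded[OF ab \<open>0 < m\<close> x] G(2))
    also have "\<dots> \<le> 4 ^ card A * e + 3 * (4 ^ card A * e)"
      using e0 mult_right_mono[of 1 "4 ^ card A" e] by (simp add: mult.commute)
    finally show ?thesis using insert(1,2) by (simp add: mult_ac)
  qed
  moreover have "total_degree_le (card (insert i A) * (2 * m)) (\<lambda>x. vp_dir a b m i G (merge_on (insert i A) x y))" for y
    using vp_dir_total_degree_le[OF G(1) insert(2), of m a b y] insert by (simp add: add.commute)
  ultimately show ?case by blast
qed

lemma jackson_box:
  fixes f :: "real^'n \<Rightarrow> real"
  assumes ab: "\<And>i. a $ i < b $ i" and f: "C_k_on k (cbox a b) f"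
  shows "\<exists>C>0. \<forall>N\<ge>1. \<exists>q. total_degree_le N q \<and> (\<forall>x\<in>cbox a b. \<bar>f x - q x\<bar> \<le> C / real N ^ k)"
proof -
  have "\<forall>i. \<exists>c>0. \<forall>m x. k \<le> m \<longrightarrow> 0 < m \<longrightarrow> x \<in> cbox a b \<longrightarrow> \<bar>f x - vp_dir a b m i f x\<bar> \<le> c / real m ^ k"
    using vp_dir_approx[OF ab f] by blast
  then obtain c where c: "\<And>i. c i > 0"
    "\<And>i m x. k \<le> m \<Longrightarrow> 0 < m \<Longrightarrow> x \<in> cbox a b \<Longrightarrow> \<bar>f x - vp_dir a b m i f x\<bar> \<le> c i / real m ^ k"
    by metis
  define n where "n = CARD('n)"
  have n: "n > 0" by (simp add: n_def)
  define c' where "c' = (\<Sum>i\<in>UNIV. c i)"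
  have c': "c i \<le> c'" for i unfolding c'_def using c(1) by (intro member_le_sum) (auto intro: less_imp_le)
  have c'0: "c' > 0" using c(1) c' less_le_trans by blast
  obtain B where B: "\<And>x. x \<in> cbox a b \<Longrightarrow> \<bar>f x\<bar> \<le> B"
    using compact_imp_bounded[OF compact_continuous_image[OF C_k_on_continuous[OF f] compact_cbox]]
    unfolding bounded_iff by (metis imageI real_norm_def)
  define m0 where "m0 = max k 1"
  \<comment> \<open>The first summand handles large \<open>N\<close>. The second handles
    \<open>N\<close> too small for \<open>m \<ge> k\<close>, where the zero polynomial is used and
    the error is at most \<open>\<bar>B\<bar>\<close>.\<close>
  define C where "C = 4 ^ n * c' * real (4 * n) ^ k + \<bar>B\<bar> * real (2 * n * m0) ^ k"
  have C1: "4 ^ n * c' * real (4 * n) ^ k \<le> C" and C2: "\<bar>B\<bar> * real (2 * n * m0) ^ k \<le> C"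
    using c'0 by (simp_all add: C_def)
  have "C > 0" using c'0 n by (simp add: C_def add_pos_nonneg)
  moreover have "\<exists>q. total_degree_le N q \<and> (\<forall>x\<in>cbox a b. \<bar>f x - q x\<bar> \<le> C / real N ^ k)" if N: "N \<ge> 1" for N
  proof (cases "N < 2 * n * m0")
    case True
    have "\<bar>f x - 0\<bar> \<le> C / real N ^ k" if "x \<in> cbox a b" for x
    proof -
      have "\<bar>B\<bar> * real N ^ k \<le> \<bar>B\<bar> * real (2 * n * m0) ^ k"
        using True by (intro mult_left_mono power_mono) linarith+
      with C2 have "\<bar>B\<bar> \<le> C / real N ^ k" using N by (simp add: pos_le_divide_eq)
      then show ?thesis using B[OF that] by simp
    qed
    then show ?thesis using total_degree_le.const[of N 0] by blast
  next
    case False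
    \<comment> \<open>The largest \<open>m\<close> for which \<open>n\<close> coordinates of degree
      \<open>2 * m\<close> fit into total degree \<open>N\<close>.\<close>
    define m where "m = N div (2 * n)"
    have "m0 \<le> m" unfolding m_def using False n by (simp add: less_eq_div_iff_mult_less_eq mult.commute)
    then have m: "k \<le> m" "0 < m" by (auto simp: m0_def)
    \<comment> \<open>Since \<open>m \<ge> 1\<close>, the rounding in the division costs at most a
      factor 2, so \<open>N\<close> and \<open>m\<close> differ by a factor of at most
      \<open>4 * n\<close>.\<close>
    have "N < 2 * n * (m + 1)" unfolding m_def using n dividend_less_times_div[of "2 * n" N] by simp
    also have "\<dots> \<le> 4 * n * m" using m by (simp add: algebra_simps)
    finally have "real N ^ k \<le> real (4 * n * m) ^ k" by (intro power_mono) linarith+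
    then have Nm: "c' / real m ^ k \<le> c' * real (4 * n) ^ k / real N ^ k"
      using m N c'0 by (simp add: divide_simps power_mult_distrib mult_ac)
    have e: "\<bar>f x - vp_dir a b m i f x\<bar> \<le> c' / real m ^ k" if "x \<in> cbox a b" for i x
      using order.trans[OF c(2)[OF m that] divide_right_mono[OF c']] by simp
    obtain G where G: "\<And>y. total_degree_le (card (UNIV :: 'n set) * (2 * m)) (\<lambda>x. G (merge_on UNIV x y))"
      "\<And>x. x \<in> cbox a b \<Longrightarrow> \<bar>f x - G x\<bar> \<le> 4 ^ card (UNIV :: 'n set) * (c' / real m ^ k)"
      using vp_tensor_approx[OF ab m(2) e, of UNIV] by blast
    have "merge_on UNIV x y = x" for x y :: "real^'n" by (simp add: merge_on_def)
    then have "total_degree_le (n * (2 * m)) G" using G(1) by (simp add: n_def)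
    moreover have "n * (2 * m) \<le> N" unfolding m_def using times_div_less_eq_dividend[of "2 * n" N] by (simp add: mult_ac)
    ultimately have "total_degree_le N G" by (rule total_degree_le.mono)
    moreover have "\<bar>f x - G x\<bar> \<le> C / real N ^ k" if "x \<in> cbox a b" for x
    proof -
      have "\<bar>f x - G x\<bar> \<le> 4 ^ n * (c' / real m ^ k)" using G(2)[OF that] by (simp add: n_def)
      also have "\<dots> \<le> 4 ^ n * (c' * real (4 * n) ^ k / real N ^ k)" by (intro mult_left_mono Nm) simp
      also have "\<dots> = (4 ^ n * c' * real (4 * n) ^ k) / real N ^ k" by simp
      also have "\<dots> \<le> C / real N ^ k" by (intro divide_right_mono C1) simp
      finally show ?thesis .
    qed
    ultimately show ?thesis by blast
  qed
  ultimately show ?thesis by blast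
qed


subsection \<open>Invariant measures and exactness\<close>

lemma affine_ifs_contraction:
  assumes "affine_ifs L S"
  obtains \<rho> where "0 \<le> \<rho>" "\<rho> < 1"
    "\<And>l x y. l < L \<Longrightarrow> norm (S l x - S l y) \<le> \<rho> * norm (x - y :: real^'n)"
proof -
  obtain A :: "nat \<Rightarrow> real^'n^'n" and b where
    A: "\<And>l. l < L \<Longrightarrow> onorm ((*v) (A l)) < 1" "\<And>l. l < L \<Longrightarrow> S l = (\<lambda>x. A l *v x + b l)"
    using assms unfolding affine_ifs_def by metis
  have L: "2 \<le> L" using assms by (simp add: affine_ifs_def)
  define \<rho> where "\<rho> = Max ((\<lambda>l. onorm ((*v) (A l))) ` {..<L})"
  have le: "onorm ((*v) (A l)) \<le> \<rho>" if "l < L" for l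
    unfolding \<rho>_def using that by (intro Max_ge) auto
  show thesis
  proof
    have "0 \<le> onorm ((*v) (A 0))" by (rule onorm_pos_le[OF matrix_vector_mul_bounded_linear])
    with le[of 0] L show "0 \<le> \<rho>" by simp
    show "\<rho> < 1" unfolding \<rho>_def using L A(1) by (subst Max_less_iff) (auto simp: lessThan_empty_iff)
    fix l x y assume l: "l < L"
    have "norm (S l x - S l y) = norm (A l *v (x - y))"
      by (simp add: A(2)[OF l] matrix_vector_mult_diff_distrib)
    also have "\<dots> \<le> onorm ((*v) (A l)) * norm (x - y)"
      by (rule onorm[OF matrix_vector_mul_bounded_linear])
    also have "\<dots> \<le> \<rho> * norm (x - y)" using le[OF l] by (rule mult_right_mono) simp
    finally show "norm (S l x - S l y) \<le> \<rho> * norm (x - y)" .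
  qed
qed

lemma affine_ifs_continuous:
  assumes "affine_ifs L S" "l < L"
  shows "continuous_on UNIV (S l :: real^'n \<Rightarrow> real^'n)"
proof -
  obtain A :: "real^'n^'n" and b where "S l = (\<lambda>x. A *v x + b)"
    using assms unfolding affine_ifs_def by metis
  moreover have "continuous_on UNIV (\<lambda>x. A *v x)"
    by (rule linear_continuous_on[OF matrix_vector_mul_bounded_linear])
  ultimately show ?thesis by (auto intro: continuous_intros)
qed

lemma affine_ifs_invariant_ball:
  fixes S :: "nat \<Rightarrow> real^'n \<Rightarrow> real^'n"
  assumes "affine_ifs L S"
  obtains R0 :: real where "0 \<le> R0" "\<And>R l x. R0 \<le> R \<Longrightarrow> l < L \<Longrightarrow> norm x \<le> R \<Longrightarrow> norm (S l x) \<le> R"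
proof -
  obtain \<rho> where \<rho>: "0 \<le> \<rho>" "\<rho> < 1"
    "\<And>l x y. l < L \<Longrightarrow> norm (S l x - S l y) \<le> \<rho> * norm (x - y)"
    using affine_ifs_contraction[OF assms] by blast
  \<comment> \<open>Chosen so that \<open>norm (S l 0) \<le> (1 - \<rho>) * R\<close> for
    \<open>R \<ge> R0\<close>; the contraction supplies the remaining
    \<open>\<rho> * R\<close>.\<close>
  define R0 where "R0 = (\<Sum>l<L. norm (S l 0)) / (1 - \<rho>)"
  show thesis
  proof
    show "0 \<le> R0" using \<rho> by (auto simp: R0_def intro!: divide_nonneg_nonneg sum_nonneg)
    fix R l and x :: "real^'n" assume *: "R0 \<le> R" "l < L" "norm x \<le> R"
    have "norm (S l 0) \<le> (\<Sum>l<L. norm (S l 0))" using * by (intro member_le_sum) auto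
    also have "\<dots> = R0 * (1 - \<rho>)" using \<rho> by (simp add: R0_def)
    also have "\<dots> \<le> R * (1 - \<rho>)" using * \<rho> by (intro mult_right_mono) auto
    finally have "norm (S l 0) \<le> R * (1 - \<rho>)" .
    moreover have "norm (S l x - S l 0) \<le> \<rho> * R"
      using \<rho>(3)[OF *(2), of x 0] mult_left_mono[OF *(3) \<rho>(1)] by simp
    moreover have "norm (S l x) \<le> norm (S l x - S l 0) + norm (S l 0)"
      using norm_triangle_ineq[of "S l x - S l 0" "S l 0"] by simp
    ultimately show "norm (S l x) \<le> R" by (simp add: algebra_simps)
  qed
qed

lemma invariant_measure_ball:
  fixes M :: "(real^'n) measure"
  assumes "invariant_measure L S p M"
  obtains R1 where "\<And>R. R1 \<le> R \<Longrightarrow> AE x in M. norm x \<le> R"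
proof -
  interpret prob_space M using assms by (simp add: invariant_measure_def)
  obtain z r where "measure M (cball z r) = 1" using assms by (auto simp: invariant_measure_def)
  then have AE: "AE x in M. x \<in> cball z r" by (rule AE_prob_1)
  show thesis
  proof
    fix R assume R: "norm z + r \<le> R"
    show "AE x in M. norm x \<le> R"
      using AE
    proof eventually_elim
      case (elim x)
      then show ?case using norm_triangle_sub[of x z] R by (simp add: dist_norm norm_minus_commute)
    qed
  qed
qed

text \<open>The closed \<open>r\<close>-neighbourhood of the attractor is mapped into its \<open>\<rho> * r\<close>-neighbourhood, so
  full mass passes from the former to the latter, and in the limit to the attractor.\<close>

lemma AE_in_attractor:
  fixes M :: "(real^'n) measure"
  assumes ifs: "affine_ifs L S" and prob: "ifs_probabilities L p" and att: "is_attractor L S \<Gamma>"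
    and inv: "invariant_measure L S p M"
  shows "AE x in M. x \<in> \<Gamma>"
proof -
  interpret prob_space M using inv by (simp add: invariant_measure_def)
  have sets: "sets M = sets borel" using inv by (simp add: invariant_measure_def)
  obtain \<rho> where \<rho>: "0 \<le> \<rho>" "\<rho> < 1"
    "\<And>l x y. l < L \<Longrightarrow> norm (S l x - S l y) \<le> \<rho> * norm (x - y)"
    using affine_ifs_contraction[OF ifs] by blast
  have \<Gamma>: "compact \<Gamma>" "\<Gamma> \<noteq> {}" "\<And>l x. l < L \<Longrightarrow> x \<in> \<Gamma> \<Longrightarrow> S l x \<in> \<Gamma>"
    using att unfolding is_attractor_def by blast+
  define G where "G r = {x. infdist x \<Gamma> \<le> r}" for r
  have G: "G r \<in> sets borel" for r
    unfolding G_def by (intro borel_closed closed_Collect_le continuous_intros)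
  have step: "measure M (G (\<rho> * r)) = 1" if r: "measure M (G r) = 1" for r
  proof -
    have "measure M (G r) \<le> measure M (S l -` G (\<rho> * r))" if l: "l < L" for l
    proof (rule finite_measure_mono)
      show "G r \<subseteq> S l -` G (\<rho> * r)"
      proof
        fix x assume "x \<in> G r"
        obtain g where g: "g \<in> \<Gamma>" "infdist x \<Gamma> = dist x g"
          using infdist_attains_inf[OF compact_imp_closed[OF \<Gamma>(1)] \<Gamma>(2)] by blast
        have "infdist (S l x) \<Gamma> \<le> dist (S l x) (S l g)" using \<Gamma>(3)[OF l g(1)] by (rule infdist_le)
        also have "\<dots> \<le> \<rho> * dist x g" using \<rho>(3)[OF l] by (simp add: dist_norm)
        also have "\<dots> \<le> \<rho> * r" using \<open>x \<in> G r\<close> g \<rho>(1) by (intro mult_left_mono) (auto simp: G_def)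
        finally show "x \<in> S l -` G (\<rho> * r)" by (simp add: G_def)
      qed
      have "S l \<in> borel_measurable borel"
        by (rule borel_measurable_continuous_onI[OF affine_ifs_continuous[OF ifs l]])
      from measurable_sets[OF this G[of "\<rho> * r"]] show "S l -` G (\<rho> * r) \<in> events"
        by (simp add: sets)
    qed
    then have "(\<Sum>l<L. p l * measure M (G r)) \<le> (\<Sum>l<L. p l * measure M (S l -` G (\<rho> * r)))"
      using prob by (intro sum_mono mult_left_mono) (auto simp: ifs_probabilities_def intro: less_imp_le)
    also have "\<dots> = measure M (G (\<rho> * r))" using inv G by (simp add: invariant_measure_def)
    finally have "1 \<le> measure M (G (\<rho> * r))"
      using prob r by (simp add: ifs_probabilities_def flip: sum_distrib_right)
    then show ?thesis using prob_le_1[of "G (\<rho> * r)"] by linarith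
  qed
  obtain R1 where R1: "\<And>R. R1 \<le> R \<Longrightarrow> AE x in M. norm x \<le> R"
    using invariant_measure_ball[OF inv] by blast
  obtain g where g: "g \<in> \<Gamma>" using \<Gamma> by blast
  \<comment> \<open>Starting radius: a point of the ball that carries \<open>M\<close> has at most
    this distance from the point \<open>g\<close> of the attractor.\<close>
  define r where "r = max R1 0 + norm g"
  have "AE x in M. x \<in> G r"
    using R1[of "max R1 0", OF max.cobounded1]
  proof eventually_elim
    case (elim x)
    have "infdist x \<Gamma> \<le> dist x g" using g by (rule infdist_le)
    also have "\<dots> \<le> norm x + norm g" unfolding dist_norm by (rule norm_triangle_ineq4)
    finally show ?case using elim by (simp add: G_def r_def)
  qed
  then have "measure M (G r) = 1" using G[of r] by (subst prob_eq_1) (auto simp: sets)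
  then have "measure M (G (\<rho> ^ m * r)) = 1" for m
    by (induction m) (auto simp: mult.assoc dest: step)
  then have "AE x in M. \<forall>m. x \<in> G (\<rho> ^ m * r)"
    unfolding AE_all_countable using AE_prob_1 by blast
  then show ?thesis
  proof eventually_elim
    case (elim x)
    have "(\<lambda>m. \<rho> ^ m * r) \<longlonglongrightarrow> 0 * r"
      using \<rho> by (intro tendsto_mult_right LIMSEQ_power_zero) auto
    then have "infdist x \<Gamma> \<le> 0 * r"
      using elim by (intro LIMSEQ_le_const) (auto simp: G_def)
    then have "infdist x \<Gamma> = 0" using infdist_nonneg[of x \<Gamma>] by simp
    then show ?case using in_closed_iff_infdist_zero[OF compact_imp_closed[OF \<Gamma>(1)] \<Gamma>(2)] by simp
  qed
qed

text \<open>Invariance is given on Borel sets; indicators, linear combinations and monotone limits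
  extend it to nonnegative measurable functions.\<close>

lemma invariant_measure_nn_integral:
  fixes M :: "(real^'n) measure"
  assumes ifs: "affine_ifs L S" and prob: "ifs_probabilities L p" and inv: "invariant_measure L S p M"
    and u: "u \<in> borel_measurable borel"
  shows "(\<integral>\<^sup>+x. u x \<partial>M) = (\<Sum>l<L. ennreal (p l) * (\<integral>\<^sup>+x. u (S l x) \<partial>M))"
  using u
proof (induction rule: borel_measurable_induct)
  interpret prob_space M using inv by (simp add: invariant_measure_def)
  have sets[measurable_cong]: "sets M = sets borel" using inv by (simp add: invariant_measure_def)
  have S: "S l \<in> M \<rightarrow>\<^sub>M borel" if "l < L" for l
    using borel_measurable_continuous_onI[OF affine_ifs_continuous[OF ifs that]] sets by simp
  have p: "0 \<le> p l" if "l < L" for l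
    using prob that by (auto simp: ifs_probabilities_def intro: less_imp_le)
  {
    case (cong f g)
    then have "f = g" by auto
    with cong show ?case by simp
  next
    case (set A)
    have "S l -` A \<in> events" if "l < L" for l
      using measurable_sets[OF S[OF that] set] sets_eq_imp_space_eq[OF sets] by simp
    then have "(\<integral>\<^sup>+x. indicator A (S l x) \<partial>M) = ennreal (measure M (S l -` A))" if "l < L" for l
      using that
      by (subst nn_integral_cong[of _ _ "indicator (S l -` A)"])
         (auto simp: indicator_def emeasure_eq_measure[symmetric])
    then have "(\<Sum>l<L. ennreal (p l) * (\<integral>\<^sup>+x. indicator A (S l x) \<partial>M))
        = (\<Sum>l<L. ennreal (p l * measure M (S l -` A)))"
      by (intro sum.cong refl) (simp add: ennreal_mult p)
    also have "\<dots> = ennreal (\<Sum>l<L. p l * measure M (S l -` A))"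
      using p by (intro sum_ennreal) auto
    also have "\<dots> = emeasure M A"
      using inv set by (simp add: invariant_measure_def emeasure_eq_measure)
    finally show ?case using set by (simp add: sets)
  next
    case (mult u c)
    have "(\<integral>\<^sup>+x. c * u (S l x) \<partial>M) = c * (\<integral>\<^sup>+x. u (S l x) \<partial>M)" if "l < L" for l
      using measurable_compose[OF S[OF that] mult(2)] by (rule nn_integral_cmult)
    moreover have "u \<in> borel_measurable M" using mult(2) sets by simp
    ultimately show ?case
      using mult by (simp add: nn_integral_cmult sum_distrib_left mult.left_commute)
  next
    case (add u v)
    have "(\<integral>\<^sup>+x. v (S l x) + u (S l x) \<partial>M) = (\<integral>\<^sup>+x. v (S l x) \<partial>M) + (\<integral>\<^sup>+x. u (S l x) \<partial>M)"
      if "l < L" for l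
      using measurable_compose[OF S[OF that] \<open>v \<in> borel_measurable borel\<close>]
        measurable_compose[OF S[OF that] \<open>u \<in> borel_measurable borel\<close>]
      by (rule nn_integral_add)
    moreover have "u \<in> borel_measurable M" "v \<in> borel_measurable M" using add sets by simp_all
    ultimately show ?case
      using add by (simp add: nn_integral_add distrib_left sum.distrib)
  next
    case (seq U)
    have U: "U i \<in> borel_measurable M" for i using seq(1) sets by simp
    have mono: "U n y \<le> U (Suc n) y" for n y
      using incseq_SucD[OF seq.hyps(3), of n] by (simp add: le_fun_def)
    have "(\<integral>\<^sup>+x. (SUP i. U i) x \<partial>M) = (SUP i. \<integral>\<^sup>+x. U i x \<partial>M)"
      unfolding SUP_apply using seq.hyps(3) U by (rule nn_integral_monotone_convergence_SUP)
    also have "\<dots> = (SUP i. \<Sum>l<L. ennreal (p l) * (\<integral>\<^sup>+x. U i (S l x) \<partial>M))"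
      using seq.IH by simp
    also have "\<dots> = (\<Sum>l<L. SUP i. ennreal (p l) * (\<integral>\<^sup>+x. U i (S l x) \<partial>M))"
      by (intro ennreal_SUP_sum incseq_SucI mult_left_mono nn_integral_mono mono) simp
    also have "\<dots> = (\<Sum>l<L. ennreal (p l) * (\<integral>\<^sup>+x. (SUP i. U i) (S l x) \<partial>M))"
    proof (intro sum.cong refl)
      fix l assume l: "l \<in> {..<L}"
      have "(\<integral>\<^sup>+x. (SUP i. U i) (S l x) \<partial>M) = (SUP i. \<integral>\<^sup>+x. U i (S l x) \<partial>M)"
        unfolding SUP_apply
      proof (rule nn_integral_monotone_convergence_SUP)
        show "incseq (\<lambda>i x. U i (S l x))" using seq.hyps(3) by (auto simp: incseq_def le_fun_def)
        show "(\<lambda>x. U i (S l x)) \<in> borel_measurable M" for i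
          using measurable_compose[OF S seq(1)] l by simp
      qed
      then show "(SUP i. ennreal (p l) * (\<integral>\<^sup>+x. U i (S l x) \<partial>M))
          = ennreal (p l) * (\<integral>\<^sup>+x. (SUP i. U i) (S l x) \<partial>M)"
        by (simp add: SUP_mult_left_ennreal)
    qed
    finally show ?case .
  }
qed

lemma invariant_measure_bounded_ball:
  fixes M :: "(real^'n) measure"
  assumes ifs: "affine_ifs L S" and inv: "invariant_measure L S p M"
  obtains R0 where "0 \<le> R0" "\<And>R l x. R0 \<le> R \<Longrightarrow> l < L \<Longrightarrow> norm x \<le> R \<Longrightarrow> norm (S l x) \<le> R"
    "\<And>R. R0 \<le> R \<Longrightarrow> AE x in M. norm x \<le> R"
proof -
  obtain R0 where R0: "0 \<le> R0" "\<And>R l x. R0 \<le> R \<Longrightarrow> l < L \<Longrightarrow> norm x \<le> R \<Longrightarrow> norm (S l x) \<le> R"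
    using affine_ifs_invariant_ball[OF ifs] by blast
  obtain R1 where R1: "\<And>R. R1 \<le> R \<Longrightarrow> AE x in M. norm x \<le> R"
    using invariant_measure_ball[OF inv] by blast
  show thesis
  proof
    show "0 \<le> max R0 R1" using R0 by simp
  qed (use R0 R1 in auto)
qed

lemma invariant_measure_integrable:
  fixes M :: "(real^'n) measure" and f :: "real^'n \<Rightarrow> real"
  assumes inv: "invariant_measure L S p M" and f: "continuous_on UNIV f"
  shows "integrable M f"
proof -
  interpret prob_space M using inv by (simp add: invariant_measure_def)
  have sets: "sets M = sets borel" using inv by (simp add: invariant_measure_def)
  obtain R where R: "AE x in M. norm x \<le> R"
    using invariant_measure_ball[OF inv] by blast
  have "bounded (f ` cball 0 R)"
    by (intro compact_imp_bounded compact_continuous_image continuous_on_subset[OF f]) auto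
  then obtain C where C: "\<And>x. norm x \<le> R \<Longrightarrow> \<bar>f x\<bar> \<le> C"
    unfolding bounded_iff by (metis imageI mem_cball_0 real_norm_def)
  show ?thesis
  proof (rule integrable_const_bound)
    show "AE x in M. norm (f x) \<le> C" using R by eventually_elim (use C in auto)
    show "f \<in> borel_measurable M" using borel_measurable_continuous_onI[OF f] sets by simp
  qed
qed

text \<open>Adding a bound \<open>C\<close> for \<open>f\<close> on an invariant ball of full
  measure makes \<open>f\<close> and all \<open>f \<circ> S l\<close> nonnegative there, so the
  version for nonnegative functions applies. The constant cancels because the probabilities sum to
  1.\<close>

lemma invariant_measure_ruelle:
  fixes M :: "(real^'n) measure" and f :: "real^'n \<Rightarrow> real"
  assumes ifs: "affine_ifs L S" and prob: "ifs_probabilities L p" and inv: "invariant_measure L S p M"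
    and f: "continuous_on UNIV f"
  shows "(\<integral>x. ruelle L S p f x \<partial>M) = (\<integral>x. f x \<partial>M)"
proof -
  interpret prob_space M using inv by (simp add: invariant_measure_def)
  have p: "0 \<le> p l" if "l < L" for l
    using prob that by (auto simp: ifs_probabilities_def intro: less_imp_le)
  obtain R where R: "\<And>l x. l < L \<Longrightarrow> norm x \<le> R \<Longrightarrow> norm (S l x) \<le> R" "AE x in M. norm x \<le> R"
    using invariant_measure_bounded_ball[OF ifs inv] by (metis order_refl)
  have "bounded (f ` cball 0 R)"
    by (intro compact_imp_bounded compact_continuous_image continuous_on_subset[OF f]) auto
  then obtain C where C: "\<And>x. norm x \<le> R \<Longrightarrow> \<bar>f x\<bar> \<le> C"
    unfolding bounded_iff by (metis imageI mem_cball_0 real_norm_def)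
  have fS: "continuous_on UNIV (\<lambda>x. f (S l x))" if "l < L" for l
    using continuous_on_compose2[OF f affine_ifs_continuous[OF ifs that]] by simp
  have int: "integrable M f" "\<And>l. l < L \<Longrightarrow> integrable M (\<lambda>x. f (S l x))"
    using invariant_measure_integrable[OF inv] f fS by blast+
  have pos: "AE x in M. 0 \<le> f x + C" "\<And>l. l < L \<Longrightarrow> AE x in M. 0 \<le> f (S l x) + C"
    using R(2) by (eventually_elim, use C R(1) in fastforce)+
  have nn: "0 \<le> (\<integral>x. f (S l x) + C \<partial>M)" if "l < L" for l
    using pos(2)[OF that] by (rule integral_nonneg_AE)
  have "ennreal (\<integral>x. f x + C \<partial>M) = (\<integral>\<^sup>+x. ennreal (f x + C) \<partial>M)"
    using int pos by (intro nn_integral_eq_integral[symmetric]) auto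
  also have "\<dots> = (\<Sum>l<L. ennreal (p l) * (\<integral>\<^sup>+x. ennreal (f (S l x) + C) \<partial>M))"
    using borel_measurable_continuous_onI[OF f]
    by (intro invariant_measure_nn_integral[OF ifs prob inv]) simp
  also have "\<dots> = (\<Sum>l<L. ennreal (p l * (\<integral>x. f (S l x) + C \<partial>M)))"
  proof (intro sum.cong refl)
    fix l assume "l \<in> {..<L}"
    then have l: "l < L" by simp
    have "(\<integral>\<^sup>+x. ennreal (f (S l x) + C) \<partial>M) = ennreal (\<integral>x. f (S l x) + C \<partial>M)"
      using int(2)[OF l] pos(2)[OF l] by (intro nn_integral_eq_integral) auto
    then show "ennreal (p l) * (\<integral>\<^sup>+x. ennreal (f (S l x) + C) \<partial>M) = ennreal (p l * (\<integral>x. f (S l x) + C \<partial>M))"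
      using p[OF l] by (simp add: ennreal_mult')
  qed
  also have "\<dots> = ennreal (\<Sum>l<L. p l * (\<integral>x. f (S l x) + C \<partial>M))"
    using p nn by (intro sum_ennreal mult_nonneg_nonneg) auto
  finally have "(\<integral>x. f x + C \<partial>M) = (\<Sum>l<L. p l * (\<integral>x. f (S l x) + C \<partial>M))"
    using p nn integral_nonneg_AE[OF pos(1)]
    by (subst (asm) ennreal_inj) (auto intro!: sum_nonneg mult_nonneg_nonneg)
  then have "(\<integral>x. f x \<partial>M) + C = (\<Sum>l<L. p l * ((\<integral>x. f (S l x) \<partial>M) + C))"
    using int by (simp add: prob_space)
  also have "\<dots> = (\<Sum>l<L. p l * (\<integral>x. f (S l x) \<partial>M)) + C"
    using prob by (simp add: distrib_left sum.distrib ifs_probabilities_def flip: sum_distrib_right)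
  also have "(\<Sum>l<L. p l * (\<integral>x. f (S l x) \<partial>M)) = (\<integral>x. ruelle L S p f x \<partial>M)"
    unfolding ruelle_def using int by (subst Bochner_Integration.integral_sum) auto
  finally show ?thesis by simp
qed

lemma ruelle_total_degree_le:
  fixes S :: "nat \<Rightarrow> real^'n \<Rightarrow> real^'n"
  assumes "affine_ifs L S" "total_degree_le N q"
  shows "total_degree_le N (ruelle L S p q)"
  unfolding ruelle_def
proof (intro total_degree_le_sum total_degree_le_scale)
  fix l assume "l \<in> {..<L}"
  then obtain A :: "real^'n^'n" and b where "S l = (\<lambda>x. A *v x + b)"
    using assms(1) unfolding affine_ifs_def by (metis lessThan_iff)
  then show "total_degree_le N (\<lambda>x. q (S l x))"
    using total_degree_le_affine[OF assms(2)] by simp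
qed

text \<open>The discrete counterpart of invariance of the measure. Expanding \<open>q\<close> in the
  Lagrange basis expresses the values of \<open>ruelle L S p q\<close> on the grid through the
  matrix, and the weights are an eigenvector of its transpose. Only grid values enter, so the image
  of \<open>q\<close> may well lie outside \<open>Q_space N\<close>.\<close>

lemma cubature_ruelle:
  fixes T :: "'n::finite \<Rightarrow> real set" and N :: nat
  defines "X \<equiv> {x :: real^'n. \<forall>i. x $ i \<in> T i}"
  assumes T: "\<And>i. finite (T i)" "\<And>i. card (T i) = Suc N"
    and w: "cubature_weights L S p N X w" and q: "q \<in> Q_space N"
  shows "cubature X w (ruelle L S p q) = cubature X w q"
proof -
  have q: "q x = (\<Sum>y\<in>X. q y * lagrange N X y x)" for x
    unfolding X_def by (rule Q_space_lagrange_expansion[OF T q])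
  have "ruelle L S p q x = (\<Sum>y\<in>X. cubature_matrix L S p N X x y * q y)" for x
  proof -
    have "ruelle L S p q x = (\<Sum>l<L. p l * (\<Sum>y\<in>X. q y * lagrange N X y (S l x)))"
      unfolding ruelle_def by (intro sum.cong refl arg_cong2[of _ _ _ _ "(*)"] q)
    also have "\<dots> = (\<Sum>y\<in>X. \<Sum>l<L. p l * (q y * lagrange N X y (S l x)))"
      unfolding sum_distrib_left by (rule sum.swap)
    also have "\<dots> = (\<Sum>y\<in>X. cubature_matrix L S p N X x y * q y)"
      unfolding cubature_matrix_def sum_distrib_right by (simp add: mult_ac)
    finally show ?thesis .
  qed
  then have "cubature X w (ruelle L S p q) = (\<Sum>y\<in>X. (\<Sum>x\<in>X. cubature_matrix L S p N X x y * w x) * q y)"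
    unfolding cubature_def
    by (simp add: sum_distrib_left sum_distrib_right) (subst sum.swap, simp add: mult_ac)
  also have "\<dots> = cubature X w q"
    using w by (simp add: cubature_weights_def cubature_def)
  finally show ?thesis .
qed

text \<open>The iterates of \<open>q\<close> converge to a constant because the Ruelle operator contracts Lipschitz constants.\<close>

lemma cubature_exact:
  fixes T :: "'n::finite \<Rightarrow> real set" and N :: nat and M :: "(real^'n) measure"
  defines "X \<equiv> {x :: real^'n. \<forall>i. x $ i \<in> T i}"
  assumes ifs: "affine_ifs L S" and prob: "ifs_probabilities L p" and inv: "invariant_measure L S p M"
    and T: "\<And>i. finite (T i)" "\<And>i. card (T i) = Suc N"
    and w: "cubature_weights L S p N X w"
    and P: "P \<subseteq> Q_space N" "\<And>q. q \<in> P \<Longrightarrow> ruelle L S p q \<in> P" and q: "q \<in> P"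
  shows "cubature X w q = (\<integral>x. q x \<partial>M)"
proof -
  interpret prob_space M using inv by (simp add: invariant_measure_def)
  have p: "0 \<le> p l" if "l < L" for l
    using prob that by (auto simp: ifs_probabilities_def intro: less_imp_le)
  have p1: "(\<Sum>l<L. p l) = 1" using prob by (simp add: ifs_probabilities_def)
  obtain \<rho> where \<rho>: "0 \<le> \<rho>" "\<rho> < 1"
    "\<And>l x y. l < L \<Longrightarrow> norm (S l x - S l y) \<le> \<rho> * norm (x - y)"
    using affine_ifs_contraction[OF ifs] by blast
  have "finite X"
    unfolding X_def by (rule finite_grid[OF T(1)])
  then have bX: "bounded X" by (rule finite_imp_bounded)
  obtain R0 where R0: "0 \<le> R0" "\<And>R l x. R0 \<le> R \<Longrightarrow> l < L \<Longrightarrow> norm x \<le> R \<Longrightarrow> norm (S l x) \<le> R"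
    "\<And>R. R0 \<le> R \<Longrightarrow> AE x in M. norm x \<le> R"
    using invariant_measure_bounded_ball[OF ifs inv] by blast
  \<comment> \<open>The radius is enlarged until the ball also contains the grid, so that one
    Lipschitz estimate covers the cubature as well as the integral.\<close>
  obtain R where R: "R0 \<le> R" "\<And>x. x \<in> X \<Longrightarrow> norm x \<le> R"
    using bX unfolding bounded_iff by (metis max.cobounded1 max.coboundedI2)
  define Q where "Q m = (ruelle L S p ^^ m) q" for m
  \<comment> \<open>The invariant set \<open>P\<close> keeps every iterate inside
    \<open>Q_space N\<close>, which \<open>cubature_ruelle\<close> requires anew at each
    step.\<close>
  have Q: "Q m \<in> P" for m by (induction m) (auto simp: Q_def q P(2))
  have cont: "continuous_on UNIV (Q m)" for m
    using Q P(1) by (intro total_degree_le_continuous[OF Q_space_total_degree_le]) blast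
  have cub: "cubature X w (Q m) = cubature X w q" for m
  proof (induction m)
    case (Suc m)
    have "cubature X w (Q (Suc m)) = cubature X w (Q m)"
      unfolding Q_def funpow.simps o_def X_def
      using Q[of m] P(1) w unfolding Q_def X_def by (intro cubature_ruelle[OF T]) auto
    then show ?case using Suc by simp
  qed (simp add: Q_def)
  have int: "(\<integral>x. Q m x \<partial>M) = (\<integral>x. q x \<partial>M)" for m
  proof (induction m)
    case (Suc m)
    then show ?case using invariant_measure_ruelle[OF ifs prob inv cont[of m]] by (simp add: Q_def)
  qed (simp add: Q_def)
  obtain C where C: "C \<ge> 0" "\<And>x y. norm x \<le> R \<Longrightarrow> norm y \<le> R \<Longrightarrow> \<bar>q x - q y\<bar> \<le> C * norm (x - y)"
    using total_degree_le_lipschitz[OF Q_space_total_degree_le, of q N R] q P(1)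
    by (metis subsetD mem_cball_0)
  have lip: "\<bar>Q m x - Q m y\<bar> \<le> C * \<rho> ^ m * norm (x - y)" if "norm x \<le> R" "norm y \<le> R" for m x y
    using that
  proof (induction m arbitrary: x y)
    case (Suc m)
    have "\<bar>Q (Suc m) x - Q (Suc m) y\<bar> = \<bar>\<Sum>l<L. p l * (Q m (S l x) - Q m (S l y))\<bar>"
      by (simp add: Q_def ruelle_def right_diff_distrib sum_subtractf)
    also have "\<dots> \<le> (\<Sum>l<L. p l * (C * \<rho> ^ Suc m * norm (x - y)))"
    proof (intro order.trans[OF sum_abs] sum_mono)
      fix l assume "l \<in> {..<L}"
      then have l: "l < L" by simp
      have "\<bar>Q m (S l x) - Q m (S l y)\<bar> \<le> C * \<rho> ^ m * norm (S l x - S l y)"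
        using Suc.prems R0(2)[OF R(1) l] by (intro Suc.IH) auto
      also have "\<dots> \<le> C * \<rho> ^ m * (\<rho> * norm (x - y))"
        using C(1) \<rho>(1) by (intro mult_left_mono \<rho>(3)[OF l]) auto
      finally show "\<bar>p l * (Q m (S l x) - Q m (S l y))\<bar> \<le> p l * (C * \<rho> ^ Suc m * norm (x - y))"
        unfolding abs_mult abs_of_nonneg[OF p[OF l]]
        by (intro mult_left_mono p[OF l]) (simp add: mult_ac)
    qed
    also have "\<dots> = C * \<rho> ^ Suc m * norm (x - y)"
      by (simp only: sum_distrib_right[symmetric] p1 mult_1)
    finally show ?case .
  qed (use C in \<open>simp add: Q_def\<close>)
  have diff: "\<bar>Q m x - (\<integral>x. q x \<partial>M)\<bar> \<le> C * \<rho> ^ m * (2 * R)" if x: "norm x \<le> R" for m x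
  proof -
    have i: "integrable M (Q m)" by (rule invariant_measure_integrable[OF inv cont])
    then have "Q m x - (\<integral>x. q x \<partial>M) = (\<integral>y. Q m x - Q m y \<partial>M)"
      by (simp add: int prob_space)
    moreover have "AE y in M. \<bar>Q m x - Q m y\<bar> \<le> C * \<rho> ^ m * (2 * R)"
      using R0(3)[OF R(1)]
    proof eventually_elim
      case (elim y)
      have "\<bar>Q m x - Q m y\<bar> \<le> C * \<rho> ^ m * norm (x - y)" using x elim by (rule lip)
      also have "\<dots> \<le> C * \<rho> ^ m * (2 * R)"
        using C(1) \<rho>(1) x elim norm_triangle_ineq4[of x y] by (intro mult_left_mono) auto
      finally show ?case .
    qed
    then have "\<bar>\<integral>y. Q m x - Q m y \<partial>M\<bar> \<le> (\<integral>y. C * \<rho> ^ m * (2 * R) \<partial>M)"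
      using i by (intro order.trans[OF integral_abs_bound] integral_mono_AE) auto
    ultimately show ?thesis by (simp add: prob_space)
  qed
  \<comment> \<open>The left side does not involve \<open>m\<close>, while the right side tends to 0
    because the weights are fixed.\<close>
  have "\<bar>cubature X w q - (\<integral>x. q x \<partial>M)\<bar> \<le> l1_norm X w * (C * \<rho> ^ m * (2 * R))" for m
  proof -
    have "cubature X w q - (\<integral>x. q x \<partial>M) = (\<Sum>x\<in>X. w x * (Q m x - (\<integral>x. q x \<partial>M)))"
      using w unfolding cub[of m, symmetric]
      by (simp add: cubature_def cubature_weights_def right_diff_distrib sum_subtractf flip: sum_distrib_right)
    then have "\<bar>cubature X w q - (\<integral>x. q x \<partial>M)\<bar> \<le> (\<Sum>x\<in>X. \<bar>w x * (Q m x - (\<integral>x. q x \<partial>M))\<bar>)"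
      by (simp only: sum_abs)
    also have "\<dots> \<le> (\<Sum>x\<in>X. \<bar>w x\<bar> * (C * \<rho> ^ m * (2 * R)))"
      using diff R(2) by (intro sum_mono) (auto simp: abs_mult intro!: mult_left_mono)
    finally show ?thesis by (simp add: l1_norm_def sum_distrib_right)
  qed
  moreover have "(\<lambda>m. l1_norm X w * (C * \<rho> ^ m * (2 * R))) \<longlonglongrightarrow> l1_norm X w * (C * 0 * (2 * R))"
    using \<rho> by (intro tendsto_intros LIMSEQ_power_zero) auto
  ultimately have "\<bar>cubature X w q - (\<integral>x. q x \<partial>M)\<bar> \<le> l1_norm X w * (C * 0 * (2 * R))"
    by (intro LIMSEQ_le_const) auto
  then show ?thesis by simp
qed


subsection \<open>The cubature error\<close>

lemma cheb_grid_subset: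
  fixes a b :: "real^'n"
  assumes "\<And>i. a $ i < b $ i"
  shows "cheb_grid kind N a b \<subseteq> cbox a b"
proof
  fix x assume "x \<in> cheb_grid kind N a b"
  then have "x $ i \<in> {a $ i..b $ i}" for i
    using cheb_nodes_subset[OF less_imp_le[OF assms[of i]], of kind N] by (auto simp: cheb_grid_def)
  then show "x \<in> cbox a b" by (simp add: mem_box_cart)
qed

text \<open>The Lebesgue function of a product grid factorises: the sum over the grid of a product
  of one-dimensional terms is the product of the one-dimensional sums.\<close>

lemma lebesgue_constant_grid:
  fixes a b :: "real^'n"
  assumes ab: "\<And>i. a $ i < b $ i" and N: "N \<ge> 1" and x: "x \<in> cbox a b"
  shows "(\<Sum>y\<in>cheb_grid kind N a b. \<bar>lagrange N (cheb_grid kind N a b) y x\<bar>)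
    \<le> ((2 + 3 / ln 2) * ln (real N + 1)) ^ CARD('n)"
proof -
  define T where "T i = cheb_nodes kind N (a $ i) (b $ i)" for i
  have X: "cheb_grid kind N a b = {x. \<forall>i. x $ i \<in> T i}" by (simp add: cheb_grid_def T_def)
  have T: "finite (T i)" "card (T i) = Suc N" for i
    unfolding T_def by (rule finite_cheb_nodes, rule card_cheb_nodes[OF N ab])
  have "(\<Sum>y\<in>{x. \<forall>i. x $ i \<in> T i}. \<bar>lagrange N {x. \<forall>i. x $ i \<in> T i} y x\<bar>)
      = (\<Sum>y\<in>{x. \<forall>i. x $ i \<in> T i}. \<Prod>i\<in>UNIV. \<bar>poly (lagrange_poly (T i) (y $ i)) (x $ i)\<bar>)"
    by (intro sum.cong refl) (simp add: lagrange_tensor[OF T] abs_prod)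
  also have "\<dots> = (\<Sum>g\<in>PiE UNIV T. \<Prod>i\<in>UNIV. \<bar>poly (lagrange_poly (T i) (g i)) (x $ i)\<bar>)"
    by (rule sum.reindex_bij_witness[of _ "\<lambda>g. \<chi> i. g i" "\<lambda>y i. y $ i"]) auto
  also have "\<dots> = (\<Prod>i\<in>UNIV. \<Sum>t\<in>T i. \<bar>poly (lagrange_poly (T i) t) (x $ i)\<bar>)"
    by (rule prod_sum_PiE[symmetric]) (auto simp: T)
  also have "\<dots> \<le> (\<Prod>i\<in>(UNIV :: 'n set). (2 + 3 / ln 2) * ln (real N + 1))"
  proof (rule prod_mono, intro conjI sum_nonneg abs_ge_zero)
    fix i
    have "x $ i \<in> {a $ i..b $ i}" using x by (simp add: mem_box_cart)
    from lebesgue_constant_cheb[OF N ab this]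
    show "(\<Sum>t\<in>T i. \<bar>poly (lagrange_poly (T i) t) (x $ i)\<bar>) \<le> (2 + 3 / ln 2) * ln (real N + 1)"
      by (simp only: T_def)
  qed
  also have "\<dots> = ((2 + 3 / ln 2) * ln (real N + 1)) ^ CARD('n)" by simp
  finally show ?thesis unfolding X .
qed

lemma l1_norm_weights_le:
  fixes a b :: "real^'n"
  assumes ab: "\<And>i. a $ i < b $ i" and N: "N \<ge> 1"
    and ifs: "affine_ifs L S" and prob: "ifs_probabilities L p" and att: "is_attractor L S \<Gamma>"
    and inv: "invariant_measure L S p M" and sub: "\<Gamma> \<subseteq> cbox a b"
    and w: "cubature_weights L S p N (cheb_grid kind N a b) w"
    and Q: "ifs_invariant L S p (Q_space N)"
  shows "l1_norm (cheb_grid kind N a b) w \<le> ((2 + 3 / ln 2) * ln (real N + 1)) ^ CARD('n)"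
proof -
  interpret prob_space M using inv by (simp add: invariant_measure_def)
  define X where "X = cheb_grid kind N a b"
  define T where "T i = cheb_nodes kind N (a $ i) (b $ i)" for i
  have X: "X = {x. \<forall>i. x $ i \<in> T i}" by (simp add: X_def cheb_grid_def T_def)
  have T: "finite (T i)" "card (T i) = Suc N" for i
    unfolding T_def by (rule finite_cheb_nodes, rule card_cheb_nodes[OF N ab])
  have fin: "finite X" unfolding X by (rule finite_grid[OF T(1)])
  have w': "cubature_weights L S p N {x. \<forall>i. x $ i \<in> T i} w" using w by (simp add: X X_def[symmetric])
  have l: "lagrange N X y \<in> Q_space N" if "y \<in> X" for y
    using that unfolding X by (rule lagrange_in_Q_space[OF T])
  have int: "integrable M (lagrange N X y)" if "y \<in> X" for y
    by (rule invariant_measure_integrable[OF inv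
          total_degree_le_continuous[OF Q_space_total_degree_le[OF l[OF that]]]])
  have weight: "w y = (\<integral>x. lagrange N X y x \<partial>M)" if y: "y \<in> X" for y
  proof -
    \<comment> \<open>Invariance of the full space enters here: the Lagrange polynomials can have
      total degree up to n times \<open>N\<close>, beyond the reach of exactness for total degree
      \<open>N\<close>.\<close>
    have "\<And>q. q \<in> Q_space N \<Longrightarrow> ruelle L S p q \<in> Q_space N"
      using Q by (auto simp: ifs_invariant_def)
    from cubature_exact[OF ifs prob inv T w' order_refl this l[OF y]]
    have "cubature X w (lagrange N X y) = (\<integral>x. lagrange N X y x \<partial>M)" by (simp add: X)
    moreover have "lagrange N X y x = (if x = y then 1 else 0)" if "x \<in> X" for x
    proof -
      have "lagrange N X y x = (\<Prod>i\<in>UNIV. poly (lagrange_poly (T i) (y $ i)) (x $ i))"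
        using y unfolding X by (simp add: lagrange_tensor[OF T])
      also have "\<dots> = (if x = y then 1 else 0)"
        using that y T(1) by (intro tensor_lagrange_at_node) (auto simp: X)
      finally show ?thesis .
    qed
    then have "cubature X w (lagrange N X y) = (\<Sum>x\<in>X. if x = y then w x else 0)"
      unfolding cubature_def by (intro sum.cong refl) simp
    ultimately show ?thesis using fin y by simp
  qed
  have "l1_norm X w = (\<Sum>y\<in>X. \<bar>\<integral>x. lagrange N X y x \<partial>M\<bar>)"
    unfolding l1_norm_def by (intro sum.cong refl) (simp only: weight)
  also have "\<dots> \<le> (\<Sum>y\<in>X. \<integral>x. \<bar>lagrange N X y x\<bar> \<partial>M)"
    by (intro sum_mono integral_abs_bound)
  also have "\<dots> = (\<integral>x. (\<Sum>y\<in>X. \<bar>lagrange N X y x\<bar>) \<partial>M)"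
    using int by (intro Bochner_Integration.integral_sum[symmetric]) auto
  also have "\<dots> \<le> (\<integral>x. ((2 + 3 / ln 2) * ln (real N + 1)) ^ CARD('n) \<partial>M)"
  proof (rule integral_mono_AE)
    \<comment> \<open>The Lebesgue function is bounded on the box only, so the estimate relies on
      \<open>M\<close> being carried by the attractor inside it.\<close>
    show "AE x in M. (\<Sum>y\<in>X. \<bar>lagrange N X y x\<bar>) \<le> ((2 + 3 / ln 2) * ln (real N + 1)) ^ CARD('n)"
      using AE_in_attractor[OF ifs prob att inv]
    proof eventually_elim
      case (elim x)
      then show ?case unfolding X_def using sub by (intro lebesgue_constant_grid[OF ab N]) auto
    qed
  qed (use int in auto)
  finally show ?thesis by (simp add: X_def prob_space)
qed

text \<open>Cubature and integral agree on \<open>q\<close>, which leaves the two functionals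
  applied to \<open>f - q\<close>: the weights contribute \<open>l1_norm\<close> times
  \<open>e\<close>, the probability measure contributes \<open>e\<close> once.\<close>

lemma cubature_error:
  fixes a b :: "real^'n"
  assumes ab: "\<And>i. a $ i < b $ i" and N: "N \<ge> 1"
    and ifs: "affine_ifs L S" and prob: "ifs_probabilities L p" and att: "is_attractor L S \<Gamma>"
    and inv: "invariant_measure L S p M" and sub: "\<Gamma> \<subseteq> cbox a b"
    and w: "cubature_weights L S p N (cheb_grid kind N a b) w"
    and f: "continuous_on (cbox a b) f"
    and q: "total_degree_le N q" and e: "\<And>x. x \<in> cbox a b \<Longrightarrow> \<bar>f x - q x\<bar> \<le> e"
  shows "\<bar>cubature (cheb_grid kind N a b) w f - (LINT x:\<Gamma>|M. f x)\<bar>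
    \<le> e * (1 + l1_norm (cheb_grid kind N a b) w)"
proof -
  interpret prob_space M using inv by (simp add: invariant_measure_def)
  have sets: "sets M = sets borel" using inv by (simp add: invariant_measure_def)
  define X where "X = cheb_grid kind N a b"
  define T where "T i = cheb_nodes kind N (a $ i) (b $ i)" for i
  have X: "X = {x. \<forall>i. x $ i \<in> T i}" by (simp add: X_def cheb_grid_def T_def)
  have T: "finite (T i)" "card (T i) = Suc N" for i
    unfolding T_def by (rule finite_cheb_nodes, rule card_cheb_nodes[OF N ab])
  have w': "cubature_weights L S p N {x. \<forall>i. x $ i \<in> T i} w" using w by (simp add: X X_def[symmetric])
  have "cubature {x. \<forall>i. x $ i \<in> T i} w q = (\<integral>x. q x \<partial>M)"
  proof (rule cubature_exact[OF ifs prob inv T w'])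
    show "{q. total_degree_le N q} \<subseteq> (Q_space N :: (real^'n \<Rightarrow> real) set)"
      using total_degree_le_Q_space by blast
    show "\<And>q. q \<in> {q. total_degree_le N q} \<Longrightarrow> ruelle L S p q \<in> {q. total_degree_le N q}"
      using ruelle_total_degree_le[OF ifs] by blast
  qed (use q in simp)
  then have exact: "cubature X w q = (\<integral>x. q x \<partial>M)" by (simp only: X)
  have closed: "compact \<Gamma>" using att by (simp add: is_attractor_def)
  have AE: "AE x in M. x \<in> \<Gamma>" by (rule AE_in_attractor[OF ifs prob att inv])
  have f\<Gamma>: "continuous_on \<Gamma> f" using f sub by (rule continuous_on_subset)
  obtain B where B: "\<And>x. x \<in> \<Gamma> \<Longrightarrow> \<bar>f x\<bar> \<le> B"
    using compact_imp_bounded[OF compact_continuous_image[OF f\<Gamma> closed]]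
    unfolding bounded_iff by (metis imageI real_norm_def)
  \<comment> \<open>Nothing is known about \<open>f\<close> off the box; cutting it off outside
    \<open>\<Gamma>\<close> makes it measurable and bounded.\<close>
  have int_f: "integrable M (\<lambda>x. indicator \<Gamma> x *\<^sub>R f x)"
  proof (rule integrable_const_bound)
    show "AE x in M. norm (indicator \<Gamma> x *\<^sub>R f x) \<le> B"
      using AE by eventually_elim (simp add: B)
    show "(\<lambda>x. indicator \<Gamma> x *\<^sub>R f x) \<in> borel_measurable M"
      using borel_measurable_continuous_on_indicator[OF borel_compact[OF closed] f\<Gamma>] sets by simp
  qed
  have int_q: "integrable M q"
    by (rule invariant_measure_integrable[OF inv total_degree_le_continuous[OF q]])
  have "cubature X w f - (LINT x:\<Gamma>|M. f x)
      = (\<Sum>x\<in>X. w x * (f x - q x)) + (\<integral>x. q x - indicator \<Gamma> x *\<^sub>R f x \<partial>M)"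
    using int_f int_q exact
    by (simp add: set_lebesgue_integral_def cubature_def right_diff_distrib sum_subtractf)
  then have "\<bar>cubature X w f - (LINT x:\<Gamma>|M. f x)\<bar>
      \<le> \<bar>\<Sum>x\<in>X. w x * (f x - q x)\<bar> + \<bar>\<integral>x. q x - indicator \<Gamma> x *\<^sub>R f x \<partial>M\<bar>"
    by (simp only: abs_triangle_ineq)
  also have "\<dots> \<le> l1_norm X w * e + e"
  proof (rule add_mono)
    have "\<bar>\<Sum>x\<in>X. w x * (f x - q x)\<bar> \<le> (\<Sum>x\<in>X. \<bar>w x * (f x - q x)\<bar>)" by (rule sum_abs)
    also have "\<dots> \<le> (\<Sum>x\<in>X. \<bar>w x\<bar> * e)"
    proof (rule sum_mono)
      fix x assume "x \<in> X"
      then have "x \<in> cbox a b" using cheb_grid_subset[OF ab] by (auto simp: X_def)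
      then show "\<bar>w x * (f x - q x)\<bar> \<le> \<bar>w x\<bar> * e"
        unfolding abs_mult by (intro mult_left_mono e) auto
    qed
    finally show "\<bar>\<Sum>x\<in>X. w x * (f x - q x)\<bar> \<le> l1_norm X w * e"
      by (simp add: l1_norm_def sum_distrib_right)
    have "\<bar>\<integral>x. q x - indicator \<Gamma> x *\<^sub>R f x \<partial>M\<bar> \<le> (\<integral>x. \<bar>q x - indicator \<Gamma> x *\<^sub>R f x\<bar> \<partial>M)"
      by (rule integral_abs_bound)
    also have "\<dots> \<le> (\<integral>x. e \<partial>M)"
    proof (rule integral_mono_AE)
      show "AE x in M. \<bar>q x - indicator \<Gamma> x *\<^sub>R f x\<bar> \<le> e"
        using AE
      proof eventually_elim
        case (elim x)
        then show ?case using e[of x] sub by (auto simp: abs_minus_commute)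
      qed
    qed (use int_f int_q in auto)
    finally show "\<bar>\<integral>x. q x - indicator \<Gamma> x *\<^sub>R f x \<partial>M\<bar> \<le> e" by (simp add: prob_space)
  qed
  finally show ?thesis by (simp add: X_def algebra_simps)
qed

theorem theorem5p11:
  fixes a b :: "real^'n" and k :: nat and f :: "real^'n \<Rightarrow> real"
  assumes "\<And>i. a $ i < b $ i"
    and "C_k_on k (cbox a b) f"
  shows "\<exists>C>0. \<forall>L (S :: nat \<Rightarrow> real^'n \<Rightarrow> real^'n) p \<Gamma> M kind.
    affine_ifs L S \<and> ifs_probabilities L p \<and> is_attractor L S \<Gamma> \<and>
    invariant_measure L S p M \<and> \<Gamma> \<subseteq> cbox a b \<longrightarrow>
      (\<forall>N\<ge>1. \<forall>w. cubature_weights L S p N (cheb_grid kind N a b) w \<longrightarrow>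
         \<bar>cubature (cheb_grid kind N a b) w f - (LINT x:\<Gamma>|M. f x)\<bar>
           \<le> C * (1 + l1_norm (cheb_grid kind N a b) w) * (1 / real N ^ k)) \<and>
      ((\<forall>N. ifs_invariant L S p (Q_space N)) \<longrightarrow>
         (\<exists>c>0. \<forall>N\<ge>1. \<forall>w. cubature_weights L S p N (cheb_grid kind N a b) w \<longrightarrow>
            \<bar>cubature (cheb_grid kind N a b) w f - (LINT x:\<Gamma>|M. f x)\<bar>
              \<le> c * C * ln (real N + 1) ^ CARD('n) * (1 / real N ^ k)))"
proof -
  \<comment> \<open>\<open>jackson_box\<close> involves only the box, \<open>k\<close> and
    \<open>f\<close>, so the constant is fixed before the function system, the measure and the kind
    of nodes.\<close>
  obtain C where C: "C > 0" and approx: "\<And>N. N \<ge> 1 \<Longrightarrow>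
      \<exists>q. total_degree_le N q \<and> (\<forall>x\<in>cbox a b. \<bar>f x - q x\<bar> \<le> C / real N ^ k)"
    using jackson_box[OF assms] by blast
  show ?thesis
  proof (rule exI[of _ C], rule conjI[OF C], (rule allI)+, rule impI, elim conjE)
    fix L and S :: "nat \<Rightarrow> real^'n \<Rightarrow> real^'n" and p \<Gamma> M kind
    assume ifs: "affine_ifs L S" "ifs_probabilities L p" "is_attractor L S \<Gamma>"
      "invariant_measure L S p M" "\<Gamma> \<subseteq> cbox a b"
    let ?X = "\<lambda>N. cheb_grid kind N a b"
    have bound: "\<bar>cubature (?X N) w f - (LINT x:\<Gamma>|M. f x)\<bar>
        \<le> C * (1 + l1_norm (?X N) w) * (1 / real N ^ k)"
      if N: "1 \<le> N" and w: "cubature_weights L S p N (?X N) w" for N w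
    proof -
      obtain q where q: "total_degree_le N q" "\<And>x. x \<in> cbox a b \<Longrightarrow> \<bar>f x - q x\<bar> \<le> C / real N ^ k"
        using approx[OF N] by blast
      have "\<bar>cubature (?X N) w f - (LINT x:\<Gamma>|M. f x)\<bar> \<le> C / real N ^ k * (1 + l1_norm (?X N) w)"
        by (rule cubature_error[OF assms(1) N ifs w C_k_on_continuous[OF assms(2)] q])
      then show ?thesis by (simp add: mult_ac)
    qed
    define n where "n = CARD('n)"
    \<comment> \<open>The first summand absorbs the 1 of \<open>1 + l1_norm\<close> by means of
      \<open>ln 2 \<le> ln (N + 1)\<close>; the second is the Lebesgue constant bound. Both depend
      on the dimension only.\<close>
    define c where "c = 1 / ln 2 ^ n + (2 + 3 / ln 2 :: real) ^ n"
    have "c > 0" by (auto simp: c_def intro!: add_pos_pos zero_less_power)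
    moreover have "\<bar>cubature (?X N) w f - (LINT x:\<Gamma>|M. f x)\<bar> \<le> c * C * ln (real N + 1) ^ n * (1 / real N ^ k)"
      if Q: "\<forall>N. ifs_invariant L S p (Q_space N)"
        and N: "1 \<le> N" and w: "cubature_weights L S p N (?X N) w" for N w
    proof -
      have "ln 2 ^ n \<le> ln (real N + 1) ^ n" using N by (intro power_mono) auto
      then have "1 \<le> 1 / ln 2 ^ n * ln (real N + 1) ^ n" by (simp add: field_simps)
      moreover have "l1_norm (?X N) w \<le> (2 + 3 / ln 2) ^ n * ln (real N + 1) ^ n"
        using l1_norm_weights_le[OF assms(1) N ifs w] Q by (simp add: power_mult_distrib n_def)
      ultimately have "1 + l1_norm (?X N) w \<le> c * ln (real N + 1) ^ n"
        unfolding c_def distrib_right by (rule add_mono)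
      then have "C * (1 + l1_norm (?X N) w) * (1 / real N ^ k) \<le> C * (c * ln (real N + 1) ^ n) * (1 / real N ^ k)"
        using C by (intro mult_right_mono mult_left_mono) auto
      with bound[OF N w] show ?thesis by (simp add: mult_ac)
    qed
    ultimately show "(\<forall>N\<ge>1. \<forall>w. cubature_weights L S p N (?X N) w \<longrightarrow>
         \<bar>cubature (?X N) w f - (LINT x:\<Gamma>|M. f x)\<bar> \<le> C * (1 + l1_norm (?X N) w) * (1 / real N ^ k)) \<and>
      ((\<forall>N. ifs_invariant L S p (Q_space N)) \<longrightarrow>
         (\<exists>c>0. \<forall>N\<ge>1. \<forall>w. cubature_weights L S p N (?X N) w \<longrightarrow>
            \<bar>cubature (?X N) w f - (LINT x:\<Gamma>|M. f x)\<bar>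
              \<le> c * C * ln (real N + 1) ^ CARD('n) * (1 / real N ^ k)))"
      using bound unfolding n_def by blast
  qed
qed

end
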